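(* Let $0<p<1$, $r\in\mathbb{N}$, and $\varphi(x)=\sqrt{1-x^2}$. There are a number $n(r)\in\mathbb{N}$ and a constant $C$, independent of $f$ and $n$, such that the following holds. Let $f$ be a function on $[-1,1]$ such that $f^{(r-1)}\in AC[-1,1]$, $\varphi^rf^{(r)}\in L_1[-1,1]$, and $$\sum_{\nu=r+1}^\infty\nu^{1-2p}E_{\nu-r}(f^{(r)})_{p,\varphi^r}^p<\infty .$$ Then for any $n\ge n(r)$, $$E_n(f)_p\le\frac{C}{n^r}\left(E_{n-r}(f^{(r)})_{p,\varphi^r}+n^{2-\frac2p}\left(\sum_{\nu=n+1}^\infty\nu^{1-2p}E_{\nu-r}(f^{(r)})_{p,\varphi^r}^p\right)^{\frac1p}\right).$$
   Context: $\|f\|_p=\left(\int_{-1}^1|f(x)|^p\,dx\right)^{1/p}$. $AC[-1,1]$ is the set of absolutely continuous functions on $[-1,1]$; when $f^{(r-1)}\in AC[-1,1]$, $f^{(r)}$ denotes the a.e. defined derivative of $f^{(r-1)}$. $\mathcal{P}_n$ is the set of all algebraic polynomials of degree at most $n$. For a weight $w$ on $[-1,1]$, $E_n(f)_{p,w}=\inf_{P\in\mathcal{P}_n}\|w(f-P)\|_p$, and $E_n(f)_p=E_n(f)_{p,1}$ (weight identically $1$). *)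

theory Defs
  imports "HOL-Analysis.Analysis" "HOL-Computational_Algebra.Polynomial"
begin

text \<open>Functions on \<open>[-1,1]\<close> are represented by total functions on the reals; every notion below
  depends only on their values on \<open>{-1..1}\<close>.\<close>

text \<open>The Bochner integral of a non-integrable function is \<open>0\<close>, so this is the usual
  \<open>L\<^sub>p\<close> (quasi-)norm only for \<open>g\<close> with \<open>\<bar>g\<bar>\<close> to the power \<open>p\<close> integrable.\<close>
definition Lp_norm :: "real \<Rightarrow> (real \<Rightarrow> real) \<Rightarrow> real" where
  "Lp_norm p g = (LINT x:{-1..1}|lebesgue. \<bar>g x\<bar> powr p) powr (1 / p)"

text \<open>For \<open>0 < p \<le> 1\<close> and a bounded measurable weight \<open>w\<close>, all functions whose norm occurs here
  are in \<open>L\<^sub>p\<close> as soon as \<open>w f\<close> is in \<open>L\<^sub>1\<close>.\<close>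
definition best_approx :: "nat \<Rightarrow> (real \<Rightarrow> real) \<Rightarrow> real \<Rightarrow> (real \<Rightarrow> real) \<Rightarrow> real" where
  "best_approx n f p w =
     (INF P\<in>{P :: real poly. degree P \<le> n}. Lp_norm p (\<lambda>x. w x * (f x - poly P x)))"

definition abs_cont_on :: "real set \<Rightarrow> (real \<Rightarrow> real) \<Rightarrow> bool" where
  "abs_cont_on S f \<longleftrightarrow>
     (\<forall>\<epsilon>>0. \<exists>\<delta>>0. \<forall>(m::nat) a b.
        (\<forall>i<m. a i \<le> b i \<and> {a i..b i} \<subseteq> S) \<and>
        disjoint_family_on (\<lambda>i. {a i<..<b i}) {..<m} \<and>
        (\<Sum>i<m. b i - a i) < \<delta>
        \<longrightarrow> (\<Sum>i<m. \<bar>f (b i) - f (a i)\<bar>) < \<epsilon>)"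

text \<open>Iterated derivative on \<open>[-1,1]\<close>, one-sided at the end points. At points where the
  derivative does not exist the value is arbitrary.\<close>
primrec nth_deriv :: "nat \<Rightarrow> (real \<Rightarrow> real) \<Rightarrow> real \<Rightarrow> real" where
  "nth_deriv 0 f = f"
| "nth_deriv (Suc k) f = (\<lambda>x. vector_derivative (nth_deriv k f) (at x within {-1..1}))"

text \<open>\<open>k\<close>-th derivative in \<open>AC[-1,1]\<close>: the derivatives up to order \<open>k\<close> exist everywhere on
  \<open>[-1,1]\<close>. Then \<open>nth_deriv (Suc k) f\<close> is the almost everywhere defined derivative of
  \<open>nth_deriv k f\<close>.\<close>
definition nth_deriv_AC :: "nat \<Rightarrow> (real \<Rightarrow> real) \<Rightarrow> bool" where
  "nth_deriv_AC k f \<longleftrightarrow>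
     (\<forall>j<k. nth_deriv j f differentiable_on {-1..1}) \<and> abs_cont_on {-1..1} (nth_deriv k f)"

definition phi :: "real \<Rightarrow> real" where
  "phi x = sqrt (1 - x\<^sup>2)"

end

theory Submission
  imports Defs "HOL-Complex_Analysis.Conformal_Mappings"
begin

text \<open>Let \<open>Q\<^sub>k\<close> be a nearly best approximation to \<open>nth_deriv r f\<close> of degree \<open>2^k n - r\<close>, and let \<open>G\<^sub>k\<close> be an
  \<open>r\<close>-fold antiderivative of it. Each increment \<open>F = G\<^sub>k\<^sub>+\<^sub>1 - G\<^sub>k\<close> is a polynomial of degree at most
  \<open>N = 2^(k+1) n\<close>, and it is approximated by a polynomial of degree \<open>n\<close> with an error of order
  \<open>n^(-r) (N/n)^(2/p - 2)\<close> times the weighted quasi-norm of its \<open>r\<close>-th derivative. For this, the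
  truncated power in Taylor's formula for \<open>F (cos \<theta>)\<close> is replaced by \<open>(cos \<theta> - cos \<tau>)^(r-1)\<close> times
  a trigonometric polynomial in \<open>\<theta>\<close> close to the indicator of \<open>\<theta> < \<tau>\<close>. The resulting bound
  is an integral over \<open>\<tau>\<close>, whereas for \<open>p < 1\<close> the \<open>p\<close>-th power has to be inside; this is achieved by
  Nikolskii's inequality, as the error is dominated by the \<open>L\<^sub>1\<close> norm of a trigonometric polynomial
  of degree of order \<open>N\<close>. The errors are then summed by the triangle inequality for \<open>p\<close>-th powers,
  and monotonicity of the best approximations turns the dyadic sum into the series of the theorem.
  Nikolskii's inequality also makes \<open>phi^r Q\<^sub>k\<close> converge to \<open>phi^r nth_deriv r f\<close> in \<open>L\<^sub>1\<close>, and Hardy's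
  inequality makes \<open>G\<^sub>k\<close>, up to polynomials of degree less than \<open>r\<close>, converge to \<open>f\<close>.\<close>

section \<open>Absolutely continuous functions\<close>

text \<open>For \<open>p < 1\<close> smallness of a derivative in \<open>L_p\<close> gives no
  control of the function. The \<open>L_p\<close> estimates are therefore made for polynomials,
  where the degree pays for exchanging \<open>L_1\<close> and \<open>L_p\<close>, and the passage to
  \<open>f\<close> goes through \<open>L_1\<close>. The exponent \<open>2/p - 2\<close> is due to
  the end points: under \<open>x = cos t\<close> the measure \<open>sin t dt\<close> degenerates
  there, and for p-th powers the exchange costs \<open>N^(2-2p)\<close>, against
  \<open>N^(1-p)\<close> without the weight. Hence the variable \<tau> is cut where
  \<open>sin \<tau> = 1/l\<close>, with \<open>l\<close> of order \<open>n\<close>. On the two end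
  arcs the indicator is replaced by a constant, and only on the middle arc is it smoothed. The
  quantity estimated is \<open>Lp_mass\<close>, the p-th power of the quasi-norm, which is
  subadditive. Differentiation of absolutely continuous functions comes first because
  \<open>nth_deriv r f\<close> is a pointwise derivative with arbitrary values where none exists; it
  has to be shown that it integrates back to \<open>nth_deriv (r - 1) f\<close>.\<close>

lemma abs_cont_on_division:
  assumes "abs_cont_on S f" "e > 0"
  obtains d where "d > 0"
    "\<And>D. D division_of \<Union>D \<Longrightarrow> \<Union>D \<subseteq> S \<Longrightarrow> (\<Sum>K\<in>D. Sup K - Inf K) < d \<Longrightarrow>
       (\<Sum>K\<in>D. \<bar>f (Sup K) - f (Inf K)\<bar>) < e"
proof -
  obtain d where d: "d > 0" and H: "\<forall>(m::nat) a b.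
        (\<forall>i<m. a i \<le> b i \<and> {a i..b i} \<subseteq> S) \<and>
        disjoint_family_on (\<lambda>i. {a i<..<b i}) {..<m} \<and>
        (\<Sum>i<m. b i - a i) < d
        \<longrightarrow> (\<Sum>i<m. \<bar>f (b i) - f (a i)\<bar>) < e"
    using assms unfolding abs_cont_on_def by meson
  show thesis
  proof (rule that[OF d])
    fix D :: "real set set"
    assume D: "D division_of \<Union>D" "\<Union>D \<subseteq> S" "(\<Sum>K\<in>D. Sup K - Inf K) < d"
    note dD = division_ofD[OF D(1)]
    obtain h where h: "bij_betw h {..<card D} D"
      using ex_bij_betw_nat_finite[OF dD(1)] by (auto simp: atLeast0LessThan)
    have hD: "h i \<in> D" if "i < card D" for i
      using h that by (auto simp: bij_betw_def)
    have box: "h i = {Inf (h i)..Sup (h i)} \<and> Inf (h i) \<le> Sup (h i)" if "i < card D" for i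
    proof -
      have hi: "h i \<in> D" using hD[OF that] .
      obtain u v where uv: "h i = {u..v}" "u \<le> v"
        using dD(3,4)[OF hi] by (metis atLeastatMost_empty_iff box_real(2))
      then show ?thesis by auto
    qed
    have "(\<Sum>i<card D. \<bar>f (Sup (h i)) - f (Inf (h i))\<bar>) < e"
    proof (intro H[rule_format] conjI allI impI)
      show "disjoint_family_on (\<lambda>i. {Inf (h i)<..<Sup (h i)}) {..<card D}"
        unfolding disjoint_family_on_def
      proof (intro ballI impI)
        fix i j assume ij: "i \<in> {..<card D}" "j \<in> {..<card D}" "i \<noteq> j"
        then have "h i \<noteq> h j" using h by (auto simp: bij_betw_def inj_on_def)
        then have "interior (h i) \<inter> interior (h j) = {}" using dD(5) hD ij by auto
        then show "{Inf (h i)<..<Sup (h i)} \<inter> {Inf (h j)<..<Sup (h j)} = {}"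
          using box[of i] box[of j] ij by (metis interior_atLeastAtMost_real lessThan_iff)
      qed
      show "(\<Sum>i<card D. Sup (h i) - Inf (h i)) < d"
        using D(3) sum.reindex_bij_betw[OF h, of "\<lambda>K. Sup K - Inf K"] by simp
      show "Inf (h i) \<le> Sup (h i)" if "i < card D" for i using box[OF that] by simp
      show "{Inf (h i)..Sup (h i)} \<subseteq> S" if "i < card D" for i
        using box[OF that] hD[OF that] D(2) by auto
    qed
    then show "(\<Sum>K\<in>D. \<bar>f (Sup K) - f (Inf K)\<bar>) < e"
      using sum.reindex_bij_betw[OF h, of "\<lambda>K. \<bar>f (Sup K) - f (Inf K)\<bar>"] by simp
  qed
qed

lemma division_sum_length:
  fixes D :: "real set set"
  assumes "D division_of S"
  shows "(\<Sum>K\<in>D. Sup K - Inf K) = measure lebesgue S"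
proof -
  have "(\<Sum>K\<in>D. Sup K - Inf K) = (\<Sum>K\<in>D. measure lebesgue K)"
  proof (rule sum.cong[OF refl])
    fix K assume "K \<in> D"
    then obtain u v where "K = {u..v}" "u \<le> v"
      using division_ofD(3,4)[OF assms] by (metis atLeastatMost_empty_iff box_real(2))
    then show "Sup K - Inf K = measure lebesgue K" by simp
  qed
  then show ?thesis using content_division[OF assms] by simp
qed

text \<open>The gauge is chosen separately on \<open>N\<close> and off \<open>N\<close>. Off
  \<open>N\<close> differentiability compares each increment of \<open>f\<close> with
  \<open>g\<close> times the length. Tags in \<open>N\<close> are confined to a small open set,
  where absolute continuity makes the total increment small.\<close>

lemma abs_cont_on_has_integral:
  fixes f g :: "real \<Rightarrow> real"
  assumes ac: "abs_cont_on {a..b} f" and neg: "negligible N" and ab: "a \<le> b"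
    and der: "\<And>x. x \<in> {a..b} - N \<Longrightarrow> (f has_vector_derivative g x) (at x within {a..b})"
  shows "(g has_integral (f b - f a)) {a..b}"
proof -
  define g' where "g' = (\<lambda>x. if x \<in> N then 0 else g x)"
  have "(g' has_integral (f b - f a)) {a..b}"
    unfolding has_integral_real
  proof (intro allI impI)
    fix e :: real assume e: "e > 0"
    \<comment> \<open>The \<open>+ 1\<close> keeps the quotient meaningful for
      \<open>a = b\<close>.\<close>
    define e' where "e' = e / (2 * (b - a + 1))"
    have e': "e' > 0" using e ab by (simp add: e'_def)
    obtain \<delta> where \<delta>: "\<delta> > 0"
      "\<And>D. D division_of \<Union>D \<Longrightarrow> \<Union>D \<subseteq> {a..b} \<Longrightarrow> (\<Sum>K\<in>D. Sup K - Inf K) < \<delta> \<Longrightarrow>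
       (\<Sum>K\<in>D. \<bar>f (Sup K) - f (Inf K)\<bar>) < e/2"
      using abs_cont_on_division[OF ac half_gt_zero[OF e]] by blast
    obtain U where U: "open U" "N \<subseteq> U" "U \<in> lmeasurable" "measure lebesgue U < \<delta>"
    proof -
      have "N \<in> lmeasurable" "measure lebesgue N = 0"
        using neg by (auto simp: negligible_iff_measure)
      then obtain U where "open U" "N \<subseteq> U" "U - N \<in> lmeasurable" and em: "emeasure lebesgue (U - N) < ennreal \<delta>"
        using sets_lebesgue_outer_open[of N \<delta>] \<delta>(1) by (metis fmeasurableD)
      moreover have "U \<in> lmeasurable"
        using \<open>U - N \<in> lmeasurable\<close> \<open>N \<in> lmeasurable\<close> \<open>N \<subseteq> U\<close>
        by (metis Diff_partition fmeasurable.Un)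
      moreover have "measure lebesgue U < \<delta>"
      proof -
        have "measure lebesgue U = measure lebesgue (U - N)"
          using measure_Diff_null_set[of U lebesgue N] neg \<open>U \<in> lmeasurable\<close>
          by (simp add: negligible_iff_null_sets)
        also have "\<dots> < \<delta>" 
          using em by (simp add: emeasure_eq_measure2[OF \<open>U - N \<in> lmeasurable\<close>] ennreal_less_iff)
        finally show ?thesis .
      qed
      ultimately show ?thesis using that by blast
    qed
    have "\<forall>x. \<exists>d>0. x \<in> {a..b} - N \<longrightarrow>
         (\<forall>y\<in>{a..b}. norm (y-x) < d \<longrightarrow> norm (f y - f x - (y-x) *\<^sub>R g x) \<le> e' * norm (y-x))"
      using der[unfolded has_vector_derivative_def has_derivative_within_alt] e' by meson
    then obtain d where d: "\<And>x. 0 < d x"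
      "\<And>x y. x \<in> {a..b} - N \<Longrightarrow> y \<in> {a..b} \<Longrightarrow> norm (y-x) < d x \<Longrightarrow>
         norm (f y - f x - (y-x) *\<^sub>R g x) \<le> e' * norm (y-x)"
      by metis
    define \<gamma> where "\<gamma> = (\<lambda>x. if x \<in> N then U else ball x (d x))"
    show "\<exists>\<gamma>. gauge \<gamma> \<and> (\<forall>\<D>. \<D> tagged_division_of {a..b} \<and> \<gamma> fine \<D> \<longrightarrow>
        norm ((\<Sum>(x, k)\<in>\<D>. measure lborel k *\<^sub>R g' x) - (f b - f a)) < e)"
    proof (intro exI[of _ \<gamma>] conjI allI impI)
      show "gauge \<gamma>" using U(1,2) d(1) by (auto simp: gauge_def \<gamma>_def)
      fix p assume "p tagged_division_of {a..b} \<and> \<gamma> fine p"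
      then have p: "p tagged_division_of {a..b}" and fine: "\<gamma> fine p" by auto
      note pD = tagged_division_ofD[OF p]
      have int: "\<exists>u v. K = {u..v} \<and> u \<le> v \<and> x \<in> {u..v} \<and> {u..v} \<subseteq> {a..b}" if "(x,K) \<in> p" for x K
        using pD(2)[OF that] pD(3)[OF that] pD(4)[OF that] by (auto simp: box_real)
      define q where "q = {z \<in> p. fst z \<in> N}"
      have q: "q \<subseteq> p" "finite q" using pD(1) by (auto simp: q_def)
      have qtp: "q tagged_partial_division_of {a..b}"
        using p q(1) tagged_partial_division_subset tagged_division_of_def by blast
      have ne: "K \<noteq> {}" if "(x,K) \<in> q" for x K using pD(2)[of x K] that q(1) by blast
      \<comment> \<open>Several tags may share one interval if it is degenerate, so passing from
        tagged intervals to the set of intervals needs a summand that vanishes on degenerate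
        ones.\<close>
      define \<phi> where "\<phi> = (\<lambda>K::real set. if K = {} then 0 else \<bar>f (Sup K) - f (Inf K)\<bar>)"
      have "(\<Sum>(x,K)\<in>q. \<bar>f (Sup K) - f (Inf K)\<bar>) = (\<Sum>(x,K)\<in>q. \<phi> K)"
        using ne by (intro sum.cong) (auto simp: \<phi>_def)
      also have "\<dots> = (\<Sum>K\<in>snd ` q. \<phi> K)"
      proof (rule sum.over_tagged_division_lemma[OF tagged_partial_division_of_Union_self[OF qtp]])
        fix u v :: real assume "box u v = {}"
        then have "v \<le> u" by (simp add: box_real)
        then show "\<phi> (cbox u v) = 0" by (cases "u = v") (auto simp: \<phi>_def)
      qed
      also have "\<dots> = (\<Sum>K\<in>snd ` q. \<bar>f (Sup K) - f (Inf K)\<bar>)"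
        using ne by (intro sum.cong) (auto simp: \<phi>_def)
      also have "\<dots> < e/2"
      proof (rule \<delta>(2))
        show div: "snd ` q division_of \<Union> (snd ` q)" by (rule partial_division_of_tagged_division[OF qtp])
        show "\<Union> (snd ` q) \<subseteq> {a..b}" using pD(3) q(1) by fastforce
        have sub: "\<Union> (snd ` q) \<subseteq> U" using fine by (fastforce simp: q_def fine_def \<gamma>_def)
        have "\<Union> (snd ` q) \<in> lmeasurable" 
          using div by (rule lmeasurable_division)
        then show "(\<Sum>K\<in>snd ` q. Sup K - Inf K) < \<delta>"
          unfolding division_sum_length[OF div]
          using measure_mono_fmeasurable[OF sub _ U(3)] U(4) by (simp add: fmeasurableD)
      qed
      finally have 1: "(\<Sum>(x,K)\<in>q. \<bar>f (Sup K) - f (Inf K)\<bar>) < e/2" .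
      \<comment> \<open>Straddle estimate: the tag \<open>x\<close> lies between the end points
        \<open>u\<close> and \<open>v\<close>, so the errors \<open>e' * |u - x|\<close> and
        \<open>e' * |v - x|\<close> add up to \<open>e'\<close> times the length.\<close>
      have 2: "(\<Sum>(x,K)\<in>p-q. \<bar>measure lborel K *\<^sub>R g' x - (f (Sup K) - f (Inf K))\<bar>) \<le> (\<Sum>(x,K)\<in>p-q. e' * (Sup K - Inf K))"
      proof (rule sum_mono, clarsimp)
        fix x K assume xK: "(x,K) \<in> p" "(x,K) \<notin> q"
        then have xN: "x \<notin> N" by (auto simp: q_def)
        obtain u v where uv: "K = {u..v}" "u \<le> v" "x \<in> {u..v}" "{u..v} \<subseteq> {a..b}" using int[OF xK(1)] by blast
        have "K \<subseteq> ball x (d x)" using fineD[OF fine xK(1)] xN by (simp add: \<gamma>_def)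
        moreover have "u \<in> K" "v \<in> K" using uv by auto
        ultimately have "u \<in> ball x (d x)" "v \<in> ball x (d x)" by blast+
        then have "\<bar>u - x\<bar> < d x" "\<bar>v - x\<bar> < d x" by (auto simp: dist_real_def)
        then have A: "\<bar>f u - f x - (u - x) * g x\<bar> \<le> e' * \<bar>u - x\<bar>" "\<bar>f v - f x - (v - x) * g x\<bar> \<le> e' * \<bar>v - x\<bar>"
          using d(2)[of x u] d(2)[of x v] uv xN by auto
        have "\<bar>(v-u) * g x - (f v - f u)\<bar> \<le> e' * \<bar>u - x\<bar> + e' * \<bar>v - x\<bar>"
          using A by (simp add: algebra_simps abs_if split: if_splits)
        also have "\<dots> = e' * (v - u)" using uv(3) by (simp add: algebra_simps)
        finally show "\<bar>measure lborel K * g' x - (f (Sup K) - f (Inf K))\<bar> \<le> e' * (Sup K - Inf K)"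
          using uv xN by (simp add: g'_def)
      qed
      have len: "(\<Sum>(x,K)\<in>p. Sup K - Inf K) = b - a"
        using additive_tagged_division_1[OF ab p, of "\<lambda>x. x"] .
      have "(\<Sum>(x,K)\<in>p-q. e' * (Sup K - Inf K)) \<le> (\<Sum>(x,K)\<in>p. e' * (Sup K - Inf K))"
        using int e' by (intro sum_mono2[OF pD(1)]) fastforce+
      also have "\<dots> = e' * (b - a)"
        unfolding len[symmetric] sum_distrib_left by (simp add: case_prod_unfold)
      also have "\<dots> \<le> e/2" using ab e by (simp add: e'_def field_simps)
      finally have 3: "(\<Sum>(x,K)\<in>p-q. e' * (Sup K - Inf K)) \<le> e/2" .
      have "(\<Sum>(x, k)\<in>p. measure lborel k *\<^sub>R g' x) - (f b - f a) = (\<Sum>(x,K)\<in>p. measure lborel K *\<^sub>R g' x - (f (Sup K) - f (Inf K)))"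
        using additive_tagged_division_1[OF ab p, of f] by (simp add: sum_subtractf case_prod_unfold)
      also have "\<bar>\<dots>\<bar> \<le> (\<Sum>(x,K)\<in>p. \<bar>measure lborel K *\<^sub>R g' x - (f (Sup K) - f (Inf K))\<bar>)"
        by (rule order_trans[OF sum_abs]) (simp add: case_prod_unfold)
      also have "\<dots> = (\<Sum>(x,K)\<in>q. \<bar>measure lborel K *\<^sub>R g' x - (f (Sup K) - f (Inf K))\<bar>) +
           (\<Sum>(x,K)\<in>p-q. \<bar>measure lborel K *\<^sub>R g' x - (f (Sup K) - f (Inf K))\<bar>)"
        using sum.subset_diff[OF q(1) pD(1)] by (simp add: add.commute)
      also have "(\<Sum>(x,K)\<in>q. \<bar>measure lborel K *\<^sub>R g' x - (f (Sup K) - f (Inf K))\<bar>) = (\<Sum>(x,K)\<in>q. \<bar>f (Sup K) - f (Inf K)\<bar>)"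
        by (rule sum.cong) (auto simp: q_def g'_def)
      finally show "norm ((\<Sum>(x, k)\<in>p. measure lborel k *\<^sub>R g' x) - (f b - f a)) < e"
        using 1 2 3 by simp
    qed
  qed
  then show ?thesis
    by (rule has_integral_spike[OF neg, rotated]) (auto simp: g'_def)
qed

section \<open>Almost everywhere differentiability by Vitali coverings\<close>

lemma division_sum_diff:
  fixes f :: "real \<Rightarrow> real"
  assumes "D division_of {a..b}" "a \<le> b"
  shows "(\<Sum>K\<in>D. f (Sup K) - f (Inf K)) = f b - f a"
proof -
  let ?f = "(\<lambda>K::real set. if K = {} then 0 else f(interval_upperbound K) - f(interval_lowerbound K))"
  interpret operative_real plus 0 ?f
    rewrites "comm_monoid_set.F (+) 0 = sum"
    by standard[1] (auto simp add: sum_def)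
  have "(\<Sum>K\<in>D. f (Sup K) - f (Inf K)) = sum ?f D"
  proof (rule sum.cong[OF refl])
    fix K assume "K \<in> D"
    then obtain u v where "K = {u..v}" "u \<le> v"
      using division_ofD(3,4)[OF assms(1)] by (metis atLeastatMost_empty_iff box_real(2))
    then show "f (Sup K) - f (Inf K) = ?f K" by simp
  qed
  also have "\<dots> = ?f (cbox a b)"
    using division[of D a b] assms by (simp add: box_real)
  also have "\<dots> = f b - f a" using assms(2) by simp
  finally show ?thesis .
qed

text \<open>Vitali's theorem yields countably many disjoint intervals covering almost all of
  \<open>E\<close>, and continuity of measure cuts them down to finitely many. As \<open>E\<close>
  may be nonmeasurable, what is left of it is enclosed in a measurable set \<open>Z\<close>.\<close>

lemma Vitali_finite_intervals:
  fixes U E :: "real set"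
  assumes "open U" "bounded U" "E \<subseteq> U" "e > 0"
    and Q: "\<And>x d. x \<in> E \<Longrightarrow> d > 0 \<Longrightarrow> \<exists>u v. u < v \<and> v - u < d \<and> x \<in> {u..v} \<and> Q u v"
  obtains D Z where "D division_of \<Union>D" "\<Union>D \<subseteq> U"
    "\<And>K K'. K \<in> D \<Longrightarrow> K' \<in> D \<Longrightarrow> K \<noteq> K' \<Longrightarrow> K \<inter> K' = {}"
    "\<And>K. K \<in> D \<Longrightarrow> \<exists>u v. K = {u..v} \<and> u < v \<and> Q u v"
    "E \<subseteq> \<Union>D \<union> Z" "Z \<in> lmeasurable" "measure lebesgue Z < e"
proof -
  define I where "I = {(u,v). u < v \<and> {u..v} \<subseteq> U \<and> Q u v}"
  define cen where "cen = (\<lambda>(u::real,v). (u+v)/2)"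
  define rad where "rad = (\<lambda>(u::real,v). (v-u)/2)"
  have cb: "cball (cen i) (rad i) = {fst i..snd i}" for i
    by (cases i) (auto simp: cball_eq_atLeastAtMost cen_def rad_def field_simps)
  obtain C where C: "countable C" "C \<subseteq> I"
     "pairwise (\<lambda>i j. disjnt (cball (cen i) (rad i)) (cball (cen j) (rad j))) C"
     "negligible(E - (\<Union>i \<in> C. cball (cen i) (rad i)))"
  proof (rule Vitali_covering_theorem_cballs[of I rad E cen])
    show "0 < rad i" if "i \<in> I" for i using that by (auto simp: I_def rad_def)
    fix x d :: real assume x: "x \<in> E" and d: "0 < d"
    obtain d' where d': "d' > 0" "ball x d' \<subseteq> U" using x assms(1,3) by (meson openE subsetD)
    obtain u v where uv: "u < v" "v - u < min d d'" "x \<in> {u..v}" "Q u v"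
      using Q[OF x, of "min d d'"] d d' by auto
    have "{u..v} \<subseteq> ball x d'" using uv by (auto simp: dist_real_def)
    then have "(u,v) \<in> I" using uv d' by (auto simp: I_def)
    moreover have "x \<in> cball (cen (u,v)) (rad (u,v))" using uv(3) by (simp add: cb)
    moreover have "rad (u,v) < d" using uv by (simp add: rad_def)
    ultimately show "\<exists>i. i \<in> I \<and> x \<in> cball (cen i) (rad i) \<and> rad i < d" by blast
  qed
  define J where "J = (\<lambda>i::real\<times>real. {fst i..snd i})"
  have IJ: "J i \<subseteq> U" "\<exists>u v. J i = {u..v} \<and> u < v \<and> Q u v" if "i \<in> I" for i
    using that by (auto simp: I_def J_def)
  have dj: "J i \<inter> J j = {}" if "i \<in> C" "j \<in> C" "i \<noteq> j" for i j
    using C(3) that by (auto simp: pairwise_def cb J_def disjnt_def)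
  have neg: "negligible (E - (\<Union>i\<in>C. J i))" using C(4) by (simp add: cb J_def)
  have main: "\<exists>F. finite F \<and> F \<subseteq> C \<and> (\<exists>Z. E \<subseteq> (\<Union>i\<in>F. J i) \<union> Z \<and> Z \<in> lmeasurable \<and> measure lebesgue Z < e)"
  proof (cases "C = {}")
    case True
    then have "negligible E" using neg by simp
    then show ?thesis using assms(4) by (intro exI[of _ "{}"]) (auto intro!: exI[of _ E] simp: negligible_iff_measure)
  next
    case False
    \<comment> \<open>Finite unions exhausting the covering. Their measures converge to that of
      \<open>B\<close>, which is finite because \<open>B\<close> lies in the bounded set
      \<open>U\<close>.\<close>
    define A where "A = (\<lambda>n. \<Union>i<n::nat. J (from_nat_into C i))"
    define B where "B = (\<Union>i\<in>C. J i)"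
    have Ul: "U \<in> lmeasurable" using assms(1,2) by (rule lmeasurable_open[rotated])
    have BU: "B \<subseteq> U" using IJ(1) C(2) unfolding B_def by blast
    have Jl: "J i \<in> lmeasurable" for i by (simp add: J_def)
    have Al: "A n \<in> lmeasurable" for n unfolding A_def by (intro fmeasurable.finite_UN) (auto simp: Jl)
    have AB: "(\<Union>n. A n) = B"
    proof
      show "(\<Union>n. A n) \<subseteq> B" using from_nat_into[OF False] unfolding A_def B_def by blast
      show "B \<subseteq> (\<Union>n. A n)"
      proof
        fix x assume "x \<in> B"
        then obtain i where "i \<in> C" "x \<in> J i" by (auto simp: B_def)
        then obtain k where "i = from_nat_into C k" using C(1) by (metis from_nat_into_surj)
        then have "x \<in> A (Suc k)" using \<open>x \<in> J i\<close> by (auto simp: A_def)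
        then show "x \<in> (\<Union>n. A n)" by blast
      qed
    qed
    have Bl: "B \<in> lmeasurable"
      using BU Ul C(1) unfolding B_def
      by (intro fmeasurableI2[OF Ul]) (auto intro!: sets.countable_UN' fmeasurableD[OF Jl])
    have "(\<lambda>n. measure lebesgue (A n)) \<longlonglongrightarrow> measure lebesgue (\<Union>n. A n)"
    proof (rule Lim_measure_incseq)
      show "range A \<subseteq> sets lebesgue" using Al by (auto intro: fmeasurableD)
      show "incseq A" unfolding A_def incseq_def by (intro allI impI UN_mono) auto
      show "emeasure lebesgue (\<Union>n. A n) \<noteq> \<infinity>" unfolding AB using Bl by (auto simp: fmeasurable_def)
    qed
    then have "(\<lambda>n. measure lebesgue (A n)) \<longlonglongrightarrow> measure lebesgue B" by (simp add: AB)
    then have "\<forall>\<^sub>F n in sequentially. measure lebesgue (A n) > measure lebesgue B - e"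
      using assms(4) by (intro order_tendstoD) auto
    then obtain n where n: "measure lebesgue (A n) > measure lebesgue B - e"
      by (auto simp: eventually_sequentially)
    have AnB: "A n \<subseteq> B" using AB by blast
    have "measure lebesgue (B - A n) = measure lebesgue B - measure lebesgue (A n)"
      using AnB Al Bl by (simp add: measurable_measure_Diff fmeasurableD)
    then have sm: "measure lebesgue (B - A n) < e" using n by simp
    show ?thesis
    proof (intro exI[of _ "from_nat_into C ` {..<n}"] conjI)
      show "from_nat_into C ` {..<n} \<subseteq> C" using from_nat_into[OF False] by auto
      let ?Z = "(B - A n) \<union> (E - B)"
      have E: "E - B \<in> lmeasurable" "measure lebesgue (E - B) = 0" using neg by (auto simp: B_def negligible_iff_measure)
      have "measure lebesgue ?Z \<le> measure lebesgue (B - A n) + measure lebesgue (E - B)"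
        using Bl Al E by (intro measure_Un_le) (auto intro: fmeasurableD)
      then have "measure lebesgue ?Z < e" using sm E by simp
      moreover have "E \<subseteq> (\<Union>i\<in>from_nat_into C ` {..<n}. J i) \<union> ?Z" by (auto simp: A_def)
      moreover have "?Z \<in> lmeasurable" using Bl Al E by blast
      ultimately show "\<exists>Z. E \<subseteq> (\<Union>i\<in>from_nat_into C ` {..<n}. J i) \<union> Z \<and> Z \<in> lmeasurable \<and> measure lebesgue Z < e" by blast
    qed simp
  qed
  then obtain F Z where F: "finite F" "F \<subseteq> C" "E \<subseteq> (\<Union>i\<in>F. J i) \<union> Z" "Z \<in> lmeasurable" "measure lebesgue Z < e"
    by blast
  show thesis
  proof (rule that[of "J ` F" Z])
    show "J ` F division_of \<Union> (J ` F)"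
    proof (rule division_ofI)
      fix K assume "K \<in> J ` F"
      then obtain i where i: "i \<in> F" "K = J i" by blast
      then show "K \<subseteq> \<Union> (J ` F)" by blast
      obtain u v where "J i = {u..v}" "u < v" using IJ(2)[of i] i F(2) C(2) by blast
      then show "K \<noteq> {}" "\<exists>a b. K = cbox a b" using i by auto
    next
      fix K1 K2 assume "K1 \<in> J ` F" "K2 \<in> J ` F" "K1 \<noteq> K2"
      then have "K1 \<inter> K2 = {}" using dj F(2) by blast
      then show "interior K1 \<inter> interior K2 = {}" using interior_subset by blast
    qed (use F in auto)
    show "K \<inter> K' = {}" if "K \<in> J ` F" "K' \<in> J ` F" "K \<noteq> K'" for K K'
      using dj F(2) that by blast
    show "\<Union> (J ` F) \<subseteq> U" using IJ(1) F(2) C(2) by blast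
    show "\<exists>u v. K = {u..v} \<and> u < v \<and> Q u v" if "K \<in> J ` F" for K using that IJ(2) F(2) C(2) by blast
  qed (use F in auto)
qed

lemma abs_cont_on_diff_linear:
  assumes "abs_cont_on S f"
  shows "abs_cont_on S (\<lambda>x. f x - c * x)"
  unfolding abs_cont_on_def
proof (intro allI impI)
  fix e :: real assume e: "e > 0"
  obtain d where d: "d > 0" and H: "\<forall>(m::nat) a b.
        (\<forall>i<m. a i \<le> b i \<and> {a i..b i} \<subseteq> S) \<and>
        disjoint_family_on (\<lambda>i. {a i<..<b i}) {..<m} \<and>
        (\<Sum>i<m. b i - a i) < d
        \<longrightarrow> (\<Sum>i<m. \<bar>f (b i) - f (a i)\<bar>) < e/2"
    using assms[unfolded abs_cont_on_def, rule_format, OF half_gt_zero[OF e]] by blast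
  define d' where "d' = min d (e / (2 * (\<bar>c\<bar> + 1)))"
  show "\<exists>\<delta>>0. \<forall>(m::nat) a b.
        (\<forall>i<m. a i \<le> b i \<and> {a i..b i} \<subseteq> S) \<and>
        disjoint_family_on (\<lambda>i. {a i<..<b i}) {..<m} \<and>
        (\<Sum>i<m. b i - a i) < \<delta>
        \<longrightarrow> (\<Sum>i<m. \<bar>(f (b i) - c * b i) - (f (a i) - c * a i)\<bar>) < e"
  proof (intro exI[of _ d'] conjI allI impI)
    show "d' > 0" using d e by (auto simp: d'_def add_nonneg_pos)
    fix m :: nat and a b :: "nat \<Rightarrow> real"
    assume A: "(\<forall>i<m. a i \<le> b i \<and> {a i..b i} \<subseteq> S) \<and>
        disjoint_family_on (\<lambda>i. {a i<..<b i}) {..<m} \<and> (\<Sum>i<m. b i - a i) < d'"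
    then have 1: "(\<Sum>i<m. \<bar>f (b i) - f (a i)\<bar>) < e/2" using H by (auto simp: d'_def)
    have "(\<Sum>i<m. \<bar>(f (b i) - c * b i) - (f (a i) - c * a i)\<bar>) \<le> (\<Sum>i<m. \<bar>f (b i) - f (a i)\<bar> + \<bar>c\<bar> * (b i - a i))"
    proof (rule sum_mono)
      fix i assume "i \<in> {..<m}"
      then have "a i \<le> b i" using A by auto
      then have "\<bar>c * (b i - a i)\<bar> = \<bar>c\<bar> * (b i - a i)" by (simp add: abs_mult)
      then show "\<bar>(f (b i) - c * b i) - (f (a i) - c * a i)\<bar> \<le> \<bar>f (b i) - f (a i)\<bar> + \<bar>c\<bar> * (b i - a i)"
        by (simp add: algebra_simps)
    qed
    also have "\<dots> = (\<Sum>i<m. \<bar>f (b i) - f (a i)\<bar>) + \<bar>c\<bar> * (\<Sum>i<m. b i - a i)"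
      by (simp add: sum.distrib sum_distrib_left)
    also have "\<bar>c\<bar> * (\<Sum>i<m. b i - a i) \<le> \<bar>c\<bar> * (e / (2 * (\<bar>c\<bar> + 1)))"
      using A by (intro mult_left_mono) (auto simp: d'_def)
    also have "\<dots> \<le> e/2" using e by (simp add: field_simps)
    finally show "(\<Sum>i<m. \<bar>(f (b i) - c * b i) - (f (a i) - c * a i)\<bar>) < e" using 1 by linarith
  qed
qed

text \<open>Disjoint intervals that are short in total and on which the slope is at least
  \<open>M\<close> in modulus have total length below \<open>1/M\<close>, because the increments of
  \<open>f\<close> over them sum to less than \<open>1\<close>. With \<open>M = 2/e\<close> such
  intervals cover the set up to measure \<open>e/2\<close>.\<close>

lemma abs_cont_on_unbounded_quotient_negligible:
  fixes f :: "real \<Rightarrow> real"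
  assumes ac: "abs_cont_on {a..b} f" and E: "E \<subseteq> {a<..<b}"
    and Q: "\<And>x d M. x \<in> E \<Longrightarrow> d > 0 \<Longrightarrow>
      \<exists>u v. u < v \<and> v - u < d \<and> x \<in> {u..v} \<and> M * (v - u) \<le> \<bar>f v - f u\<bar>"
  shows "negligible E"
proof -
  obtain \<delta> where \<delta>: "\<delta> > 0"
    "\<And>D. D division_of \<Union>D \<Longrightarrow> \<Union>D \<subseteq> {a..b} \<Longrightarrow> (\<Sum>K\<in>D. Sup K - Inf K) < \<delta> \<Longrightarrow>
       (\<Sum>K\<in>D. \<bar>f (Sup K) - f (Inf K)\<bar>) < 1"
    using abs_cont_on_division[OF ac zero_less_one] by blast
  \<comment> \<open>Negligibility is a local property, and a ball of length
    \<open>2 \<delta> / 3\<close> makes every disjoint family inside it short enough for the choice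
    of \<delta>.\<close>
  have loc: "negligible (E \<inter> ball x (\<delta>/3))" for x
    unfolding negligible_outer_le
  proof (intro allI impI)
    fix e :: real assume e: "e > 0"
    obtain D Z where D: "D division_of \<Union>D" "\<Union>D \<subseteq> ball x (\<delta>/3) \<inter> {a<..<b}"
      "\<And>K. K \<in> D \<Longrightarrow> \<exists>u v. K = {u..v} \<and> u < v \<and> (2/e) * (v - u) \<le> \<bar>f v - f u\<bar>"
      and Z: "E \<inter> ball x (\<delta>/3) \<subseteq> \<Union>D \<union> Z" "Z \<in> lmeasurable" "measure lebesgue Z < e/2"
    proof (rule Vitali_finite_intervals[of "ball x (\<delta>/3) \<inter> {a<..<b}" "E \<inter> ball x (\<delta>/3)" "e/2" "\<lambda>u v. (2/e) * (v - u) \<le> \<bar>f v - f u\<bar>"])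
      show "\<exists>u v. u < v \<and> v - u < d \<and> y \<in> {u..v} \<and> 2 / e * (v - u) \<le> \<bar>f v - f u\<bar>"
        if "y \<in> E \<inter> ball x (\<delta>/3)" "d > 0" for y d using Q[of y d "2/e"] that by blast
      show "E \<inter> ball x (\<delta>/3) \<subseteq> ball x (\<delta>/3) \<inter> {a<..<b}" using E by auto
    qed (use e in \<open>auto simp: bounded_Int\<close>)
    have Dl: "\<Union>D \<in> lmeasurable" using D(1) by (rule lmeasurable_division)
    have "measure lebesgue (\<Union>D) \<le> measure lebesgue (ball x (\<delta>/3))"
      using D(2) Dl by (intro measure_mono_fmeasurable) (auto intro: fmeasurableD)
    also have "ball x (\<delta>/3) = {x - \<delta>/3 <..< x + \<delta>/3}" by (rule ball_eq_greaterThanLessThan)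
    also have "measure lebesgue \<dots> < \<delta>" using \<delta>(1) by simp
    finally have "(\<Sum>K\<in>D. \<bar>f (Sup K) - f (Inf K)\<bar>) < 1"
      using D(2) by (intro \<delta>(2)[OF D(1)]) (fastforce simp: division_sum_length[OF D(1)])+
    moreover have "(\<Sum>K\<in>D. (2/e) * (Sup K - Inf K)) \<le> (\<Sum>K\<in>D. \<bar>f (Sup K) - f (Inf K)\<bar>)"
    proof (rule sum_mono)
      fix K assume "K \<in> D"
      then obtain u v where "K = {u..v}" "u < v" "(2/e) * (v - u) \<le> \<bar>f v - f u\<bar>" using D(3) by blast
      then show "(2/e) * (Sup K - Inf K) \<le> \<bar>f (Sup K) - f (Inf K)\<bar>" by simp
    qed
    ultimately have "(2/e) * measure lebesgue (\<Union>D) < 1"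
      by (simp only: sum_distrib_left[symmetric] division_sum_length[OF D(1)])
    then have sm: "measure lebesgue (\<Union>D) < e/2" using e by (simp add: field_simps)
    have "measure lebesgue (\<Union>D \<union> Z) \<le> measure lebesgue (\<Union>D) + measure lebesgue Z"
      using Dl Z by (intro measure_Un_le) (auto intro: fmeasurableD)
    then show "\<exists>T. E \<inter> ball x (\<delta> / 3) \<subseteq> T \<and> T \<in> lmeasurable \<and> measure lebesgue T \<le> e"
      using Z sm Dl by (intro exI[of _ "\<Union>D \<union> Z"] conjI fmeasurable.Un) linarith+
  qed
  show ?thesis
  proof (rule iffD2[OF locally_negligible_alt], intro ballI exI conjI)
    fix x assume "x \<in> E"
    show "openin (top_of_set E) (E \<inter> ball x (\<delta>/3))" by (simp add: openin_open_Int)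
    show "x \<in> E \<inter> ball x (\<delta>/3)" using \<open>x \<in> E\<close> \<delta> by simp
    show "negligible (E \<inter> ball x (\<delta>/3))" by (rule loc)
  qed
qed

text \<open>\<open>E\<close> is covered almost exactly by disjoint intervals on which
  \<open>f\<close> falls, and inside these again by intervals on which \<open>f\<close> rises. The
  gaps between the two families are then short, yet \<open>f\<close> must fall on them by at least
  \<kappa> times the total length of the first family. Absolute continuity makes this length
  small.\<close>

lemma abs_cont_on_opposite_quotients_negligible:
  fixes f :: "real \<Rightarrow> real"
  assumes ac: "abs_cont_on {a..b} f" and E: "E \<subseteq> {a<..<b}" and \<kappa>: "\<kappa> > 0"
    and neg: "\<And>x d. x \<in> E \<Longrightarrow> d > 0 \<Longrightarrow>
      \<exists>u v. u < v \<and> v - u < d \<and> x \<in> {u..v} \<and> f v - f u \<le> - \<kappa> * (v - u)"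
    and pos: "\<And>x d. x \<in> E \<Longrightarrow> d > 0 \<Longrightarrow>
      \<exists>u v. u < v \<and> v - u < d \<and> x \<in> {u..v} \<and> f v - f u \<ge> \<kappa> * (v - u)"
  shows "negligible E"
  unfolding negligible_outer_le
proof (intro allI impI)
  let ?\<mu> = "measure lebesgue"
  fix e :: real assume e: "e > 0"
  obtain \<delta>0 where \<delta>0: "\<delta>0 > 0"
    "\<And>D. D division_of \<Union>D \<Longrightarrow> \<Union>D \<subseteq> {a..b} \<Longrightarrow> (\<Sum>K\<in>D. Sup K - Inf K) < \<delta>0 \<Longrightarrow>
       (\<Sum>K\<in>D. \<bar>f (Sup K) - f (Inf K)\<bar>) < \<kappa> * (e/2)"
    using abs_cont_on_division[OF ac mult_pos_pos[OF \<kappa> half_gt_zero[OF e]]] by blast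
  define \<delta> where "\<delta> = min \<delta>0 e"
  have \<delta>: "\<delta> > 0" "\<delta> \<le> \<delta>0" "\<delta> \<le> e" using \<delta>0(1) e by (auto simp: \<delta>_def)
  \<comment> \<open>\<open>m\<close> is the outer measure of \<open>E\<close>; the coverings are
    compared with it because \<open>E\<close> may be nonmeasurable.\<close>
  define M where "M = {?\<mu> T | T. T \<in> lmeasurable \<and> E \<subseteq> T}"
  define m where "m = Inf M"
  have M: "M \<noteq> {}" "bdd_below M"
    using E by (auto simp: M_def intro!: exI[of _ "{a<..<b}"] bdd_belowI[of _ 0])
  have mle: "m \<le> ?\<mu> T" if "T \<in> lmeasurable" "E \<subseteq> T" for T
    unfolding m_def using that M by (intro cInf_lower) (auto simp: M_def)
  obtain T where T: "T \<in> lmeasurable" "E \<subseteq> T" "?\<mu> T < m + \<delta>/4"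
    using cInf_lessD[OF M(1), of "m + \<delta>/4"] \<delta> by (auto simp: m_def M_def)
  obtain U where U: "open U" "T \<subseteq> U" "U - T \<in> lmeasurable" "emeasure lebesgue (U - T) < ennreal (\<delta>/4)"
    using sets_lebesgue_outer_open[OF fmeasurableD[OF T(1)] divide_pos_pos[OF \<delta>(1) zero_less_numeral]] by blast
  have UT: "?\<mu> (U - T) < \<delta>/4" using U(4) by (simp add: emeasure_eq_measure2[OF U(3)] ennreal_less_iff)
  have "U = T \<union> (U - T)" using U(2) by blast
  then have Ul: "U \<in> lmeasurable" and "?\<mu> U \<le> ?\<mu> T + ?\<mu> (U - T)"
    using T(1) U(3) by (metis fmeasurable.Un, metis measure_Un_le fmeasurableD)
  then have Um: "?\<mu> U < m + \<delta>/2" using UT T(3) by linarith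
  define U' where "U' = U \<inter> {a<..<b}"
  obtain D Z where D: "D division_of \<Union>D" "\<Union>D \<subseteq> U'"
    "\<And>K K'. K \<in> D \<Longrightarrow> K' \<in> D \<Longrightarrow> K \<noteq> K' \<Longrightarrow> K \<inter> K' = {}"
    "\<And>K. K \<in> D \<Longrightarrow> \<exists>u v. K = {u..v} \<and> u < v \<and> f v - f u \<le> - \<kappa> * (v - u)"
    and Z: "E \<subseteq> \<Union>D \<union> Z" "Z \<in> lmeasurable" "?\<mu> Z < \<delta>/8"
  proof (rule Vitali_finite_intervals[of U' E "\<delta>/8" "\<lambda>u v. f v - f u \<le> - \<kappa> * (v - u)"])
    show "open U'" "bounded U'" using U(1) by (auto simp: U'_def intro: bounded_subset[of "{a<..<b}"])
    show "E \<subseteq> U'" using E U(2) T(2) by (auto simp: U'_def)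
    show "\<exists>u v. u < v \<and> v - u < d \<and> x \<in> {u..v} \<and> f v - f u \<le> - \<kappa> * (v - u)" if "x \<in> E" "d > 0" for x d
      using neg[OF that] .
  qed (use \<delta> in auto)
  note dD = division_ofD[OF D(1)]
  \<comment> \<open>An error of \<open>t\<close> in each of the \<open>card D\<close> inner
    coverings adds up to at most \<open>\<delta>/8\<close>.\<close>
  define t where "t = \<delta> / (8 * (real (card D) + 1))"
  have t: "t > 0" "real (card D) * t \<le> \<delta>/8" using \<delta> by (auto simp: t_def field_simps)
  define P where "P = (\<lambda>K D2 Z2. D2 division_of \<Union>D2 \<and> \<Union>D2 \<subseteq> interior K \<and>
      (\<forall>L\<in>D2. \<exists>u v. L = {u..v} \<and> u < v \<and> f v - f u \<ge> \<kappa> * (v - u)) \<and>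
      E \<inter> interior K \<subseteq> \<Union>D2 \<union> Z2 \<and> Z2 \<in> lmeasurable \<and> ?\<mu> Z2 < t)"
  have "\<exists>D2 Z2. P K D2 Z2" if "K \<in> D" for K
  proof -
    have bK: "bounded (interior K)" using D(4)[OF that] by (auto intro: bounded_subset[OF _ interior_subset])
    obtain D2 Z2 where "D2 division_of \<Union>D2" "\<Union>D2 \<subseteq> interior K"
      "\<And>L. L \<in> D2 \<Longrightarrow> \<exists>u v. L = {u..v} \<and> u < v \<and> f v - f u \<ge> \<kappa> * (v - u)"
      "E \<inter> interior K \<subseteq> \<Union>D2 \<union> Z2" "Z2 \<in> lmeasurable" "?\<mu> Z2 < t"
      by (rule Vitali_finite_intervals[of "interior K" "E \<inter> interior K" t "\<lambda>u v. f v - f u \<ge> \<kappa> * (v - u)"])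
         (use bK t pos in auto)
    then show ?thesis unfolding P_def by blast
  qed
  then obtain D2 Z2 where P: "\<And>K. K \<in> D \<Longrightarrow> P K (D2 K) (Z2 K)" by metis
  have D2: "D2 K division_of \<Union>(D2 K)" "\<Union>(D2 K) \<subseteq> interior K"
      "\<And>L. L \<in> D2 K \<Longrightarrow> \<exists>u v. L = {u..v} \<and> u < v \<and> f v - f u \<ge> \<kappa> * (v - u)"
    and Z2: "E \<inter> interior K \<subseteq> \<Union>(D2 K) \<union> Z2 K" "Z2 K \<in> lmeasurable" "?\<mu> (Z2 K) < t" if "K \<in> D" for K
    using P[OF that] by (simp_all add: P_def)
  have "\<exists>r. D2 K \<subseteq> r \<and> r division_of K" if "K \<in> D" for K
  proof -
    have "\<exists>u v. K = cbox u v" using dD(4)[OF that] .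
    then obtain u v where uv: "K = cbox u v" by blast
    have "\<Union>(D2 K) \<subseteq> cbox u v" using D2(2) \<open>K \<in> D\<close> interior_subset uv by blast
    then obtain q where "D2 K \<subseteq> q" "q division_of cbox u v" 
      using partial_division_extend_interval[OF D2(1)] \<open>K \<in> D\<close> by blast
    then show ?thesis using uv by blast
  qed
  then obtain r where r: "\<And>K. K \<in> D \<Longrightarrow> D2 K \<subseteq> r K" "\<And>K. K \<in> D \<Longrightarrow> r K division_of K" by metis
  \<comment> \<open>The gaps: the intervals that complete the rising intervals \<open>D2 K\<close>
    to a division of \<open>K\<close>.\<close>
  define G where "G = (\<lambda>K. r K - D2 K)"
  have GK: "finite (G K)" "\<And>L. L \<in> G K \<Longrightarrow> L \<subseteq> K \<and> L \<noteq> {}" if "K \<in> D" for K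
    using division_ofD[OF r(2)[OF that]] by (auto simp: G_def)
  have Gdj: "G K \<inter> G K' = {}" if "K \<in> D" "K' \<in> D" "K \<noteq> K'" for K K'
    using GK(2)[OF that(1)] GK(2)[OF that(2)] D(3)[OF that] by blast
  have sumG: "(\<Sum>L\<in>(\<Union>K\<in>D. G K). F L) = (\<Sum>K\<in>D. (\<Sum>L\<in>r K. F L) - (\<Sum>L\<in>D2 K. F L))" for F :: "real set \<Rightarrow> real"
  proof -
    have "(\<Sum>L\<in>(\<Union>K\<in>D. G K). F L) = (\<Sum>K\<in>D. \<Sum>L\<in>G K. F L)"
      using dD(1) GK(1) Gdj by (intro sum.UNION_disjoint) auto
    also have "\<dots> = (\<Sum>K\<in>D. (\<Sum>L\<in>r K. F L) - (\<Sum>L\<in>D2 K. F L))"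
      using r division_ofD(1)[OF r(2)] by (intro sum.cong) (auto simp: G_def sum_diff)
    finally show ?thesis .
  qed
  have Gdiv: "(\<Union>K\<in>D. G K) division_of \<Union>(\<Union>K\<in>D. G K)"
  proof (rule division_ofI)
    show "finite (\<Union>K\<in>D. G K)" using dD(1) GK(1) by blast
    fix L assume "L \<in> (\<Union>K\<in>D. G K)"
    then obtain K where K: "K \<in> D" "L \<in> r K" by (auto simp: G_def)
    then show "L \<noteq> {}" "\<exists>a b. L = cbox a b" using division_ofD(3,4)[OF r(2)[OF K(1)]] by auto
  next
    fix L1 L2 assume "L1 \<in> (\<Union>K\<in>D. G K)" "L2 \<in> (\<Union>K\<in>D. G K)" and ne: "L1 \<noteq> L2"
    then obtain K1 K2 where K: "K1 \<in> D" "L1 \<in> G K1" "K2 \<in> D" "L2 \<in> G K2" by blast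
    show "interior L1 \<inter> interior L2 = {}"
    proof (cases "K1 = K2")
      case True
      then show ?thesis using division_ofD(5)[OF r(2)[OF K(1)]] K ne by (auto simp: G_def)
    next
      case False
      then have "L1 \<inter> L2 = {}" using D(3)[OF K(1,3)] GK(2) K by blast
      then show ?thesis using interior_subset by blast
    qed
  qed auto
  have muD: "(\<Sum>K\<in>D. ?\<mu> K) = ?\<mu> (\<Union>D)" by (rule content_division[OF D(1)])
  have Dl: "\<Union>D \<in> lmeasurable" using D(1) by (rule lmeasurable_division)
  have D2l: "\<Union>(D2 K) \<in> lmeasurable" if "K \<in> D" for K using D2(1)[OF that] by (rule lmeasurable_division)
  have muDle: "?\<mu> (\<Union>D) \<le> ?\<mu> U"
    using D(2) Dl Ul by (intro measure_mono_fmeasurable) (auto simp: U'_def intro: fmeasurableD)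
  \<comment> \<open>The rising intervals, the exceptional sets and the end points of the intervals
    in \<open>D\<close> still cover \<open>E\<close>. Hence the rising intervals have total length
    more than \<open>m - \<delta>/4\<close>.\<close>
  have "m \<le> ?\<mu> ((\<Union>K\<in>D. (\<Union>(D2 K) \<union> Z2 K) \<union> frontier K) \<union> Z)"
  proof (rule mle)
    have fl: "frontier K \<in> lmeasurable" if "K \<in> D" for K
      using D(4)[OF that] by (auto intro!: lmeasurable_compact simp: compact_frontier)
    show "(\<Union>K\<in>D. (\<Union>(D2 K) \<union> Z2 K) \<union> frontier K) \<union> Z \<in> lmeasurable"
      using dD(1) D2l Z2(2) Z(2) fl by (intro fmeasurable.Un fmeasurable.finite_UN) auto
    show "E \<subseteq> (\<Union>K\<in>D. (\<Union>(D2 K) \<union> Z2 K) \<union> frontier K) \<union> Z"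
    proof
      fix x assume x: "x \<in> E"
      show "x \<in> (\<Union>K\<in>D. (\<Union>(D2 K) \<union> Z2 K) \<union> frontier K) \<union> Z"
      proof (cases "x \<in> Z")
        case False
        then obtain K where K: "K \<in> D" "x \<in> K" using Z(1) x by blast
        have "x \<in> interior K \<or> x \<in> frontier K" using K(2) closure_subset by (auto simp: frontier_def)
        then show ?thesis using Z2(1)[OF K(1)] x K(1) by blast
      qed blast
    qed
  qed
  also have "\<dots> \<le> ?\<mu> (\<Union>K\<in>D. (\<Union>(D2 K) \<union> Z2 K) \<union> frontier K) + ?\<mu> Z"
    using dD(1) D2l Z2(2) Z(2)
    by (intro measure_Un_le) (auto intro!: sets.finite_UN sets.Un intro: fmeasurableD)
  also have "?\<mu> (\<Union>K\<in>D. (\<Union>(D2 K) \<union> Z2 K) \<union> frontier K) \<le> (\<Sum>K\<in>D. ?\<mu> ((\<Union>(D2 K) \<union> Z2 K) \<union> frontier K))"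
    using dD(1) D2l Z2(2) by (intro measure_UNION_le) (auto intro: fmeasurableD)
  also have "\<dots> \<le> (\<Sum>K\<in>D. ?\<mu> (\<Union>(D2 K)) + t)"
  proof (rule sum_mono)
    fix K assume K: "K \<in> D"
    have "negligible (frontier K)" using D(4)[OF K] by (auto intro: negligible_convex_frontier)
    then have z: "?\<mu> (frontier K) = 0" using negligible_iff_measure by blast
    have "?\<mu> ((\<Union>(D2 K) \<union> Z2 K) \<union> frontier K) \<le> ?\<mu> (\<Union>(D2 K) \<union> Z2 K) + ?\<mu> (frontier K)"
      using D2l[OF K] Z2(2)[OF K] by (intro measure_Un_le) (auto intro: fmeasurableD)
    also have "?\<mu> (\<Union>(D2 K) \<union> Z2 K) \<le> ?\<mu> (\<Union>(D2 K)) + ?\<mu> (Z2 K)"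
      using D2l[OF K] Z2(2)[OF K] by (intro measure_Un_le) (auto intro: fmeasurableD)
    finally show "?\<mu> ((\<Union>(D2 K) \<union> Z2 K) \<union> frontier K) \<le> ?\<mu> (\<Union>(D2 K)) + t"
      using Z2(3)[OF K] z by linarith
  qed
  also have "\<dots> = (\<Sum>K\<in>D. ?\<mu> (\<Union>(D2 K))) + real (card D) * t" by (simp add: sum.distrib)
  finally have mbound: "m < (\<Sum>K\<in>D. ?\<mu> (\<Union>(D2 K))) + \<delta>/4" using t(2) Z(3) by linarith
  have "(\<Sum>L\<in>(\<Union>K\<in>D. G K). Sup L - Inf L) = (\<Sum>K\<in>D. ?\<mu> K - ?\<mu> (\<Union>(D2 K)))"
    unfolding sumG using division_sum_length[OF r(2)] division_sum_length[OF D2(1)] by (intro sum.cong) simp_all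
  also have "\<dots> = ?\<mu> (\<Union>D) - (\<Sum>K\<in>D. ?\<mu> (\<Union>(D2 K)))" by (simp add: sum_subtractf muD)
  \<comment> \<open>The falling intervals are shorter than \<open>m + \<delta>/2\<close> in total,
    so less than \<delta> remains for the gaps.\<close>
  also have "\<dots> < \<delta>0" using mbound muDle Um \<delta>(1,2) by linarith
  finally have "(\<Sum>L\<in>(\<Union>K\<in>D. G K). \<bar>f (Sup L) - f (Inf L)\<bar>) < \<kappa> * (e/2)"
  proof (intro \<delta>0(2)[OF Gdiv])
    show "\<Union>(\<Union>K\<in>D. G K) \<subseteq> {a..b}" using GK(2) D(2) unfolding U'_def by fastforce
  qed
  \<comment> \<open>On each \<open>K\<close> the function falls by at least \<kappa> times the
    length, and it does not fall on the rising intervals, so the gaps carry the whole fall.\<close>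
  moreover have "\<kappa> * ?\<mu> (\<Union>D) \<le> - (\<Sum>L\<in>(\<Union>K\<in>D. G K). f (Sup L) - f (Inf L))"
    unfolding sumG muD[symmetric] sum_distrib_left sum_negf[symmetric]
  proof (rule sum_mono)
    fix K assume K: "K \<in> D"
    obtain u v where uv: "K = {u..v}" "u < v" "f v - f u \<le> - \<kappa> * (v - u)" using D(4)[OF K] by blast
    have "(\<Sum>L\<in>r K. f (Sup L) - f (Inf L)) = f v - f u"
      using division_sum_diff[of "r K" u v f] r(2)[OF K] uv by simp
    moreover have "(\<Sum>L\<in>D2 K. f (Sup L) - f (Inf L)) \<ge> 0"
    proof (rule sum_nonneg)
      fix L assume "L \<in> D2 K"
      then obtain u v where L: "L = {u..v}" "u < v" "f v - f u \<ge> \<kappa> * (v - u)" using D2(3)[OF K] by blast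
      have "0 \<le> \<kappa> * (v - u)" using \<kappa> L(2) by simp
      then show "0 \<le> f (Sup L) - f (Inf L)" using L by simp
    qed
    moreover have "\<kappa> * ?\<mu> K = \<kappa> * (v - u)" using uv by simp
    ultimately show "\<kappa> * ?\<mu> K \<le> - ((\<Sum>L\<in>r K. f (Sup L) - f (Inf L)) - (\<Sum>L\<in>D2 K. f (Sup L) - f (Inf L)))"
      using uv by linarith
  qed
  moreover have "- (\<Sum>L\<in>(\<Union>K\<in>D. G K). f (Sup L) - f (Inf L)) \<le> (\<Sum>L\<in>(\<Union>K\<in>D. G K). \<bar>f (Sup L) - f (Inf L)\<bar>)"
    unfolding sum_negf[symmetric] by (rule sum_mono) simp
  ultimately have "\<kappa> * ?\<mu> (\<Union>D) < \<kappa> * (e/2)" by linarith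
  then have "?\<mu> (\<Union>D) < e/2" using \<kappa> by simp
  moreover have "?\<mu> (\<Union>D \<union> Z) \<le> ?\<mu> (\<Union>D) + ?\<mu> Z" 
    using Dl Z(2) by (intro measure_Un_le) (auto intro: fmeasurableD)
  ultimately have "?\<mu> (\<Union>D \<union> Z) \<le> e" using Z(3) \<delta> by linarith
  then show "\<exists>T. E \<subseteq> T \<and> T \<in> lmeasurable \<and> ?\<mu> T \<le> e"
    using Z Dl by (intro exI[of _ "\<Union>D \<union> Z"] conjI fmeasurable.Un)
qed

text \<open>A difference quotient at \<open>x\<close> is turned into an increment over an interval
  with \<open>x\<close> as an end point, on either side; this is the form that the covering lemmas
  require.\<close>

lemma frequently_at_interval:
  fixes q :: "real \<Rightarrow> real"
  assumes "\<exists>\<^sub>F y in at x. R (q y)" "d > 0" and q: "\<And>y. q y = (f y - f x) / (y - x)"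
  shows "\<exists>u v c. u < v \<and> v - u < d \<and> x \<in> {u..v} \<and> f v - f u = c * (v - u) \<and> R c"
proof -
  have "\<forall>\<^sub>F y in at x. (y \<noteq> x \<and> dist y x < d)"
    using assms(2) by (auto simp: eventually_at)
  then have "\<exists>\<^sub>F y in at x. (y \<noteq> x \<and> dist y x < d) \<and> R (q y)"
    by (rule frequently_eventually_conj[OF assms(1)])
  then obtain y where y: "R (q y)" "y \<noteq> x" "\<bar>y - x\<bar> < d"
    by (auto simp: dist_real_def dest!: frequently_ex)
  show ?thesis
  proof (cases "x < y")
    case True
    then show ?thesis using y by (intro exI[of _ x] exI[of _ y] exI[of _ "q y"]) (auto simp: q)
  next
    case False
    then have yx: "y < x" using y(2) by simp
    then have "f x - f y = q y * (x - y)" by (simp add: q field_simps)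
    then show ?thesis using yx y(1,3) by (intro exI[of _ y] exI[of _ x] exI[of _ "q y"]) auto
  qed
qed

text \<open>Where differentiability fails, the difference quotients are unbounded near
  \<open>x\<close> or their lower limit lies strictly below their upper limit. In the second case
  two rationals separate the limits, and there are only countably many such pairs.\<close>

lemma abs_cont_on_negligible_not_differentiable:
  fixes f :: "real \<Rightarrow> real"
  assumes ac: "abs_cont_on {a..b} f"
  shows "negligible {x \<in> {a<..<b}. \<not> f differentiable (at x)}"
proof -
  define q where "q = (\<lambda>x y. (f y - f x) / (y - x))"
  define Einf where "Einf = {x \<in> {a<..<b}. \<forall>M. \<exists>\<^sub>F y in at x. \<bar>q x y\<bar> \<ge> M}"
  define E where "E = (\<lambda>p s. {x \<in> {a<..<b}. (\<exists>\<^sub>F y in at x. q x y \<le> p) \<and> (\<exists>\<^sub>F y in at x. q x y \<ge> s)})"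
  have 1: "negligible Einf"
  proof (rule abs_cont_on_unbounded_quotient_negligible[OF ac])
    fix x d M :: real assume x: "x \<in> Einf" and d: "d > 0"
    have "\<exists>\<^sub>F y in at x. \<bar>q x y\<bar> \<ge> M" using x by (simp add: Einf_def)
    from frequently_at_interval[where R = "\<lambda>c. \<bar>c\<bar> \<ge> M", OF this d, of f]
    obtain u v c where c: "u < v" "v - u < d" "x \<in> {u..v}" "f v - f u = c * (v - u)" "\<bar>c\<bar> \<ge> M"
      by (auto simp: q_def)
    then have "M * (v - u) \<le> \<bar>f v - f u\<bar>" by (simp add: abs_mult)
    then show "\<exists>u v. u < v \<and> v - u < d \<and> x \<in> {u..v} \<and> M * (v - u) \<le> \<bar>f v - f u\<bar>" using c by blast
  qed (auto simp: Einf_def)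
  have 2: "negligible (E p s)" if ps: "p < s" for p s
  proof -
    \<comment> \<open>Subtracting the linear function with the mean slope \<open>c0\<close> turns
      the bounds \<open>p\<close> and \<open>s\<close> on the quotients into the opposite bounds
      \<open>-\<kappa>\<close> and \<open>\<kappa>\<close>.\<close>
    define c0 where "c0 = (p + s) / 2"
    define \<kappa> where "\<kappa> = (s - p) / 2"
    show ?thesis
    proof (rule abs_cont_on_opposite_quotients_negligible[OF abs_cont_on_diff_linear[OF ac, of c0], where \<kappa> = \<kappa>])
      show "\<kappa> > 0" using ps by (simp add: \<kappa>_def)
      fix x d :: real assume x: "x \<in> E p s" and d: "d > 0"
      have "\<exists>\<^sub>F y in at x. q x y \<le> p" using x by (simp add: E_def)
      from frequently_at_interval[where R = "\<lambda>c. c \<le> p", OF this d, of f]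
      obtain u v c where c: "u < v" "v - u < d" "x \<in> {u..v}" "f v - f u = c * (v - u)" "c \<le> p"
        by (auto simp: q_def)
      have "(c - c0) * (v - u) \<le> (- \<kappa>) * (v - u)"
        using c by (intro mult_right_mono) (auto simp: c0_def \<kappa>_def field_simps)
      then have "f v - c0 * v - (f u - c0 * u) \<le> - \<kappa> * (v - u)" using c(4) by (simp add: algebra_simps)
      then show "\<exists>u v. u < v \<and> v - u < d \<and> x \<in> {u..v} \<and> f v - c0 * v - (f u - c0 * u) \<le> - \<kappa> * (v - u)" using c by blast
    next
      fix x d :: real assume x: "x \<in> E p s" and d: "d > 0"
      have "\<exists>\<^sub>F y in at x. q x y \<ge> s" using x by (simp add: E_def)
      from frequently_at_interval[where R = "\<lambda>c. c \<ge> s", OF this d, of f]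
      obtain u v c where c: "u < v" "v - u < d" "x \<in> {u..v}" "f v - f u = c * (v - u)" "c \<ge> s"
        by (auto simp: q_def)
      have "(c - c0) * (v - u) \<ge> \<kappa> * (v - u)"
        using c by (intro mult_right_mono) (auto simp: c0_def \<kappa>_def field_simps)
      then have "f v - c0 * v - (f u - c0 * u) \<ge> \<kappa> * (v - u)" using c(4) by (simp add: algebra_simps)
      then show "\<exists>u v. u < v \<and> v - u < d \<and> x \<in> {u..v} \<and> f v - c0 * v - (f u - c0 * u) \<ge> \<kappa> * (v - u)" using c by blast
    qed (auto simp: E_def)
  qed
  have cover: "{x \<in> {a<..<b}. \<not> f differentiable (at x)} \<subseteq> Einf \<union> (\<Union>(p,s)\<in>{(p,s). p \<in> \<rat> \<and> s \<in> \<rat> \<and> p < s}. E p s)"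
  proof
    fix x assume x: "x \<in> {x \<in> {a<..<b}. \<not> f differentiable (at x)}"
    let ?L = "Liminf (at x) (\<lambda>y. ereal (q x y))" and ?U = "Limsup (at x) (\<lambda>y. ereal (q x y))"
    have LU: "?L \<le> ?U" by (rule Liminf_le_Limsup) simp
    show "x \<in> Einf \<union> (\<Union>(p,s)\<in>{(p,s). p \<in> \<rat> \<and> s \<in> \<rat> \<and> p < s}. E p s)"
    proof (cases "x \<in> Einf")
      case False
      then obtain M where "\<not> (\<exists>\<^sub>F y in at x. \<bar>q x y\<bar> \<ge> M)" using x by (auto simp: Einf_def)
      then have ev: "\<forall>\<^sub>F y in at x. \<bar>q x y\<bar> < M" by (simp add: frequently_def not_le)
      have "?L \<ge> ereal (- M)" "?U \<le> ereal M"
        using ev by (auto intro!: Liminf_bounded Limsup_bounded elim!: eventually_mono)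
      then obtain l u where lu: "?L = ereal l" "?U = ereal u"
        using LU by (cases ?L; cases ?U) auto
      have "l \<noteq> u"
      proof
        assume "l = u"
        then have "((\<lambda>y. ereal (q x y)) \<longlongrightarrow> ereal l) (at x)"
          using lu by (subst tendsto_iff_Liminf_eq_Limsup) auto
        then have "(q x \<longlongrightarrow> l) (at x)" by (simp add: lim_ereal)
        then have "(f has_field_derivative l) (at x)"
          unfolding q_def has_field_derivative_iff .
        then show False using x by (auto simp: field_differentiable_def dest: field_differentiable_imp_differentiable 
          intro: has_field_derivative_imp_has_derivative simp: differentiable_def has_field_derivative_def)
      qed
      then have "l < u" using LU lu by simp
      obtain p where p: "p \<in> \<rat>" "l < p" "p < u" using Rats_dense_in_real[OF \<open>l < u\<close>] by blast
      obtain s where s: "s \<in> \<rat>" "p < s" "s < u" using Rats_dense_in_real[OF \<open>p < u\<close>] by blast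
      have "\<exists>\<^sub>F y in at x. q x y \<le> p"
      proof (rule ccontr)
        assume "\<not> ?thesis"
        then have "\<forall>\<^sub>F y in at x. ereal p \<le> ereal (q x y)" 
          by (auto simp: frequently_def not_le elim!: eventually_mono)
        then have "ereal p \<le> ?L" by (rule Liminf_bounded)
        then show False using lu p by simp
      qed
      moreover have "\<exists>\<^sub>F y in at x. q x y \<ge> s"
      proof (rule ccontr)
        assume "\<not> ?thesis"
        then have "\<forall>\<^sub>F y in at x. ereal (q x y) \<le> ereal s" 
          by (auto simp: frequently_def not_le elim!: eventually_mono)
        then have "?U \<le> ereal s" by (rule Limsup_bounded)
        then show False using lu s by simp
      qed
      ultimately have "x \<in> E p s" using x by (simp add: E_def)
      then show ?thesis using p(1) s(1,2) by blast
    qed simp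
  qed
  have cnt: "countable {(p,s). p \<in> \<rat> \<and> s \<in> \<rat> \<and> p < (s::real)}"
    by (rule countable_subset[of _ "\<rat> \<times> \<rat>"]) (auto simp: countable_rat)
  have "negligible (\<Union>((\<lambda>(p,s). E p s) ` {(p,s). p \<in> \<rat> \<and> s \<in> \<rat> \<and> p < s}))"
    by (rule negligible_countable_Union) (use cnt 2 in auto)
  then show ?thesis using negligible_subset[OF negligible_Un[OF 1] cover] by simp
qed

lemma abs_cont_on_subset:
  assumes "abs_cont_on S f" "T \<subseteq> S" shows "abs_cont_on T f"
  using assms unfolding abs_cont_on_def by (meson order_trans)

text \<open>Lebesgue's form of the fundamental theorem: the arbitrary values of
  \<open>vector_derivative\<close> occur on a negligible set only.\<close>

proposition abs_cont_on_vector_derivative_has_integral: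
  fixes f :: "real \<Rightarrow> real"
  assumes ac: "abs_cont_on {a..b} f" and xy: "a \<le> x" "x \<le> y" "y \<le> b"
  shows "((\<lambda>t. vector_derivative f (at t within {a..b})) has_integral (f y - f x)) {x..y}"
proof (rule abs_cont_on_has_integral[OF _ _ xy(2)])
  show "abs_cont_on {x..y} f" using ac xy by (auto intro: abs_cont_on_subset)
  show "negligible ({x \<in> {a<..<b}. \<not> f differentiable (at x)} \<union> {a,b})"
    using abs_cont_on_negligible_not_differentiable[OF ac] by (intro negligible_Un) auto
  fix t assume t: "t \<in> {x..y} - ({x \<in> {a<..<b}. \<not> f differentiable at x} \<union> {a, b})"
  then have "f differentiable (at t)" and tab: "a < t" "t < b" using xy by auto
  then have "(f has_vector_derivative vector_derivative f (at t)) (at t)"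
    by (simp add: vector_derivative_works)
  moreover have "at t within {a..b} = at t" using tab by (simp add: at_within_Icc_at)
  ultimately show "(f has_vector_derivative vector_derivative f (at t within {a..b})) (at t within {x..y})"
    by (simp add: has_vector_derivative_at_within)
qed

section \<open>A Nikolskii inequality on the unit circle\<close>

text \<open>Concavity gives the chord bound \<open>2 x / pi\<close>; the weaker \<open>x / 2\<close>
  keeps \<open>pi\<close> out of the later constants.\<close>

lemma half_le_sin:
  fixes x :: real assumes "0 \<le> x" "x \<le> pi/2" shows "x / 2 \<le> sin x"
proof -
  have "convex_on {0..pi} (\<lambda>x. - sin x)"
  proof (rule f''_ge0_imp_convex[where f' = "\<lambda>x. - cos x" and f'' = sin])
    show "((\<lambda>x. - sin x) has_real_derivative - cos x) (at x)" for x :: real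
      by (auto intro!: derivative_eq_intros)
    show "((\<lambda>x. - cos x) has_real_derivative sin x) (at x)" for x :: real
      by (auto intro!: derivative_eq_intros)
    show "0 \<le> sin x" if "x \<in> {0..pi}" for x :: real using that by (auto intro: sin_ge_zero)
  qed auto
  then have "- sin ((1 - x / (pi/2)) *\<^sub>R 0 + (x / (pi/2)) *\<^sub>R (pi/2)) \<le> (1 - x / (pi/2)) * (- sin 0) + (x / (pi/2)) * (- sin (pi/2))"
    using assms by (intro convex_onD) (auto simp: field_simps)
  then have "sin x \<ge> x / (pi/2)" by simp
  moreover have "x / (pi/2) \<ge> x / 2" using assms pi_less_4 by (intro divide_left_mono) auto
  ultimately show ?thesis by linarith
qed

lemma norm_poly_le_inside:
  fixes q :: "complex poly"
  assumes M: "\<And>z. norm z = 1 \<Longrightarrow> norm (poly q z) \<le> M" and w: "norm w \<le> 1"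
  shows "norm (poly q w) \<le> M"
proof (rule maximum_modulus_frontier[of "poly q" "cball 0 1"])
  show "continuous_on (closure (cball 0 1)) (poly q)" by (intro continuous_on_poly continuous_on_id)
  show "poly q holomorphic_on interior (cball 0 1)" by (intro holomorphic_intros)
  show "w \<in> cball 0 1" using w by simp
qed (use M in auto)

text \<open>On the unit circle the reversed polynomial has the moduli of \<open>q\<close> at inverse
  points, and its value at \<open>1/w\<close> is that of \<open>q\<close> at \<open>w\<close>
  divided by a power of \<open>w\<close>. The maximum principle inside the disc therefore controls
  the outside.\<close>

lemma norm_poly_le_outside:
  fixes q :: "complex poly"
  assumes M: "\<And>z. norm z = 1 \<Longrightarrow> norm (poly q z) \<le> M" and w: "norm w \<ge> 1"
  shows "norm (poly q w) \<le> norm w ^ degree q * M"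
proof -
  have w0: "w \<noteq> 0" using w by auto
  have R: "norm (poly (reflect_poly q) z) = norm z ^ degree q * norm (poly q (inverse z))" if "z \<noteq> 0" for z
    using that by (simp add: poly_reflect_poly_nz norm_mult norm_power)
  have "norm (poly (reflect_poly q) (inverse w)) \<le> M"
  proof (rule norm_poly_le_inside)
    fix z :: complex assume z: "norm z = 1"
    then have "z \<noteq> 0" by auto
    then show "norm (poly (reflect_poly q) z) \<le> M"
      using R M[of "inverse z"] z by (simp add: norm_inverse)
  qed (use w in \<open>simp add: norm_inverse inverse_le_1_iff\<close>)
  moreover have "norm (poly (reflect_poly q) (inverse w)) = inverse (norm w) ^ degree q * norm (poly q w)"
    using R[of "inverse w"] w0 by (simp add: norm_inverse)
  ultimately have "inverse (norm w) ^ degree q * norm (poly q w) \<le> M" by simp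
  then show ?thesis using w0 by (simp add: field_simps)
qed

text \<open>Bernstein's inequality up to a constant: Cauchy's estimate on a circle of radius \<open>1/D\<close>.\<close>

lemma norm_pderiv_le:
  fixes q :: "complex poly"
  assumes M: "\<And>z. norm z = 1 \<Longrightarrow> norm (poly q z) \<le> M" and D: "degree q \<le> D" "D \<ge> 1" and z: "norm z = 1"
  shows "norm (poly (pderiv q) z) \<le> 3 * real D * M"
proof -
  have M0: "M \<ge> 0" using M[of 1] norm_ge_zero[of "poly q 1"] by (simp del: norm_ge_zero)
  \<comment> \<open>Points at distance \<open>1/D\<close> from \<open>z\<close> have modulus at most
    \<open>1 + 1/D\<close>, so a polynomial of degree \<open>D\<close> grows there by at most the
    factor \<open>exp 1\<close>.\<close>
  have e3: "(1 + 1 / real D) ^ D \<le> 3"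
  proof -
    have "(1 + 1 / real D) ^ D \<le> exp (1 / real D) ^ D" by (intro power_mono) (use D in auto)
    also have "\<dots> = exp 1" using D by (simp add: exp_of_nat_mult[symmetric])
    finally show ?thesis using exp_le by linarith
  qed
  have "norm ((deriv ^^ 1) (poly q) z) \<le> fact 1 * (3 * M) / (1 / real D) ^ 1"
  proof (rule Cauchy_inequality)
    fix x assume "norm (z - x) = 1 / real D"
    then have nx: "norm x \<le> 1 + 1 / real D" using z norm_triangle_ineq4[of z "z - x"] by simp
    show "norm (poly q x) \<le> 3 * M"
    proof (cases "norm x \<le> 1")
      case True
      then have "norm (poly q x) \<le> M" using M by (rule norm_poly_le_inside[rotated])
      then show ?thesis using M0 by linarith
    next
      case False
      then have "norm (poly q x) \<le> norm x ^ degree q * M" using M by (intro norm_poly_le_outside) auto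
      also have "\<dots> \<le> norm x ^ D * M" using False D M0 by (intro mult_right_mono power_increasing) auto
      also have "\<dots> \<le> (1 + 1 / real D) ^ D * M" using nx M0 by (intro mult_right_mono power_mono) auto
      also have "\<dots> \<le> 3 * M" using e3 M0 by (rule mult_right_mono)
      finally show ?thesis .
    qed
  qed (use D in \<open>auto intro!: holomorphic_intros continuous_intros\<close>)
  moreover have "deriv (poly q) z = poly (pderiv q) z" by (rule DERIV_imp_deriv) (rule poly_DERIV)
  ultimately show ?thesis by (simp add: field_simps)
qed

lemma norm_poly_cis_Lipschitz:
  fixes q :: "complex poly"
  assumes M: "\<And>z. norm z = 1 \<Longrightarrow> norm (poly q z) \<le> M" and D: "degree q \<le> D" "D \<ge> 1"
  shows "norm (poly q (cis t) - poly q (cis s)) \<le> 3 * real D * M * \<bar>t - s\<bar>"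
proof -
  have "norm (poly q (cis t) - poly q (cis s)) \<le> 3 * real D * M * norm (t - s)"
  proof (rule differentiable_bound[of UNIV])
    fix x :: real
    have "((\<lambda>t. poly q (cis t)) has_vector_derivative (\<i> * cis x * poly (pderiv q) (cis x))) (at x)"
      using field_vector_diff_chain_at[of cis "\<i> * cis x" x "poly q" "poly (pderiv q) (cis x)"]
      by (simp add: o_def has_vector_derivative_def poly_DERIV has_derivative_cis[OF has_derivative_ident])
    then show "((\<lambda>t. poly q (cis t)) has_derivative (\<lambda>h. h *\<^sub>R (\<i> * cis x * poly (pderiv q) (cis x)))) (at x within UNIV)"
      by (simp add: has_vector_derivative_def)
    show "onorm (\<lambda>h. h *\<^sub>R (\<i> * cis x * poly (pderiv q) (cis x))) \<le> 3 * real D * M"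
    proof (rule onorm_le)
      fix h :: real
      have "norm (poly (pderiv q) (cis x)) \<le> 3 * real D * M" using norm_pderiv_le[OF M D] by simp
      then show "norm (h *\<^sub>R (\<i> * cis x * poly (pderiv q) (cis x))) \<le> 3 * real D * M * norm h"
        by (simp add: norm_mult mult_left_mono mult.commute)
    qed
  qed auto
  then show ?thesis by simp
qed

text \<open>Since \<open>U = U^(1-p) U^p\<close>, replacing the first factor by
  \<open>M^(1-p)\<close> bounds the integral of \<open>U\<close> by that of \<open>U^p\<close>; the
  hypothesis bounds \<open>M^p\<close> in turn. Inequalities of Nikolskii type are thereby reduced
  to a bound for the maximum.\<close>

lemma integral_powr_interpolation:
  fixes U w :: "real \<Rightarrow> real"
  assumes p: "0 < p" "p < 1" and cont: "continuous_on {a..b} U" "continuous_on {a..b} w"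
    and U: "\<And>x. x \<in> {a..b} \<Longrightarrow> 0 \<le> U x \<and> U x \<le> M" and w: "\<And>x. x \<in> {a..b} \<Longrightarrow> 0 \<le> w x"
    and M: "M \<ge> 0" "M powr p \<le> K * integral {a..b} (\<lambda>x. U x powr p * w x)" and K: "K \<ge> 0"
  shows "integral {a..b} (\<lambda>x. U x * w x) powr p \<le> K powr (1 - p) * integral {a..b} (\<lambda>x. U x powr p * w x)"
proof -
  let ?I = "integral {a..b} (\<lambda>x. U x powr p * w x)"
  have cp: "continuous_on {a..b} (\<lambda>x. U x powr p)"
    using cont(1) p U by (intro continuous_on_powr') auto
  have int: "(\<lambda>x. U x powr p * w x) integrable_on {a..b}" "(\<lambda>x. U x * w x) integrable_on {a..b}"
    using cont cp by (auto intro!: integrable_continuous_real continuous_intros)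
  have I0: "?I \<ge> 0" using U w by (intro integral_nonneg[OF int(1)]) auto
  have "integral {a..b} (\<lambda>x. U x * w x) \<le> integral {a..b} (\<lambda>x. M powr (1 - p) * (U x powr p * w x))"
  proof (rule integral_le)
    fix x assume x: "x \<in> {a..b}"
    have "U x = U x powr (1 - p) * U x powr p" using U[OF x] by (cases "U x = 0") (auto simp: powr_add[symmetric])
    also have "\<dots> \<le> M powr (1 - p) * U x powr p" using U[OF x] p by (intro mult_right_mono powr_mono2) auto
    finally show "U x * w x \<le> M powr (1 - p) * (U x powr p * w x)"
      using w[OF x] by (simp add: mult_right_mono mult.assoc[symmetric])
  qed (use int in \<open>auto intro: integrable_on_mult_right\<close>)
  then have "integral {a..b} (\<lambda>x. U x * w x) \<le> M powr (1 - p) * ?I" by simp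
  then have "integral {a..b} (\<lambda>x. U x * w x) powr p \<le> (M powr (1 - p) * ?I) powr p"
    using p U w by (intro powr_mono2 integral_nonneg[OF int(2)]) auto
  also have "\<dots> = (M powr p) powr (1 - p) * ?I powr p"
    using I0 M(1) by (simp add: powr_mult powr_powr mult.commute)
  also have "\<dots> \<le> (K * ?I) powr (1 - p) * ?I powr p"
    using p M by (intro mult_right_mono powr_mono2) auto
  also have "\<dots> = K powr (1 - p) * ?I"
    using I0 K by (cases "?I = 0") (auto simp: powr_mult powr_add[symmetric])
  finally show ?thesis .
qed

lemma integral_ge_rectangle:
  fixes g :: "real \<Rightarrow> real"
  assumes "continuous_on {a..b} g" "\<And>x. x \<in> {a..b} \<Longrightarrow> 0 \<le> g x" "a \<le> c" "c \<le> d" "d \<le> b"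
    "\<And>x. x \<in> {c..d} \<Longrightarrow> m \<le> g x"
  shows "m * (d - c) \<le> integral {a..b} g"
proof -
  have gi: "g integrable_on {a..b}" using assms(1) by (rule integrable_continuous_real)
  have gi': "g integrable_on {c..d}" using gi assms(3-5) by (auto intro: integrable_on_subinterval)
  have "m * (d - c) = integral {c..d} (\<lambda>_. m)" using assms(4) by simp
  also have "\<dots> \<le> integral {c..d} g" using assms(6) gi' by (intro integral_le) auto
  also have "\<dots> \<le> integral {a..b} g" using assms gi gi' by (intro integral_subset_le) auto
  finally show ?thesis .
qed

text \<open>With the Lipschitz constant \<open>3 D M\<close> the modulus drops by at most
  \<open>M/2\<close> over the distance \<open>1/(6 D)\<close>. A peak of this width is what bounds
  the maximum by an integral.\<close>

lemma norm_poly_cis_peak: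
  fixes q :: "complex poly"
  assumes D: "degree q \<le> D" "D \<ge> 1"
  obtains t0 where "t0 \<in> {-pi..pi}" "\<And>t. norm (poly q (cis t)) \<le> norm (poly q (cis t0))"
    "\<And>t. \<bar>t - t0\<bar> \<le> 1 / (6 * real D) \<Longrightarrow> norm (poly q (cis t0)) / 2 \<le> norm (poly q (cis t))"
proof -
  have "continuous_on {-pi..pi} (\<lambda>t. norm (poly q (cis t)))" by (intro continuous_intros)
  then obtain t0 where t0: "t0 \<in> {-pi..pi}" "\<And>t. t \<in> {-pi..pi} \<Longrightarrow> norm (poly q (cis t)) \<le> norm (poly q (cis t0))"
    using continuous_attains_sup[of "{-pi..pi}" "\<lambda>t. norm (poly q (cis t))"] by auto
  define M where "M = norm (poly q (cis t0))"
  have M: "norm (poly q z) \<le> M" if "norm z = 1" for z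
  proof -
    have "z \<noteq> 0" using that by auto
    then have "cis (Arg z) = z" using that by (simp add: cis_Arg sgn_div_norm)
    moreover have "Arg z \<in> {-pi..pi}" using Arg_bounded[of z] by auto
    ultimately show ?thesis using t0(2)[of "Arg z"] by (simp add: M_def)
  qed
  show thesis
  proof (rule that[OF t0(1)])
    show "norm (poly q (cis t)) \<le> norm (poly q (cis t0))" for t using M[of "cis t"] by (simp add: M_def)
    fix t assume t: "\<bar>t - t0\<bar> \<le> 1 / (6 * real D)"
    have M0: "M \<ge> 0" by (simp add: M_def)
    have "norm (poly q (cis t0) - poly q (cis t)) \<le> 3 * real D * M * \<bar>t0 - t\<bar>"
      using M D by (rule norm_poly_cis_Lipschitz)
    also have "\<dots> \<le> 3 * real D * M * (1 / (6 * real D))" 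
      using t M0 by (intro mult_left_mono) (auto simp: abs_minus_commute)
    also have "\<dots> = M / 2" using D by simp
    finally have "norm (poly q (cis t0) - poly q (cis t)) \<le> M / 2" .
    then show "norm (poly q (cis t0)) / 2 \<le> norm (poly q (cis t))"
      using norm_triangle_ineq2[of "poly q (cis t0)" "poly q (cis t)"] by (simp add: M_def)
  qed
qed

lemma powr_half_ge:
  fixes M p :: real
  assumes "M \<ge> 0" "p < 1" shows "M powr p / 2 \<le> (M/2) powr p"
proof -
  have "2 powr p \<le> (2::real)" using powr_mono[of p 1 "2::real"] assms by simp
  then have "M powr p / 2 \<le> M powr p / 2 powr p" by (intro divide_left_mono) auto
  then show ?thesis using assms by (simp add: powr_divide)
qed

theorem Nikolskii_circle:
  fixes q :: "complex poly"
  assumes p: "0 < p" "p < 1" and D: "degree q \<le> D" "D \<ge> 1"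
  shows "integral {-pi..pi} (\<lambda>t. norm (poly q (cis t))) powr p
    \<le> (12 * real D) powr (1 - p) * integral {-pi..pi} (\<lambda>t. norm (poly q (cis t)) powr p)"
proof -
  obtain t0 where t0: "t0 \<in> {-pi..pi}" "\<And>t. norm (poly q (cis t)) \<le> norm (poly q (cis t0))"
    "\<And>t. \<bar>t - t0\<bar> \<le> 1 / (6 * real D) \<Longrightarrow> norm (poly q (cis t0)) / 2 \<le> norm (poly q (cis t))"
    using norm_poly_cis_peak[OF D] by blast
  define M where "M = norm (poly q (cis t0))"
  define \<eta> where "\<eta> = 1 / (6 * real D)"
  have \<eta>: "0 < \<eta>" "\<eta> \<le> 1" using D by (auto simp: \<eta>_def)
  \<comment> \<open>The peak may reach beyond \<open>[-pi, pi]\<close>; its half towards the centre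
    stays inside.\<close>
  define c where "c = (if t0 \<le> 0 then t0 else t0 - \<eta>)"
  have c: "-pi \<le> c" "c + \<eta> \<le> pi" "\<And>t. t \<in> {c..c+\<eta>} \<Longrightarrow> \<bar>t - t0\<bar> \<le> \<eta>"
    using t0(1) \<eta> pi_gt3 by (auto simp: c_def split: if_splits)
  have contp: "continuous_on {-pi..pi} (\<lambda>t. norm (poly q (cis t)) powr p)"
    using p by (intro continuous_on_powr' continuous_intros) auto
  have "(M powr p / 2) * (c + \<eta> - c) \<le> integral {-pi..pi} (\<lambda>t. norm (poly q (cis t)) powr p)"
  proof (rule integral_ge_rectangle[OF contp])
    fix x assume "x \<in> {c..c+\<eta>}"
    then have "M / 2 \<le> norm (poly q (cis x))" using t0(3) c(3) by (simp add: M_def \<eta>_def)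
    then have "(M/2) powr p \<le> norm (poly q (cis x)) powr p" using p by (intro powr_mono2) (auto simp: M_def)
    then show "M powr p / 2 \<le> norm (poly q (cis x)) powr p" using powr_half_ge[of M p] p by (simp add: M_def)
  qed (use c \<eta> in auto)
  \<comment> \<open>\<open>12 = 2 * 6\<close>, from the halved p-th power of the maximum and the
    width \<open>1/(6 D)\<close>.\<close>
  then have "M powr p \<le> (12 * real D) * integral {-pi..pi} (\<lambda>t. norm (poly q (cis t)) powr p * 1)"
    using D by (simp add: \<eta>_def field_simps)
  then have "integral {-pi..pi} (\<lambda>t. norm (poly q (cis t)) * 1) powr p
     \<le> (12 * real D) powr (1 - p) * integral {-pi..pi} (\<lambda>t. norm (poly q (cis t)) powr p * 1)"
    using t0(2) by (intro integral_powr_interpolation[OF p, where M = M]) (auto simp: M_def intro!: continuous_intros)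
  then show ?thesis by simp
qed

text \<open>The weight may vanish at the peak itself, but it is at least of order \<open>1/D\<close>
  on a part of the peak of length of order \<open>1/D\<close>; this turns \<open>D\<close> into
  \<open>D^2\<close>. Evenness moves the peak into \<open>[0, pi]\<close>.\<close>

theorem Nikolskii_circle_sin_weight:
  fixes q :: "complex poly"
  assumes p: "0 < p" "p < 1" and D: "degree q \<le> D" "D \<ge> 1"
    and even: "\<And>t. norm (poly q (cis (- t))) = norm (poly q (cis t))"
  shows "integral {0..pi} (\<lambda>t. norm (poly q (cis t)) * sin t) powr p
    \<le> (1152 * (real D)\<^sup>2) powr (1 - p) * integral {0..pi} (\<lambda>t. norm (poly q (cis t)) powr p * sin t)"
proof -
  obtain t1 where t1: "t1 \<in> {-pi..pi}" "\<And>t. norm (poly q (cis t)) \<le> norm (poly q (cis t1))"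
    "\<And>t. \<bar>t - t1\<bar> \<le> 1 / (6 * real D) \<Longrightarrow> norm (poly q (cis t1)) / 2 \<le> norm (poly q (cis t))"
    using norm_poly_cis_peak[OF D] by blast
  define t0 where "t0 = \<bar>t1\<bar>"
  have eq: "norm (poly q (cis t0)) = norm (poly q (cis t1))" using even[of t1] by (auto simp: t0_def abs_if)
  have t0: "t0 \<in> {0..pi}" "\<And>t. norm (poly q (cis t)) \<le> norm (poly q (cis t0))"
    using t1 by (auto simp: t0_def eq[unfolded t0_def])
  have t03: "norm (poly q (cis t0)) / 2 \<le> norm (poly q (cis t))" if "\<bar>t - t0\<bar> \<le> 1 / (6 * real D)" for t
  proof (cases "t1 \<ge> 0")
    case True then show ?thesis using t1(3)[of t] that by (simp add: t0_def)
  next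
    case False
    then have "\<bar>- t - t1\<bar> \<le> 1 / (6 * real D)" using that by (simp add: t0_def abs_if split: if_splits)
    then show ?thesis using t1(3)[of "- t"] even[of t] eq by simp
  qed
  define M where "M = norm (poly q (cis t0))"
  define \<eta> where "\<eta> = 1 / (6 * real D)"
  have \<eta>: "0 < \<eta>" "\<eta> \<le> 1" using D by (auto simp: \<eta>_def)
  define c where "c = (if t0 \<le> pi/2 then t0 else t0 - \<eta>)"
  have c: "0 \<le> c" "c + \<eta> \<le> pi" "\<And>t. t \<in> {c..c+\<eta>} \<Longrightarrow> \<bar>t - t0\<bar> \<le> \<eta>"
    using t0(1) \<eta> pi_gt3 by (auto simp: c_def split: if_splits)
  have contp: "continuous_on {0..pi} (\<lambda>t. norm (poly q (cis t)) powr p * sin t)"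
    using p by (intro continuous_intros continuous_on_powr') auto
  \<comment> \<open>The middle half of the interval keeps the distance \<open>\<eta>/4\<close> from
    \<open>0\<close> and \<open>pi\<close>, so \<open>sin\<close> is at least
    \<open>\<eta>/8\<close> on it. With \<open>\<eta> = 1/(6 D)\<close> the resulting factor
    \<open>\<eta>^2/32\<close> gives \<open>1152 = 32 * 36\<close>.\<close>
  have "(M powr p / 2 * (\<eta>/8)) * ((c + 3*\<eta>/4) - (c + \<eta>/4)) \<le> integral {0..pi} (\<lambda>t. norm (poly q (cis t)) powr p * sin t)"
  proof (rule integral_ge_rectangle[OF contp])
    fix x assume x: "x \<in> {c + \<eta>/4..c+3*\<eta>/4}"
    then have "M / 2 \<le> norm (poly q (cis x))" using t03 c(3)[of x] \<eta> by (simp add: M_def \<eta>_def)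
    then have "(M/2) powr p \<le> norm (poly q (cis x)) powr p" using p by (intro powr_mono2) (auto simp: M_def)
    then have 1: "M powr p / 2 \<le> norm (poly q (cis x)) powr p" using powr_half_ge[of M p] p by (simp add: M_def)
    have 2: "\<eta>/8 \<le> sin x"
    proof (cases "x \<le> pi/2")
      case True
      then show ?thesis using half_le_sin[of x] x c \<eta> by simp
    next
      case False
      then have "(pi - x) / 2 \<le> sin (pi - x)" using x c \<eta> by (intro half_le_sin) auto
      then show ?thesis using x c \<eta> by simp
    qed
    show "M powr p / 2 * (\<eta>/8) \<le> norm (poly q (cis x)) powr p * sin x"
      using 1 2 \<eta> by (intro mult_mono) auto
  qed (use c \<eta> in \<open>auto intro!: mult_nonneg_nonneg sin_ge_zero\<close>)
  then have "M powr p * (\<eta>\<^sup>2 / 32) \<le> integral {0..pi} (\<lambda>t. norm (poly q (cis t)) powr p * sin t)"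
    by (simp add: power2_eq_square)
  then have "M powr p \<le> (1152 * (real D)\<^sup>2) * integral {0..pi} (\<lambda>t. norm (poly q (cis t)) powr p * sin t)"
    using D by (simp add: \<eta>_def field_simps power2_eq_square)
  then show ?thesis
    using t0(2) by (intro integral_powr_interpolation[OF p, where M = M]) (auto simp: M_def intro!: continuous_intros sin_ge_zero)
qed

section \<open>Powers of Fejer kernels\<close>

text \<open>The Fejer kernel normalised to the value \<open>1\<close> at \<open>0\<close>, that is
  \<open>(sin (l v / 2) / (l sin (v / 2)))^2\<close> for \<open>l \<ge> 1\<close>. The exponential
  sum avoids the removable singularities of this quotient.\<close>

definition fejer :: "nat \<Rightarrow> real \<Rightarrow> real" where
  "fejer l v = (norm (\<Sum>j<l. cis (real j * v)) / real l)\<^sup>2"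

lemma fejer_nonneg [simp]: "0 \<le> fejer l v"
  by (simp add: fejer_def)

lemma fejer_le_one [simp]: "fejer l v \<le> 1"
proof (cases "l = 0")
  case False
  have "norm (\<Sum>j<l. cis (real j * v)) \<le> (\<Sum>j<l. norm (cis (real j * v)))" by (rule norm_sum)
  then have "norm (\<Sum>j<l. cis (real j * v)) \<le> real l" by simp
  then show ?thesis using False by (simp add: fejer_def power_le_one)
qed (simp add: fejer_def)

lemma fejer_periodic: "fejer l (v + 2 * pi) = fejer l v"
proof -
  have "cis (real j * (v + 2 * pi)) = cis (real j * v)" for j
  proof -
    have "cis (real j * (v + 2 * pi)) = cis (real j * v) * cis (2 * pi * real j)"
      by (simp add: cis_mult algebra_simps)
    then show ?thesis by (simp add: cis_multiple_2pi)
  qed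
  then show ?thesis by (simp add: fejer_def)
qed

lemma norm_cis_minus_1: "norm (cis v - 1) = 2 * \<bar>sin (v / 2)\<bar>"
proof -
  have "(norm (cis v - 1))\<^sup>2 = (cos v - 1)\<^sup>2 + (sin v)\<^sup>2" by (simp add: cmod_power2)
  also have "\<dots> = 2 - 2 * cos v" using sin_cos_squared_add[of v] by (simp add: power2_eq_square algebra_simps)
  also have "\<dots> = (2 * \<bar>sin (v / 2)\<bar>)\<^sup>2" using cos_double_sin[of "v/2"] by (simp add: power_mult_distrib)
  finally show ?thesis by (metis abs_ge_zero norm_ge_zero power2_eq_imp_eq mult_nonneg_nonneg zero_le_numeral)
qed

lemma sum_cis_eq_power: "(\<Sum>j<l. cis (real j * v)) = (\<Sum>j<l. cis v ^ j)"
  by (simp only: Complex.DeMoivre)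

text \<open>The geometric sum of powers of \<open>cis v\<close>, with the denominator cleared so
  that multiples of \<open>2 pi\<close> need no exception.\<close>

lemma fejer_mult_sin: "fejer l v * (real l * sin (v / 2))\<^sup>2 = (sin (real l * v / 2))\<^sup>2"
proof (cases "l = 0")
  case False
  have "(cis v - 1) * (\<Sum>j<l. cis (real j * v)) = cis v ^ l - 1"
    unfolding sum_cis_eq_power using power_diff_1_eq[of "cis v" l] by simp
  from arg_cong[OF this, of norm]
  have "norm (cis v - 1) * norm (\<Sum>j<l. cis (real j * v)) = norm (cis (real l * v) - 1)"
    by (simp only: norm_mult Complex.DeMoivre)
  then have "\<bar>sin (v/2)\<bar> * norm (\<Sum>j<l. cis (real j * v)) = \<bar>sin (real l * v / 2)\<bar>"
    by (simp add: norm_cis_minus_1)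
  then have "(\<bar>sin (v/2)\<bar> * norm (\<Sum>j<l. cis (real j * v)))\<^sup>2 = \<bar>sin (real l * v / 2)\<bar>\<^sup>2" by simp
  then show ?thesis using False by (simp add: fejer_def power_mult_distrib power_divide mult.commute)
qed (simp add: fejer_def)

text \<open>Each of the \<open>l\<close> exponentials is within \<open>l * |cis v - 1|\<close> of
  \<open>1\<close>. The bound is used twice: for the mass of the kernel near \<open>0\<close> and
  for the vanishing of \<open>damping\<close> at multiples of \<open>pi\<close>.\<close>

lemma one_minus_fejer_le:
  assumes "l \<ge> 1" shows "1 - fejer l v \<le> 4 * real l * \<bar>sin (v / 2)\<bar>"
proof -
  define s where "s = norm (\<Sum>j<l. cis (real j * v)) / real l"
  have l: "real l > 0" using assms by simp
  have s: "0 \<le> s" "s \<le> 1" 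
  proof -
    have "s\<^sup>2 \<le> 1" using fejer_le_one[of l v] by (simp add: fejer_def s_def)
    then show "s \<le> 1" using power2_le_imp_le[of s 1] by simp
  qed (simp add: s_def)
  have "real l - norm (\<Sum>j<l. cis (real j * v)) \<le> norm (of_nat l - (\<Sum>j<l. cis (real j * v)))"
    using norm_triangle_ineq2[of "of_nat l :: complex" "\<Sum>j<l. cis (real j * v)"] by simp
  also have "of_nat l - (\<Sum>j<l. cis (real j * v)) = (\<Sum>j<l. 1 ^ j - cis v ^ j)"
    unfolding sum_cis_eq_power by (simp add: sum_subtractf)
  also have "norm \<dots> \<le> (\<Sum>j<l. real l * norm (1 - cis v))"
  proof (rule sum_norm_le)
    fix j assume "j \<in> {..<l}"
    have "norm (1 ^ j - cis v ^ j) \<le> real j * norm (1 - cis v)" by (rule norm_power_diff) auto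
    also have "\<dots> \<le> real l * norm (1 - cis v)" using \<open>j \<in> {..<l}\<close> by (intro mult_right_mono) auto
    finally show "norm (1 ^ j - cis v ^ j) \<le> real l * norm (1 - cis v)" .
  qed
  also have "\<dots> = real l * (real l * (2 * \<bar>sin (v/2)\<bar>))" using norm_cis_minus_1[of v] by (simp add: norm_minus_commute)
  finally have "real l * (1 - s) \<le> real l * (real l * (2 * \<bar>sin (v/2)\<bar>))" using l by (simp add: s_def algebra_simps)
  then have 1: "1 - s \<le> 2 * real l * \<bar>sin (v/2)\<bar>" using l by simp
  have "1 - fejer l v = (1 - s) * (1 + s)" by (simp add: fejer_def s_def power2_eq_square algebra_simps)
  also have "\<dots> \<le> (1 - s) * 2" using s by (intro mult_left_mono) auto
  also have "\<dots> \<le> (2 * real l * \<bar>sin (v/2)\<bar>) * 2" using 1 by (rule mult_right_mono) simp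
  finally show ?thesis by (simp add: mult_ac)
qed

lemma continuous_on_fejer [continuous_intros]:
  "continuous_on S g \<Longrightarrow> continuous_on S (\<lambda>x. fejer l (g x))"
  unfolding fejer_def by (cases "l = 0") (auto intro!: continuous_intros)

text \<open>Joins the trivial bound \<open>1\<close> with the bound \<open>16 / (l v)^2\<close> from
  the closed formula; the form with \<open>1 + l |v|\<close> covers both ranges at once, and
  \<open>2 + 2 * 16\<close> is below \<open>36\<close>.\<close>

lemma fejer_decay:
  assumes "l \<ge> 1" "\<bar>v\<bar> \<le> pi"
  shows "fejer l v \<le> 36 / (1 + real l * \<bar>v\<bar>)\<^sup>2"
proof -
  have s: "\<bar>v\<bar> / 4 \<le> \<bar>sin (v/2)\<bar>"
    using half_le_sin[of "\<bar>v\<bar>/2"] assms(2) by (cases "v \<ge> 0") (auto simp: abs_if)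
  have "(real l * \<bar>v\<bar>)\<^sup>2 / 16 * fejer l v = (real l * (\<bar>v\<bar> / 4))\<^sup>2 * fejer l v"
    by (simp add: power_mult_distrib power_divide)
  also have "\<dots> \<le> (real l * \<bar>sin (v/2)\<bar>)\<^sup>2 * fejer l v"
    using s by (intro mult_right_mono power_mono mult_left_mono) auto
  also have "\<dots> = (sin (real l * v / 2))\<^sup>2"
    using fejer_mult_sin[of l v] by (simp add: power_mult_distrib mult.commute)
  also have "\<dots> \<le> 1" by (simp add: abs_square_le_1)
  finally have 1: "(real l * \<bar>v\<bar>)\<^sup>2 * fejer l v \<le> 16" by simp
  have "(1 + real l * \<bar>v\<bar>)\<^sup>2 \<le> 2 + 2 * (real l * \<bar>v\<bar>)\<^sup>2"
    using zero_le_power2[of "1 - real l * \<bar>v\<bar>"] by (simp add: power2_eq_square algebra_simps)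
  then have "(1 + real l * \<bar>v\<bar>)\<^sup>2 * fejer l v \<le> (2 + 2 * (real l * \<bar>v\<bar>)\<^sup>2) * fejer l v"
    by (rule mult_right_mono) simp
  also have "\<dots> = 2 * fejer l v + 2 * ((real l * \<bar>v\<bar>)\<^sup>2 * fejer l v)" by (simp add: algebra_simps)
  also have "\<dots> \<le> 36" using 1 fejer_le_one[of l v] by linarith
  finally show ?thesis by (simp add: field_simps add_pos_nonneg zero_less_power2 add_nonneg_eq_0_iff)
qed

lemma integral_inverse_square_le:
  assumes "l \<ge> 1" shows "integral {-pi..pi} (\<lambda>v. 1 / (1 + real l * \<bar>v\<bar>)\<^sup>2) \<le> 2 / real l"
proof -
  have l: "real l > 0" using assms by simp
  have pos: "((\<lambda>v. 1 / (1 + real l * v)\<^sup>2) has_integral (- inverse (1 + real l * pi) / real l - (- inverse (1 + real l * 0) / real l))) {0..pi}"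
  proof (rule fundamental_theorem_of_calculus)
    fix x assume "x \<in> {0..pi}"
    then have "1 + real l * x > 0" using l by (auto intro: add_pos_nonneg)
    then show "((\<lambda>v. - inverse (1 + real l * v) / real l) has_vector_derivative 1 / (1 + real l * x)\<^sup>2) (at x within {0..pi})"
      unfolding has_real_derivative_iff_has_vector_derivative[symmetric]
      using l by (auto intro!: derivative_eq_intros simp: inverse_eq_divide power2_eq_square)
  qed auto
  define I where "I = - inverse (1 + real l * pi) / real l - (- inverse (1 + real l * 0) / real l)"
  have I: "I \<le> 1 / real l" using l by (simp add: I_def)
  have p1: "((\<lambda>v. 1 / (1 + real l * \<bar>v\<bar>)\<^sup>2) has_integral I) {0..pi}"
    by (rule has_integral_eq[OF _ pos[folded I_def]]) auto
  have "((\<lambda>v. 1 / (1 + real l * \<bar>- v\<bar>)\<^sup>2) has_integral I) {-pi..-0}"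
    using p1 has_integral_reflect_real[of "\<lambda>v. 1 / (1 + real l * \<bar>v\<bar>)\<^sup>2" I pi 0] by simp
  then have p2: "((\<lambda>v. 1 / (1 + real l * \<bar>v\<bar>)\<^sup>2) has_integral I) {-pi..0}" by simp
  have "((\<lambda>v. 1 / (1 + real l * \<bar>v\<bar>)\<^sup>2) has_integral (I + I)) {-pi..pi}"
    by (rule has_integral_combine[OF _ _ p2 p1]) auto
  then show ?thesis using I by (simp add: integral_unique)
qed

lemma integral_periodic_shift:
  fixes g :: "real \<Rightarrow> real"
  assumes cont: "continuous_on UNIV g" and per: "\<And>v. g (v + 2 * pi) = g v" and c: "\<bar>c\<bar> \<le> 2 * pi"
  shows "integral {-pi..pi} (\<lambda>v. g (v + c)) = integral {-pi..pi} g"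
proof -
  have gi: "h integrable_on {a..b}" if "continuous_on UNIV h" for h :: "real \<Rightarrow> real" and a b
    using that by (intro integrable_continuous_real) (auto intro: continuous_on_subset)
  have A: "integral {-pi..pi} (\<lambda>v. h (v + d)) = integral {-pi..pi} h"
    if h: "continuous_on UNIV h" "\<And>v. h (v + 2 * pi) = h v" and d: "0 \<le> d" "d \<le> 2 * pi" for h :: "real \<Rightarrow> real" and d
  proof -
    have "integral {-pi..pi} (\<lambda>v. h (v + d)) = integral {-pi+d..pi+d} h"
      using integral_shift_Icc_real[of "-pi" pi h d] by (simp add: o_def add.commute)
    also have "\<dots> = integral {-pi+d..pi} h + integral {pi..pi+d} h"
      using d by (intro Henstock_Kurzweil_Integration.integral_combine[symmetric] gi h) auto
    also have "integral {pi..pi+d} h = integral {-pi..-pi+d} (\<lambda>v. h (v + 2*pi))"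
      using integral_shift_Icc_real[of "-pi" "-pi+d" h "2*pi"] by (simp add: o_def add.commute)
    also have "\<dots> = integral {-pi..-pi+d} h" by (simp add: h)
    also have "integral {-pi+d..pi} h + integral {-pi..-pi+d} h = integral {-pi..pi} h"
      using d by (subst add.commute, intro Henstock_Kurzweil_Integration.integral_combine gi h) auto
    finally show ?thesis .
  qed
  show ?thesis
  proof (cases "c \<ge> 0")
    case True then show ?thesis using A[OF cont per] c by simp
  next
    case False
    have "integral {-pi..pi} (\<lambda>v. g (v + - c + c)) = integral {-pi..pi} (\<lambda>v. g (v + c))"
    proof (rule A[where h = "\<lambda>v. g (v + c)" and d = "- c"])
      show "continuous_on UNIV (\<lambda>v. g (v + c))"
        by (intro continuous_on_compose2[OF cont] continuous_intros) auto
      show "g (v + 2 * pi + c) = g (v + c)" for v using per[of "v + c"] by (simp add: algebra_simps)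
    qed (use False c in auto)
    then show ?thesis by simp
  qed
qed

section \<open>Cosine polynomials and smoothed indicators\<close>

definition cos_poly :: "nat \<Rightarrow> (real \<Rightarrow> real) \<Rightarrow> bool" where
  "cos_poly d U \<longleftrightarrow> (\<exists>c. \<forall>v. U v = (\<Sum>k\<le>d. c k * cos (real k * v)))"

lemma cos_poly_add: "cos_poly d U \<Longrightarrow> cos_poly d V \<Longrightarrow> cos_poly d (\<lambda>v. U v + V v)"
proof -
  assume "cos_poly d U" "cos_poly d V"
  then obtain c b where c: "\<And>v. U v = (\<Sum>k\<le>d. c k * cos (real k * v))"
    and b: "\<And>v. V v = (\<Sum>k\<le>d. b k * cos (real k * v))" by (auto simp: cos_poly_def)
  have "U v + V v = (\<Sum>k\<le>d. (c k + b k) * cos (real k * v))" for v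
    unfolding b c by (simp add: sum.distrib algebra_simps)
  then show ?thesis unfolding cos_poly_def by (intro exI[of _ "\<lambda>k. c k + b k"]) simp
qed

lemma cos_poly_cmult: "cos_poly d U \<Longrightarrow> cos_poly d (\<lambda>v. a * U v)"
proof -
  assume "cos_poly d U"
  then obtain c where c: "\<And>v. U v = (\<Sum>k\<le>d. c k * cos (real k * v))" by (auto simp: cos_poly_def)
  have "a * U v = (\<Sum>k\<le>d. (a * c k) * cos (real k * v))" for v
    unfolding c by (simp add: sum_distrib_left mult_ac)
  then show ?thesis unfolding cos_poly_def by (intro exI[of _ "\<lambda>k. a * c k"]) simp
qed

lemma cos_poly_cos: "k \<le> d \<Longrightarrow> cos_poly d (\<lambda>v. cos (real k * v))"
  unfolding cos_poly_def
  by (intro exI[of _ "\<lambda>j. if j = k then 1 else 0"]) (simp add: if_distrib[of "\<lambda>x. x * _"] cong: if_cong)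

lemma cos_poly_sum: "(\<And>i. i \<in> I \<Longrightarrow> cos_poly d (U i)) \<Longrightarrow> cos_poly d (\<lambda>v. \<Sum>i\<in>I. U i v)"
proof (induction I rule: infinite_finite_induct)
  case (insert x F)
  then show ?case using cos_poly_add[of d "U x" "\<lambda>v. \<Sum>i\<in>F. U i v"] by simp
qed (use cos_poly_cmult[OF cos_poly_cos[of 0 d], of 0] in auto)

lemma cos_poly_mult:
  assumes "cos_poly d U" "cos_poly e V" shows "cos_poly (d + e) (\<lambda>v. U v * V v)"
proof -
  obtain c b where c: "\<And>v. U v = (\<Sum>k\<le>d. c k * cos (real k * v))"
    and b: "\<And>v. V v = (\<Sum>k\<le>e. b k * cos (real k * v))" using assms by (auto simp: cos_poly_def)
  have prod: "cos (real i * v) * cos (real j * v) =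
      1/2 * cos (real (i + j) * v) + 1/2 * cos (real (if i \<le> j then j - i else i - j) * v)" for i j v
  proof -
    have "cos (real (if i \<le> j then j - i else i - j) * v) = cos (real i * v - real j * v)"
      using cos_minus[of "real i * v - real j * v"] by (auto simp: of_nat_diff algebra_simps)
    then show ?thesis by (simp add: cos_add cos_diff algebra_simps)
  qed
  have "cos_poly (d + e) (\<lambda>v. \<Sum>i\<le>d. \<Sum>j\<le>e. (c i * b j) *
      (1/2 * cos (real (i + j) * v) + 1/2 * cos (real (if i \<le> j then j - i else i - j) * v)))"
    by (intro cos_poly_sum cos_poly_cmult cos_poly_add cos_poly_cos) auto
  moreover have "U v * V v = (\<Sum>i\<le>d. \<Sum>j\<le>e. (c i * b j) *
      (1/2 * cos (real (i + j) * v) + 1/2 * cos (real (if i \<le> j then j - i else i - j) * v)))" for v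
    unfolding b c sum_product prod[symmetric] by (simp add: mult_ac)
  ultimately show ?thesis by simp
qed

lemma cos_poly_power: "cos_poly d U \<Longrightarrow> cos_poly (n * d) (\<lambda>v. U v ^ n)"
proof (induction n)
  case 0
  then show ?case using cos_poly_cos[of 0 0] by simp
next
  case (Suc n)
  then show ?case using cos_poly_mult[of d U "n * d" "\<lambda>v. U v ^ n"] by simp
qed

lemma fejer_eq_sum_cos: "fejer l v = (\<Sum>j<l. \<Sum>k<l. cos ((real j - real k) * v)) / (real l)\<^sup>2"
proof -
  have "(norm (\<Sum>j<l. cis (real j * v)))\<^sup>2 = (\<Sum>j<l. cos (real j * v))\<^sup>2 + (\<Sum>j<l. sin (real j * v))\<^sup>2"
    by (simp add: cmod_power2)
  also have "\<dots> = (\<Sum>j<l. \<Sum>k<l. cos ((real j - real k) * v))"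
    by (simp add: power2_eq_square sum_product left_diff_distrib cos_diff sum.distrib)
  finally show ?thesis by (simp add: fejer_def power_divide)
qed

lemma fejer_cos_poly: "cos_poly (l - 1) (fejer l)"
proof -
  have 1: "cos ((real j - real k) * v) = cos (real (if j \<le> k then k - j else j - k) * v)" for j k v
    using cos_minus[of "(real j - real k) * v"] by (auto simp: of_nat_diff algebra_simps)
  have "cos_poly (l - 1) (\<lambda>v. (1 / (real l)\<^sup>2) * (\<Sum>j<l. \<Sum>k<l. cos ((real j - real k) * v)))"
    unfolding 1 by (intro cos_poly_cmult cos_poly_sum cos_poly_cos) (auto simp: less_diff_conv)
  moreover have "fejer l = (\<lambda>v. (1 / (real l)\<^sup>2) * (\<Sum>j<l. \<Sum>k<l. cos ((real j - real k) * v)))"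
    by (simp add: fun_eq_iff fejer_eq_sum_cos)
  ultimately show ?thesis by simp
qed

text \<open>As a function of \<open>\<theta>\<close> this is the convolution of the indicator of \<open>[-\<tau>, \<tau>]\<close> with the normalised
  kernel \<open>fejer l ^ s\<close>; on \<open>[0, pi]\<close> it is therefore close to the indicator of \<open>\<theta> < \<tau>\<close>.\<close>

definition step_kernel :: "nat \<Rightarrow> nat \<Rightarrow> real \<Rightarrow> real \<Rightarrow> real" where
  "step_kernel l s \<tau> \<theta> = integral {\<theta>-\<tau>..\<theta>+\<tau>} (\<lambda>v. fejer l v ^ s) / integral {-pi..pi} (\<lambda>v. fejer l v ^ s)"

lemma integral_cos_shifted:
  assumes "\<tau> \<ge> 0"
  shows "integral {\<theta>-\<tau>..\<theta>+\<tau>} (\<lambda>v. cos (real k * v)) =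
    (if k = 0 then 2 * \<tau> else 2 * sin (real k * \<tau>) / real k) * cos (real k * \<theta>)"
proof (cases "k = 0")
  case False
  have "((\<lambda>v. cos (real k * v)) has_integral
      (sin (real k * (\<theta>+\<tau>)) / real k - sin (real k * (\<theta>-\<tau>)) / real k)) {\<theta>-\<tau>..\<theta>+\<tau>}"
  proof (rule fundamental_theorem_of_calculus)
    fix x show "((\<lambda>v. sin (real k * v) / real k) has_vector_derivative cos (real k * x)) (at x within {\<theta>-\<tau>..\<theta>+\<tau>})"
      unfolding has_real_derivative_iff_has_vector_derivative[symmetric]
      using False by (auto intro!: derivative_eq_intros)
  qed (use assms in auto)
  then have "integral {\<theta>-\<tau>..\<theta>+\<tau>} (\<lambda>v. cos (real k * v)) = sin (real k * (\<theta>+\<tau>)) / real k - sin (real k * (\<theta>-\<tau>)) / real k"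
    by (rule integral_unique)
  then show ?thesis using False by (simp add: distrib_left right_diff_distrib sin_add sin_diff diff_divide_distrib[symmetric])
qed (use assms in auto)

text \<open>The variables separate, and the coefficients are continuous in \<tau>. Integrating the
  kernel against a continuous function of \<tau> therefore leaves a polynomial in
  \<open>cos \<theta>\<close> of degree at most \<open>s * (l - 1)\<close>.\<close>

lemma step_kernel_cos_expansion:
  obtains b where "\<And>k. continuous_on UNIV (b k)"
    "\<And>\<tau> \<theta>. \<tau> \<ge> 0 \<Longrightarrow> step_kernel l s \<tau> \<theta> = (\<Sum>k\<le>s * (l - 1). b k \<tau> * cos (real k * \<theta>))"
proof -
  obtain c where c: "\<And>v. fejer l v ^ s = (\<Sum>k\<le>s * (l - 1). c k * cos (real k * v))"
    using cos_poly_power[OF fejer_cos_poly, of s l] by (auto simp: cos_poly_def)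
  define N where "N = integral {-pi..pi} (\<lambda>v. fejer l v ^ s)"
  define g where "g = (\<lambda>k \<tau>::real. if k = (0::nat) then 2 * \<tau> else 2 * sin (real k * \<tau>) / real k)"
  show thesis
  proof (rule that[of "\<lambda>k \<tau>. c k * g k \<tau> / N"])
    show "continuous_on UNIV (\<lambda>\<tau>. c k * g k \<tau> / N)" for k
      unfolding g_def divide_inverse by (cases "k = 0") (auto intro!: continuous_intros)
    fix \<tau> \<theta> :: real assume \<tau>: "\<tau> \<ge> 0"
    have "integral {\<theta>-\<tau>..\<theta>+\<tau>} (\<lambda>v. fejer l v ^ s) = (\<Sum>k\<le>s * (l - 1). integral {\<theta>-\<tau>..\<theta>+\<tau>} (\<lambda>v. c k * cos (real k * v)))"
      unfolding c by (intro integral_sum integrable_continuous_real continuous_intros) auto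
    also have "\<dots> = (\<Sum>k\<le>s * (l - 1). c k * (g k \<tau> * cos (real k * \<theta>)))"
      using integral_cos_shifted[OF \<tau>] by (simp add: g_def)
    finally show "step_kernel l s \<tau> \<theta> = (\<Sum>k\<le>s * (l - 1). c k * g k \<tau> / N * cos (real k * \<theta>))"
      by (simp add: step_kernel_def N_def[symmetric] sum_divide_distrib mult_ac)
  qed
qed

lemma fejer_power_integrable: "(\<lambda>v. fejer l v ^ s) integrable_on {a..b}"
  by (intro integrable_continuous_real continuous_intros)

text \<open>On \<open>|v| \<le> 1/(4 l)\<close> the kernel is at least \<open>1/2\<close>.\<close>

lemma fejer_mass_ge:
  assumes l: "l \<ge> 1" shows "1 / (2 ^ s * (2 * real l)) \<le> integral {-pi..pi} (\<lambda>v. fejer l v ^ s)"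
proof -
  have l0: "real l > 0" using l by simp
  have l1: "1 / (4 * real l) \<le> 1" using l by simp
  have "(1/2)^s * (1 / (4 * real l) - (- 1 / (4 * real l))) \<le> integral {-pi..pi} (\<lambda>v. fejer l v ^ s)"
  proof (rule integral_ge_rectangle)
    fix x assume x: "x \<in> {- 1 / (4 * real l)..1 / (4 * real l)}"
    then have "\<bar>x\<bar> \<le> 1 / (4 * real l)" by auto
    then have xl: "real l * \<bar>x\<bar> \<le> 1/4" using l0 by (simp add: field_simps)
    have "1 - fejer l x \<le> 4 * real l * \<bar>sin (x/2)\<bar>" using l by (rule one_minus_fejer_le)
    also have "\<dots> \<le> 4 * real l * \<bar>x/2\<bar>" by (intro mult_left_mono abs_sin_x_le_abs_x) auto
    also have "\<dots> \<le> 1/2" using xl by (simp add: abs_divide mult_ac)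
    finally show "(1/2)^s \<le> fejer l x ^ s" by (intro power_mono) auto
  next
    show "- pi \<le> - 1 / (4 * real l)" "1 / (4 * real l) \<le> pi" using l1 pi_gt3 by simp_all
    show "- 1 / (4 * real l) \<le> 1 / (4 * real l)" using l0 by simp
  qed (auto intro!: continuous_intros)
  then show ?thesis by (simp add: power_divide field_simps)
qed

text \<open>Of the \<open>2 s\<close> powers of decay two are kept inside, where their integral is
  of order \<open>1/l\<close>; the other \<open>2 s - 2\<close> are evaluated at the distance
  \<delta>.\<close>

lemma fejer_tail:
  assumes l: "l \<ge> 1" and s: "s \<ge> 1" and ab: "- pi \<le> a" "b \<le> pi" and \<delta>: "\<delta> \<ge> 0" "\<And>v. v \<in> {a..b} \<Longrightarrow> \<delta> \<le> \<bar>v\<bar>"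
  shows "integral {a..b} (\<lambda>v. fejer l v ^ s) \<le> 36 ^ s / (1 + real l * \<delta>) ^ (2 * s - 2) * (2 / real l)"
proof -
  have l0: "real l > 0" using l by simp
  define B where "B = (\<lambda>v::real. 1 / (1 + real l * \<bar>v\<bar>))"
  have B: "0 < B v" for v using l0 by (auto simp: B_def intro!: divide_pos_pos add_pos_nonneg)
  have Bi: "(\<lambda>v. (B v)\<^sup>2) integrable_on {x..y}" for x y
    unfolding B_def using l0
    by (intro integrable_continuous_real continuous_intros) (smt (verit) mult_nonneg_nonneg abs_ge_zero)
  let ?K = "36 ^ s * (1 / (1 + real l * \<delta>)) ^ (2 * s - 2)"
  have K0: "?K \<ge> 0" using l0 \<delta>(1) by simp
  have "integral {a..b} (\<lambda>v. fejer l v ^ s) \<le> integral {a..b} (\<lambda>v. ?K * (B v)\<^sup>2)"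
  proof (rule integral_le)
    fix v assume v: "v \<in> {a..b}"
    have "fejer l v \<le> 36 * (B v)\<^sup>2"
      using fejer_decay[OF l, of v] v ab by (simp add: B_def power_divide abs_le_iff)
    then have "fejer l v ^ s \<le> (36 * (B v)\<^sup>2) ^ s" by (intro power_mono) auto
    also have "\<dots> = 36 ^ s * B v ^ (2 * s - 2) * (B v)\<^sup>2"
    proof -
      have "2 * s = (2 * s - 2) + 2" using s by simp
      then have "((B v)\<^sup>2) ^ s = B v ^ (2 * s - 2) * (B v)\<^sup>2" by (metis power_add power_mult)
      then show ?thesis by (simp add: power_mult_distrib)
    qed
    also have "B v \<le> 1 / (1 + real l * \<delta>)"
      unfolding B_def using \<delta>(1) \<delta>(2)[OF v] l0 by (intro divide_left_mono) (auto intro!: add_pos_nonneg mult_pos_pos)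
    then have "36 ^ s * B v ^ (2 * s - 2) * (B v)\<^sup>2 \<le> ?K * (B v)\<^sup>2"
      using B[of v] by (intro mult_right_mono mult_left_mono power_mono) auto
    finally show "fejer l v ^ s \<le> ?K * (B v)\<^sup>2" .
  qed (auto intro!: fejer_power_integrable integrable_on_mult_right Bi)
  also have "\<dots> = ?K * integral {a..b} (\<lambda>v. (B v)\<^sup>2)" by simp
  also have "\<dots> \<le> ?K * integral {-pi..pi} (\<lambda>v. (B v)\<^sup>2)"
    using ab K0 by (intro mult_left_mono integral_subset_le Bi) auto
  also have "\<dots> \<le> ?K * (2 / real l)"
    using integral_inverse_square_le[OF l] K0 by (intro mult_left_mono) (auto simp: B_def power_divide)
  finally show ?thesis by (simp add: power_divide)
qed

text \<open>\<open>step_kernel\<close> is the share of the kernel's mass in the window of radius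
  \<tau> about \<theta>. Its difference from the indicator is the mass of at most two arcs, taken
  modulo \<open>2 pi\<close>, that stay at distance at least \<open>|\<theta> - \<tau>|\<close> from
  \<open>0\<close>.\<close>

lemma step_kernel_error:
  assumes l: "l \<ge> 1" and s: "s \<ge> 1" and \<theta>: "0 \<le> \<theta>" "\<theta> \<le> pi" and \<tau>: "0 \<le> \<tau>" "\<tau> \<le> pi"
  shows "\<bar>(if \<theta> < \<tau> then 1 else 0) - step_kernel l s \<tau> \<theta>\<bar> \<le> 8 * 72 ^ s / (1 + real l * \<bar>\<theta> - \<tau>\<bar>) ^ (2 * s - 2)"
proof -
  have l0: "real l > 0" using l by simp
  define J where "J = (\<lambda>v. fejer l v ^ s)"
  define N where "N = integral {-pi..pi} J"
  define T where "T = 36 ^ s / (1 + real l * \<bar>\<theta> - \<tau>\<bar>) ^ (2 * s - 2) * (2 / real l)"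
  have T0: "T \<ge> 0" by (simp add: T_def)
  have Ji: "J integrable_on {a..b}" for a b unfolding J_def by (rule fejer_power_integrable)
  have J0: "integral {a..b} J \<ge> 0" for a b using Ji by (intro integral_nonneg) (auto simp: J_def)
  have N: "N \<ge> 1 / (2 ^ s * (2 * real l))" unfolding N_def J_def by (rule fejer_mass_ge[OF l])
  then have N0: "N > 0" using l0 by (smt (verit) divide_pos_pos mult_pos_pos zero_less_power)
  have tail: "integral {a..b} J \<le> T" if "- pi \<le> a" "b \<le> pi" "\<And>v. v \<in> {a..b} \<Longrightarrow> \<bar>\<theta> - \<tau>\<bar> \<le> \<bar>v\<bar>" for a b
    unfolding J_def T_def by (rule fejer_tail[OF l s that(1,2) _ that(3)]) auto
  have comb: "integral {a..b} J + integral {b..c} J = integral {a..c} J" if "a \<le> b" "b \<le> c" for a b c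
    using that Ji by (rule Henstock_Kurzweil_Integration.integral_combine)
  have shift: "integral {a+2*pi..b+2*pi} J = integral {a..b} J" for a b
    using integral_shift_Icc_real[of a b J "2*pi"] fejer_periodic[of l]
    by (simp add: o_def add.commute J_def)
  define I where "I = integral {\<theta>-\<tau>..\<theta>+\<tau>} J"
  have goal: "\<bar>(if \<theta> < \<tau> then N else 0) - I\<bar> \<le> 2 * T"
  proof (cases "\<theta> + \<tau> \<le> pi")
    case small: True
    show ?thesis
    proof (cases "\<theta> < \<tau>")
      case True
      have "N = integral {-pi..\<theta>-\<tau>} J + I + integral {\<theta>+\<tau>..pi} J"
        unfolding N_def I_def using comb[of "-pi" "\<theta>-\<tau>" "\<theta>+\<tau>"] comb[of "-pi" "\<theta>+\<tau>" pi] small True \<theta> \<tau> by auto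
      moreover have "integral {-pi..\<theta>-\<tau>} J \<le> T" using True \<theta> \<tau> by (intro tail) auto
      moreover have "integral {\<theta>+\<tau>..pi} J \<le> T" using True \<theta> \<tau> by (intro tail) auto
      ultimately show ?thesis using True J0[of "-pi" "\<theta>-\<tau>"] J0[of "\<theta>+\<tau>" pi] by simp
    next
      case False
      then have "I \<le> T" unfolding I_def using \<theta> \<tau> small by (intro tail) auto
      then show ?thesis using False J0[of "\<theta>-\<tau>" "\<theta>+\<tau>"] T0 by (simp add: I_def)
    qed
  next
    \<comment> \<open>The window leaves \<open>[-pi, pi]\<close> on the right; by periodicity the
      overhanging part is moved back by \<open>2 pi\<close>.\<close>
    case big: False
    have I: "I = integral {\<theta>-\<tau>..pi} J + integral {-pi..\<theta>+\<tau>-2*pi} J"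
      unfolding I_def using comb[of "\<theta>-\<tau>" pi "\<theta>+\<tau>"] shift[of "-pi" "\<theta>+\<tau>-2*pi"] big \<theta> \<tau> by auto
    show ?thesis
    proof (cases "\<theta> < \<tau>")
      case True
      have "N = I + integral {\<theta>+\<tau>-2*pi..\<theta>-\<tau>} J"
        unfolding N_def I using comb[of "-pi" "\<theta>+\<tau>-2*pi" "\<theta>-\<tau>"] comb[of "-pi" "\<theta>-\<tau>" pi] big \<theta> \<tau> by auto
      moreover have "integral {\<theta>+\<tau>-2*pi..\<theta>-\<tau>} J \<le> T" using True big \<theta> \<tau> by (intro tail) auto
      ultimately show ?thesis using True J0[of "\<theta>+\<tau>-2*pi" "\<theta>-\<tau>"] T0 by simp
    next
      case False
      have "integral {\<theta>-\<tau>..pi} J \<le> T" using False big \<theta> \<tau> by (intro tail) auto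
      moreover have "integral {-pi..\<theta>+\<tau>-2*pi} J \<le> T" using False big \<theta> \<tau> by (intro tail) auto
      ultimately show ?thesis using False I J0[of "\<theta>-\<tau>" "pi"] J0[of "-pi" "\<theta>+\<tau>-2*pi"] by simp
    qed
  qed
  have "(if \<theta> < \<tau> then 1 else 0) - step_kernel l s \<tau> \<theta> = ((if \<theta> < \<tau> then N else 0) - I) / N"
    using N0 by (simp add: step_kernel_def N_def[symmetric] I_def[symmetric] J_def[symmetric] diff_divide_distrib)
  then have "\<bar>(if \<theta> < \<tau> then 1 else 0) - step_kernel l s \<tau> \<theta>\<bar> = \<bar>(if \<theta> < \<tau> then N else 0) - I\<bar> / N"
    using N0 by (simp only: abs_divide abs_of_pos)
  also have "\<dots> \<le> 2 * T / N" using goal N0 by (intro divide_right_mono) auto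
  \<comment> \<open>\<open>8\<close> collects the two tails, the factor \<open>2\<close> in each of
    them and the factor \<open>2\<close> in the lower bound for the mass;
    \<open>72 = 36 * 2\<close>.\<close>
  also have "\<dots> \<le> 2 * T / (1 / (2 ^ s * (2 * real l)))" using N T0 l0 N0 by (intro divide_left_mono) auto
  also have "\<dots> = 8 * (36 ^ s * 2 ^ s) / (1 + real l * \<bar>\<theta> - \<tau>\<bar>) ^ (2 * s - 2)"
    using l0 by (simp add: T_def field_simps)
  also have "36 ^ s * 2 ^ s = (72::real) ^ s" by (simp add: power_mult_distrib[symmetric])
  finally show ?thesis .
qed

text \<open>The two shifts have no zeros in common, so that the sum has the lower bound \<open>fejer_pair_ge\<close>
  and the decay of \<open>step_kernel_error\<close> is dominated by a trigonometric polynomial.\<close>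

definition fejer_pair :: "nat \<Rightarrow> real \<Rightarrow> real" where
  "fejer_pair l u = fejer l (u - pi / (2 * real l)) + fejer l (u + pi / (2 * real l))"

lemma fejer_pair_nonneg [simp]: "0 \<le> fejer_pair l u"
  by (simp add: fejer_pair_def)

lemma continuous_on_fejer_pair [continuous_intros]:
  "continuous_on S g \<Longrightarrow> continuous_on S (\<lambda>x. fejer_pair l (g x))"
  unfolding fejer_pair_def by (intro continuous_intros)

text \<open>The two arguments differ by \<open>pi / l\<close>, so the numerators in the closed
  formula of \<open>fejer\<close> are \<open>sin^2\<close> and \<open>cos^2\<close> of one angle and
  add up to \<open>1\<close>. The denominators are at most \<open>(1 + l |u|)^2\<close>.\<close>

lemma fejer_pair_ge:
  assumes l: "l \<ge> 1" shows "1 / (1 + real l * \<bar>u\<bar>)\<^sup>2 \<le> fejer_pair l u"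
proof -
  have l0: "real l > 0" using l by simp
  define b where "b = pi / (2 * real l)"
  have lb: "real l * b = pi / 2" using l0 by (simp add: b_def)
  have b0: "b > 0" using l0 by (simp add: b_def)
  have *: "(sin (real l * v / 2))\<^sup>2 \<le> fejer l v * (1 + real l * \<bar>u\<bar>)\<^sup>2" if "\<bar>v\<bar> \<le> \<bar>u\<bar> + b" for v
  proof -
    have "\<bar>real l * sin (v / 2)\<bar> \<le> real l * \<bar>v / 2\<bar>"
      unfolding abs_mult abs_of_nat by (intro mult_left_mono abs_sin_x_le_abs_x) auto
    also have "\<dots> \<le> real l * ((\<bar>u\<bar> + b) / 2)" using that by (intro mult_left_mono) auto
    also have "\<dots> = real l * \<bar>u\<bar> / 2 + pi / 4" using lb by (simp add: algebra_simps)
    also have "\<dots> \<le> 1 + real l * \<bar>u\<bar>"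
    proof -
      have "0 \<le> real l * \<bar>u\<bar>" using l0 by simp
      then show ?thesis using pi_less_4 by linarith
    qed
    finally have "(real l * sin (v / 2))\<^sup>2 \<le> (1 + real l * \<bar>u\<bar>)\<^sup>2"
      using power_mono[of "\<bar>real l * sin (v / 2)\<bar>" "1 + real l * \<bar>u\<bar>" 2] by simp
    then show ?thesis using fejer_mult_sin[of l v] by (metis fejer_nonneg mult_left_mono)
  qed
  have e: "real l * (u - b) / 2 = real l * u / 2 - pi / 4" "real l * (u + b) / 2 = (real l * u / 2 - pi / 4) + pi / 2"
    by (simp_all add: right_diff_distrib distrib_left lb diff_divide_distrib add_divide_distrib)
  have "(sin (real l * (u - b) / 2))\<^sup>2 + (sin (real l * (u + b) / 2))\<^sup>2 = 1"
    unfolding e using sin_cos_squared_add[of "real l * u / 2 - pi / 4"] by (simp only: sin_add sin_pi_half cos_pi_half) simp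
  moreover have "(sin (real l * (u - b) / 2))\<^sup>2 \<le> fejer l (u - b) * (1 + real l * \<bar>u\<bar>)\<^sup>2" using b0 by (intro *) auto
  moreover have "(sin (real l * (u + b) / 2))\<^sup>2 \<le> fejer l (u + b) * (1 + real l * \<bar>u\<bar>)\<^sup>2" using b0 by (intro *) auto
  ultimately have "1 \<le> fejer_pair l u * (1 + real l * \<bar>u\<bar>)\<^sup>2"
    by (simp add: fejer_pair_def b_def distrib_right)
  moreover have "0 < (1 + real l * \<bar>u\<bar>)\<^sup>2" using l0 by (intro zero_less_power add_pos_nonneg) auto
  ultimately show ?thesis by (simp add: divide_le_eq)
qed

section \<open>Integrals of the kernels against the weight \<open>sin\<close>\<close>

lemma abs_sin_add_le: "\<bar>sin (x + y)\<bar> \<le> \<bar>sin x\<bar> + \<bar>y\<bar>" for x y :: real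
proof -
  have "\<bar>sin (x + y)\<bar> \<le> \<bar>sin x\<bar> * \<bar>cos y\<bar> + \<bar>cos x\<bar> * \<bar>sin y\<bar>"
    unfolding sin_add using abs_triangle_ineq[of "sin x * cos y" "cos x * sin y"] by (simp add: abs_mult)
  also have "\<dots> \<le> \<bar>sin x\<bar> * 1 + 1 * \<bar>y\<bar>"
    by (intro add_mono mult_mono abs_sin_x_le_abs_x) auto
  finally show ?thesis by simp
qed

text \<open>At distance \<open>v\<close> from the centre \<open>c\<close> the weight is at most
  \<open>(S + 1/l) (1 + l |v|)\<close>. For \<open>q \<ge> 2\<close> the kernel decays like the
  fourth power of \<open>1 / (1 + l |v|)\<close>, which absorbs this growth and leaves an integral
  of order \<open>1/l\<close>.\<close>

lemma fejer_shift_sin_integral: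
  assumes l: "l \<ge> 1" and q: "q \<ge> (2::real)" and c: "\<bar>c\<bar> \<le> 2 * pi" and S: "\<bar>sin c\<bar> \<le> S"
  shows "integral {-pi..pi} (\<lambda>\<theta>. fejer l (\<theta> - c) powr q * \<bar>sin \<theta>\<bar>) \<le> 2592 * (S + 1 / real l) / real l"
proof -
  have l0: "real l > 0" using l by simp
  have S0: "S \<ge> 0" using S by linarith
  define B where "B = (\<lambda>v::real. 1 / (1 + real l * \<bar>v\<bar>))"
  have B: "0 < B v" "B v * (1 + real l * \<bar>v\<bar>) = 1" for v
  proof -
    have "1 + real l * \<bar>v\<bar> > 0" using l0 by (simp add: add_pos_nonneg)
    then show "0 < B v" "B v * (1 + real l * \<bar>v\<bar>) = 1" by (simp_all add: B_def)
  qed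
  have B1: "B v \<le> 1" for v
  proof -
    have "1 \<le> 1 + real l * \<bar>v\<bar>" using l0 by simp
    then show ?thesis using mult_left_mono[of 1 "1 + real l * \<bar>v\<bar>" "B v"] B[of v] by simp
  qed
  have Bi: "(\<lambda>v. (B v)\<^sup>2) integrable_on {x..y}" for x y
    unfolding B_def using l0
    by (intro integrable_continuous_real continuous_intros) (smt (verit) mult_nonneg_nonneg abs_ge_zero)
  have cont: "continuous_on X (\<lambda>v. fejer l (v - d) powr q * \<bar>sin (v + e)\<bar>)" for d e X
    using q by (intro continuous_intros continuous_on_powr') auto
  have per: "fejer l (v + 2 * pi - d) = fejer l (v - d)" for v d
    using fejer_periodic[of l "v - d"] by (simp add: algebra_simps)
  \<comment> \<open>Periodicity centres the kernel at \<open>0\<close>, because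
    \<open>fejer_decay\<close> is confined to \<open>|v| \<le> pi\<close>.\<close>
  have "integral {-pi..pi} (\<lambda>\<theta>. fejer l (\<theta> - c) powr q * \<bar>sin \<theta>\<bar>)
      = integral {-pi..pi} (\<lambda>v. fejer l (v + c - c) powr q * \<bar>sin (v + c)\<bar>)"
    using cont[of UNIV c 0] per c
    by (intro integral_periodic_shift[symmetric, where g = "\<lambda>\<theta>. fejer l (\<theta> - c) powr q * \<bar>sin \<theta>\<bar>"]) auto
  also have "\<dots> \<le> integral {-pi..pi} (\<lambda>v. (1296 * (S + 1 / real l)) * (B v)\<^sup>2)"
  proof (rule integral_le)
    show "(\<lambda>v. fejer l (v + c - c) powr q * \<bar>sin (v + c)\<bar>) integrable_on {- pi..pi}"
      using cont[of "{-pi..pi}" 0 c] by (intro integrable_continuous_real) simp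
    show "(\<lambda>v. 1296 * (S + 1 / real l) * (B v)\<^sup>2) integrable_on {- pi..pi}"
      by (intro integrable_on_mult_right Bi)
    fix v assume v: "v \<in> {-pi..pi}"
    have "fejer l v powr q \<le> fejer l v powr 2"
      using q by (intro powr_mono') auto
    also have "\<dots> = (fejer l v)\<^sup>2" by simp
    also have "\<dots> \<le> (36 * (B v)\<^sup>2)\<^sup>2"
      using fejer_decay[OF l, of v] v by (intro power_mono) (auto simp: B_def power_divide)
    also have "\<dots> = 1296 * B v ^ 4" by (simp add: power_mult_distrib power_mult[symmetric])
    finally have 1: "fejer l v powr q \<le> 1296 * B v ^ 4" .
    have "\<bar>sin (v + c)\<bar> \<le> S + \<bar>v\<bar>" using abs_sin_add_le[of c v] S by (simp add: add.commute)
    also have "\<dots> \<le> (S + 1 / real l) * (1 + real l * \<bar>v\<bar>)" using S0 l0 by (simp add: algebra_simps)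
    finally have 2: "\<bar>sin (v + c)\<bar> \<le> (S + 1 / real l) * (1 + real l * \<bar>v\<bar>)" .
    have "fejer l v powr q * \<bar>sin (v + c)\<bar> \<le> (1296 * B v ^ 4) * ((S + 1 / real l) * (1 + real l * \<bar>v\<bar>))"
      using B[of v] by (intro mult_mono 1 2) auto
    also have "\<dots> = 1296 * (S + 1 / real l) * (B v ^ 3 * (B v * (1 + real l * \<bar>v\<bar>)))"
      by (simp add: power4_eq_xxxx power3_eq_cube)
    also have "\<dots> = 1296 * (S + 1 / real l) * B v ^ 3" by (simp add: B)
    also have "\<dots> \<le> 1296 * (S + 1 / real l) * (B v)\<^sup>2"
      using B[of v] B1[of v] S0 l0 by (intro mult_left_mono power_decreasing) auto
    finally show "fejer l (v + c - c) powr q * \<bar>sin (v + c)\<bar> \<le> 1296 * (S + 1 / real l) * (B v)\<^sup>2" by simp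
  qed
  also have "\<dots> = 1296 * (S + 1 / real l) * integral {-pi..pi} (\<lambda>v. (B v)\<^sup>2)" by simp
  also have "\<dots> \<le> 1296 * (S + 1 / real l) * (2 / real l)"
    using integral_inverse_square_le[OF l] S0 l0 by (intro mult_left_mono) (auto simp: B_def power_divide)
  finally show ?thesis by simp
qed

lemma powr_add_le_max:
  fixes x y q :: real
  assumes "0 \<le> x" "0 \<le> y" "0 \<le> q"
  shows "(x + y) powr q \<le> 2 powr q * (x powr q + y powr q)"
proof -
  have "(x + y) powr q \<le> (2 * max x y) powr q" using assms by (intro powr_mono2) auto
  also have "\<dots> = 2 powr q * (max x y) powr q" using assms by (simp add: powr_mult)
  also have "\<dots> \<le> 2 powr q * (x powr q + y powr q)" by (intro mult_left_mono) (auto simp: max_def)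
  finally show ?thesis .
qed

text \<open>The shifts by at most \<open>2/l\<close> change \<open>|sin \<tau>|\<close> by at most
  \<open>2/l\<close>, so \<open>S + 1/l = |sin \<tau>| + 3/l\<close>. The two kernels and the factor
  \<open>3\<close> make \<open>15552 = 6 * 2592\<close>.\<close>

lemma fejer_pair_sin_integral:
  assumes l: "l \<ge> 1" and q: "q \<ge> (2::real)" and \<tau>: "\<tau> \<in> {-pi..pi}"
  shows "integral {0..pi} (\<lambda>\<theta>. fejer_pair l (\<theta> - \<tau>) powr q * sin \<theta>)
    \<le> 2 powr q * 15552 * (\<bar>sin \<tau>\<bar> + 1 / real l) / real l"
proof -
  have l0: "real l > 0" using l by simp
  define b where "b = pi / (2 * real l)"
  have b: "0 \<le> b" "b \<le> 2 / real l" "b \<le> pi / 2"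
    using l pi_less_4 by (auto simp: b_def field_simps)
  define S where "S = \<bar>sin \<tau>\<bar> + 2 / real l"
  have s: "\<bar>sin (\<tau> + b)\<bar> \<le> S" "\<bar>sin (\<tau> - b)\<bar> \<le> S"
    using abs_sin_add_le[of \<tau> b] abs_sin_add_le[of \<tau> "- b"] b by (auto simp: S_def)
  have F1: "integral {-pi..pi} (\<lambda>\<theta>. fejer l (\<theta> - (\<tau> + b)) powr q * \<bar>sin \<theta>\<bar>) \<le> 2592 * (S + 1 / real l) / real l"
    by (rule fejer_shift_sin_integral[OF l q _ s(1)]) (use \<tau> b in auto)
  have F2: "integral {-pi..pi} (\<lambda>\<theta>. fejer l (\<theta> - (\<tau> - b)) powr q * \<bar>sin \<theta>\<bar>) \<le> 2592 * (S + 1 / real l) / real l"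
    by (rule fejer_shift_sin_integral[OF l q _ s(2)]) (use \<tau> b in auto)
  have cont: "continuous_on X (\<lambda>v. fejer l (v - d) powr q * \<bar>sin v\<bar>)" for d X
    using q by (intro continuous_intros continuous_on_powr') auto
  have int: "(\<lambda>v. fejer l (v - d) powr q * \<bar>sin v\<bar>) integrable_on {x..y}" for d x y
    using cont by (rule integrable_continuous_real)
  have "integral {0..pi} (\<lambda>\<theta>. fejer_pair l (\<theta> - \<tau>) powr q * sin \<theta>)
     \<le> integral {0..pi} (\<lambda>\<theta>. 2 powr q * (fejer l (\<theta> - (\<tau> + b)) powr q * \<bar>sin \<theta>\<bar> + fejer l (\<theta> - (\<tau> - b)) powr q * \<bar>sin \<theta>\<bar>))"
  proof (rule integral_le)
    show "(\<lambda>\<theta>. fejer_pair l (\<theta> - \<tau>) powr q * sin \<theta>) integrable_on {0..pi}"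
      using q by (intro integrable_continuous_real continuous_intros continuous_on_powr') auto
    show "(\<lambda>\<theta>. 2 powr q * (fejer l (\<theta> - (\<tau> + b)) powr q * \<bar>sin \<theta>\<bar> + fejer l (\<theta> - (\<tau> - b)) powr q * \<bar>sin \<theta>\<bar>)) integrable_on {0..pi}"
      by (intro integrable_on_mult_right integrable_add int)
    fix \<theta> assume \<theta>: "\<theta> \<in> {0..pi}"
    have "fejer_pair l (\<theta> - \<tau>) = fejer l (\<theta> - (\<tau> + b)) + fejer l (\<theta> - (\<tau> - b))"
      by (simp add: fejer_pair_def b_def algebra_simps)
    then have "fejer_pair l (\<theta> - \<tau>) powr q \<le> 2 powr q * (fejer l (\<theta> - (\<tau> + b)) powr q + fejer l (\<theta> - (\<tau> - b)) powr q)"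
      using powr_add_le_max[of "fejer l (\<theta> - (\<tau> + b))" "fejer l (\<theta> - (\<tau> - b))" q] q by simp
    then have "fejer_pair l (\<theta> - \<tau>) powr q * sin \<theta> \<le> 2 powr q * (fejer l (\<theta> - (\<tau> + b)) powr q + fejer l (\<theta> - (\<tau> - b)) powr q) * sin \<theta>"
      using \<theta> by (intro mult_right_mono sin_ge_zero) auto
    then show "fejer_pair l (\<theta> - \<tau>) powr q * sin \<theta> \<le> 2 powr q * (fejer l (\<theta> - (\<tau> + b)) powr q * \<bar>sin \<theta>\<bar> + fejer l (\<theta> - (\<tau> - b)) powr q * \<bar>sin \<theta>\<bar>)"
      using \<theta> sin_ge_zero[of \<theta>] by (simp add: algebra_simps)
  qed
  also have "\<dots> = 2 powr q * (integral {0..pi} (\<lambda>\<theta>. fejer l (\<theta> - (\<tau> + b)) powr q * \<bar>sin \<theta>\<bar>)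
      + integral {0..pi} (\<lambda>\<theta>. fejer l (\<theta> - (\<tau> - b)) powr q * \<bar>sin \<theta>\<bar>))"
    using int by (simp add: Henstock_Kurzweil_Integration.integral_add)
  also have "\<dots> \<le> 2 powr q * (2592 * (S + 1 / real l) / real l + 2592 * (S + 1 / real l) / real l)"
    by (intro mult_left_mono add_mono order_trans[OF integral_subset_le F1] order_trans[OF integral_subset_le F2] int) auto
  also have "\<dots> \<le> 2 powr q * (15552 * (\<bar>sin \<tau>\<bar> + 1 / real l) / real l)"
    using l0 by (intro mult_left_mono) (auto simp: S_def add_divide_distrib[symmetric] divide_right_mono intro!: divide_right_mono)
  finally show ?thesis by (simp only: times_divide_eq_right mult.assoc)
qed

section \<open>Trigonometric polynomials\<close>

text \<open>Encoded as \<open>cis (-d t)\<close> times a complex polynomial of degree at most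
  \<open>2 d\<close> in \<open>cis t\<close>: the modulus is then that of the polynomial on the unit
  circle, for which Nikolskii's inequality is stated.\<close>

definition trig_poly :: "nat \<Rightarrow> (real \<Rightarrow> real) \<Rightarrow> bool" where
  "trig_poly d U \<longleftrightarrow> (\<exists>q. degree q \<le> 2 * d \<and> (\<forall>t. of_real (U t) = cis (- real d * t) * poly q (cis t)))"

lemma trig_polyE:
  assumes "trig_poly d U"
  obtains q :: "complex poly" where "degree q \<le> 2 * d" "\<And>t. norm (poly q (cis t)) = \<bar>U t\<bar>"
proof -
  obtain q where q: "degree q \<le> 2 * d" "\<And>t. of_real (U t) = cis (- real d * t) * poly q (cis t)"
    using assms by (auto simp: trig_poly_def)
  have "\<bar>U t\<bar> = norm (poly q (cis t))" for t
    using arg_cong[OF q(2)[of t], of norm] by (simp add: norm_mult)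
  then show ?thesis using q(1) that by simp
qed

lemma trig_poly_mult: "trig_poly d U \<Longrightarrow> trig_poly e V \<Longrightarrow> trig_poly (d + e) (\<lambda>t. U t * V t)"
proof -
  assume "trig_poly d U" "trig_poly e V"
  then obtain q s where q: "degree q \<le> 2 * d" "\<And>t. of_real (U t) = cis (- real d * t) * poly q (cis t)"
    and s: "degree s \<le> 2 * e" "\<And>t. of_real (V t) = cis (- real e * t) * poly s (cis t)"
    by (auto simp: trig_poly_def)
  have "degree (q * s) \<le> 2 * (d + e)" using degree_mult_le[of q s] q(1) s(1) by simp
  moreover have "of_real (U t * V t) = cis (- real (d + e) * t) * poly (q * s) (cis t)" for t
  proof -
    have "cis (- real (d + e) * t) = cis (- real d * t) * cis (- real e * t)"
      by (simp add: cis_mult algebra_simps)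
    then show ?thesis using q(2)[of t] s(2)[of t] by (simp add: mult_ac)
  qed
  ultimately show ?thesis unfolding trig_poly_def by blast
qed

lemma trig_poly_add: "trig_poly d U \<Longrightarrow> trig_poly d V \<Longrightarrow> trig_poly d (\<lambda>t. U t + V t)"
proof -
  assume "trig_poly d U" "trig_poly d V"
  then obtain q s where q: "degree q \<le> 2 * d" "\<And>t. of_real (U t) = cis (- real d * t) * poly q (cis t)"
    and s: "degree s \<le> 2 * d" "\<And>t. of_real (V t) = cis (- real d * t) * poly s (cis t)"
    by (auto simp: trig_poly_def)
  have "degree (q + s) \<le> 2 * d" using degree_add_le q(1) s(1) by blast
  moreover have "of_real (U t + V t) = cis (- real d * t) * poly (q + s) (cis t)" for t
    using q(2)[of t] s(2)[of t] by (simp add: distrib_left)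
  ultimately show ?thesis unfolding trig_poly_def by blast
qed

lemma trig_poly_const: "trig_poly d (\<lambda>_. c)"
proof -
  have "cis (- real d * t) * poly (monom (of_real c) d) (cis t) = of_real c" for t
    using cis_mult[of "- real d * t" "real d * t"] by (simp add: poly_monom Complex.DeMoivre mult_ac)
  moreover have "degree (monom (complex_of_real c) d) \<le> 2 * d" using degree_monom_le[of "complex_of_real c" d] by linarith
  ultimately show ?thesis unfolding trig_poly_def by (intro exI[of _ "monom (of_real c) d"]) simp
qed

lemma trig_poly_mono: "trig_poly d U \<Longrightarrow> d \<le> e \<Longrightarrow> trig_poly e U"
  using trig_poly_mult[of d U "e - d" "\<lambda>_. 1"] trig_poly_const[of "e - d" 1] by simp

lemma trig_poly_cmult: "trig_poly d U \<Longrightarrow> trig_poly d (\<lambda>t. c * U t)"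
  using trig_poly_mult[of 0 "\<lambda>_. c" d U] trig_poly_const[of 0 c] by simp

lemma trig_poly_cos: "k \<le> d \<Longrightarrow> trig_poly d (\<lambda>t. cos (real k * t + c))"
proof (rule trig_poly_mono)
  let ?q = "[:cis (- c) / 2:] + monom (cis c / 2) (2 * k)"
  have "of_real (cos (real k * t + c)) = cis (- real k * t) * poly ?q (cis t)" for t
  proof -
    have "cis (- real k * t) * poly ?q (cis t) = (cis (- (real k * t + c)) + cis (real k * t + c)) / 2"
      by (simp add: poly_monom Complex.DeMoivre distrib_left cis_mult add_divide_distrib algebra_simps)
    also have "cis (- y) + cis y = 2 * of_real (cos y)" for y by (simp add: complex_eq_iff)
    finally show ?thesis by simp
  qed
  moreover have "degree ?q \<le> 2 * k" by (intro degree_add_le) (auto simp: degree_monom_le)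
  ultimately show "trig_poly k (\<lambda>t. cos (real k * t + c))" unfolding trig_poly_def by blast
qed

lemma trig_poly_sum: "(\<And>i. i \<in> I \<Longrightarrow> trig_poly d (U i)) \<Longrightarrow> trig_poly d (\<lambda>v. \<Sum>i\<in>I. U i v)"
  by (induction I rule: infinite_finite_induct) (auto intro: trig_poly_add trig_poly_const)

lemma trig_poly_power: "trig_poly d U \<Longrightarrow> trig_poly (n * d) (\<lambda>v. U v ^ n)"
proof (induction n)
  case (Suc n)
  then show ?case using trig_poly_mult[of d U "n * d" "\<lambda>v. U v ^ n"] by simp
qed (simp add: trig_poly_const)

lemma trig_poly_sin: "trig_poly 1 sin"
proof -
  have "trig_poly 1 (\<lambda>t. cos (real 1 * t + - (pi/2)))" by (rule trig_poly_cos) simp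
  moreover have "(\<lambda>t. cos (real 1 * t + - (pi/2))) = sin" by (simp add: fun_eq_iff cos_diff)
  ultimately show ?thesis by simp
qed

lemma trig_poly_poly_cos: "trig_poly (degree R) (\<lambda>t. poly R (cos t))"
proof (induction R)
  case 0
  then show ?case by (simp add: trig_poly_const)
next
  case (pCons a R)
  show ?case
  proof (cases "R = 0")
    case True
    then show ?thesis by (simp add: trig_poly_const)
  next
    case False
    have "trig_poly (1 + degree R) (\<lambda>t. cos (real 1 * t + 0) * poly R (cos t))"
      by (intro trig_poly_mult trig_poly_cos pCons.IH) simp
    then show ?thesis using False by (auto intro!: trig_poly_add trig_poly_const)
  qed
qed

lemma trig_poly_fejer_affine: "trig_poly (m * l) (\<lambda>t. fejer l (real m * t + c))"
proof -
  have 1: "cos ((real j - real k) * (real m * t + c)) = 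
     cos (real ((if j \<le> k then k - j else j - k) * m) * t + real (if j \<le> k then k - j else j - k) * c)" for j k t
    using cos_minus[of "(real j - real k) * (real m * t + c)"] by (auto simp: of_nat_diff algebra_simps)
  have "trig_poly (m * l) (\<lambda>t. (1 / (real l)\<^sup>2) * (\<Sum>j<l. \<Sum>k<l. cos ((real j - real k) * (real m * t + c))))"
    unfolding 1 by (intro trig_poly_cmult trig_poly_sum trig_poly_cos) (auto simp: mult.commute[of m] intro!: mult_right_mono)
  then show ?thesis by (simp add: fejer_eq_sum_cos)
qed

lemma fejer_minus: "fejer l (- v) = fejer l v"
  unfolding fejer_eq_sum_cos using cos_minus by (metis (no_types, lifting) mult_minus_right sum.cong)

lemma trig_poly_fejer_pair: "trig_poly l (\<lambda>t. fejer_pair l (\<theta> - t))"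
proof -
  have "fejer_pair l (\<theta> - t) = fejer l (real 1 * t + (pi / (2 * real l) - \<theta>)) + fejer l (real 1 * t + (- (pi / (2 * real l)) - \<theta>))" for t
    unfolding fejer_pair_def using fejer_minus[of l "\<theta> - t - pi / (2 * real l)"] fejer_minus[of l "\<theta> - t + pi / (2 * real l)"]
    by (simp add: algebra_simps)
  then show ?thesis using trig_poly_fejer_affine[of 1 l] by (auto intro!: trig_poly_add)
qed

text \<open>A trigonometric polynomial of degree \<open>4la\<close> that is bounded below where \<open>\<bar>sin t\<bar> \<ge> 1/l\<close> and
  vanishes fast enough at multiples of \<open>pi\<close> to turn the weight \<open>\<bar>sin t\<bar> + 1/l\<close> into \<open>\<bar>sin t\<bar>\<close>.\<close>

definition damping :: "nat \<Rightarrow> nat \<Rightarrow> real \<Rightarrow> real" where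
  "damping l a t = (1 - fejer (2 * l) (2 * t)) ^ a"

lemma continuous_on_damping [continuous_intros]:
  "continuous_on S g \<Longrightarrow> continuous_on S (\<lambda>x. damping l a (g x))"
  unfolding damping_def by (intro continuous_intros)

lemma damping_nonneg [simp]: "0 \<le> damping l a t"
  by (simp add: damping_def)

lemma trig_poly_damping: "trig_poly (a * (4 * l)) (damping l a)"
proof -
  have "trig_poly (2 * (2 * l)) (\<lambda>t. 1 + (- 1) * fejer (2 * l) (real 2 * t + 0))"
    by (intro trig_poly_add trig_poly_const trig_poly_cmult trig_poly_fejer_affine)
  from trig_poly_power[OF this, of a] show ?thesis
    by (simp add: damping_def[abs_def])
qed

text \<open>The parameter \<open>2 * l\<close> in \<open>damping\<close> matters here: the closed
  formula bounds the kernel by \<open>1 / (2 l sin t)^2 \<le> 1/4\<close>, so that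
  \<open>3/4\<close> remains of the complement. With \<open>l\<close> alone the bound would be
  \<open>1\<close> and nothing would remain.\<close>

lemma damping_ge:
  assumes "l \<ge> 1" "\<bar>sin t\<bar> \<ge> 1 / real l" shows "(3/4) ^ a \<le> damping l a t"
proof -
  have l: "real l > 0" using assms by simp
  have "1 \<le> real l * \<bar>sin t\<bar>" using assms(2) l by (simp add: field_simps)
  then have "1\<^sup>2 \<le> (real l * \<bar>sin t\<bar>)\<^sup>2" by (intro power_mono) auto
  then have "4 \<le> (real (2 * l) * sin (2 * t / 2))\<^sup>2" by (simp add: power_mult_distrib)
  then have "fejer (2 * l) (2 * t) * 4 \<le> fejer (2 * l) (2 * t) * (real (2 * l) * sin (2 * t / 2))\<^sup>2"
    by (intro mult_left_mono) auto
  also have "\<dots> = (sin (real (2 * l) * (2 * t) / 2))\<^sup>2" by (rule fejer_mult_sin)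
  also have "\<dots> \<le> 1" by (simp add: abs_square_le_1)
  finally show ?thesis unfolding damping_def by (intro power_mono) auto
qed

text \<open>The base \<open>y\<close> is at most \<open>1\<close> and at most
  \<open>8 l |sin t|\<close>, and \<open>a p \<ge> 1\<close> gives \<open>y^(a p) \<le> y\<close>.
  The first bound serves the term \<open>|sin t|\<close>, the second the term \<open>1/l\<close>,
  whence \<open>9 = 1 + 8\<close>.\<close>

lemma damping_weight:
  assumes "l \<ge> 1" "real a * p \<ge> 1" "p > 0"
  shows "damping l a t powr p * (\<bar>sin t\<bar> + 1 / real l) \<le> 9 * \<bar>sin t\<bar>"
proof -
  define y where "y = 1 - fejer (2 * l) (2 * t)"
  have l: "real l > 0" using assms by simp
  have y: "0 \<le> y" "y \<le> 1" by (auto simp: y_def)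
  have "y \<le> 4 * real (2 * l) * \<bar>sin (2 * t / 2)\<bar>"
    unfolding y_def using assms(1) by (intro one_minus_fejer_le) auto
  then have y8: "y \<le> 8 * real l * \<bar>sin t\<bar>" by simp
  have a: "a > 0" using assms by (cases a) auto
  have D: "damping l a t powr p = y powr (real a * p)"
    using y a by (cases "y = 0") (auto simp: damping_def y_def[symmetric] powr_powr powr_realpow[symmetric])
  also have "\<dots> \<le> y powr 1" using y assms by (intro powr_mono') auto
  finally have 1: "damping l a t powr p \<le> y" using y by simp
  have "damping l a t powr p * (\<bar>sin t\<bar> + 1 / real l) \<le> y * (\<bar>sin t\<bar> + 1 / real l)"
    using 1 by (intro mult_right_mono) auto
  also have "\<dots> \<le> 1 * \<bar>sin t\<bar> + (8 * real l * \<bar>sin t\<bar>) * (1 / real l)"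
    unfolding distrib_left using y y8 by (intro add_mono mult_right_mono) auto
  finally show ?thesis using l by simp
qed

section \<open>Approximation of polynomials by polynomials of lower degree\<close>

lemma powr_add_le:
  fixes x y p :: real
  assumes "0 \<le> x" "0 \<le> y" "0 < p" "p \<le> 1"
  shows "(x + y) powr p \<le> x powr p + y powr p"
proof (cases "x + y = 0")
  case False
  then have xy: "x + y > 0" using assms by linarith
  have *: "z / (x + y) \<le> (z / (x + y)) powr p" if "0 \<le> z" "z \<le> x + y" for z
    using powr_mono'[of p 1 "z / (x + y)"] that assms xy by (auto simp: divide_le_eq_1)
  have "1 = x / (x + y) + y / (x + y)" using xy by (simp add: add_divide_distrib[symmetric])
  also have "\<dots> \<le> (x / (x + y)) powr p + (y / (x + y)) powr p" using assms by (intro add_mono *) auto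
  also have "\<dots> = (x powr p + y powr p) / (x + y) powr p"
    using assms xy by (simp add: powr_divide add_divide_distrib)
  finally show ?thesis using xy by (simp add: field_simps)
qed (use assms in auto)

lemma power_powr_eq:
  fixes x p :: real
  assumes "0 \<le> x" "0 < a" shows "(x ^ a) powr p = x powr (real a * p)"
proof (cases "x = 0")
  case False
  then have "x ^ a = x powr real a" using assms by (simp add: powr_realpow)
  then show ?thesis by (simp add: powr_powr)
qed (use assms in auto)

text \<open>The tangent of the concave p-th power at \<open>lam\<close>, obtained from Young's
  inequality.\<close>

lemma powr_le_tangent:
  fixes y p lam :: real
  assumes "0 \<le> y" "0 < lam" "0 < p" "p < 1"
  shows "y powr p \<le> p * lam powr (p - 1) * y + (1 - p) * lam powr p"
proof -
  have "y powr p * lam powr (1 - p) \<le> p * y + (1 - p) * lam"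
    using assms Youngs_inequality_0[of p "1 - p" y lam] by (cases "y = 0") auto
  then have "(y powr p * lam powr (1 - p)) * lam powr (p - 1) \<le> (p * y + (1 - p) * lam) * lam powr (p - 1)"
    by (intro mult_right_mono) auto
  moreover have "lam powr (1 - p) * lam powr (p - 1) = 1" using assms by (simp add: powr_add[symmetric])
  moreover have "lam * (p * lam powr (p - 1)) = p * lam powr p" using assms by (simp add: powr_mult_base mult.left_commute)
  moreover have "lam * lam powr (p - 1) = lam powr p" using assms by (simp add: powr_mult_base)
  ultimately show ?thesis by (simp add: algebra_simps)
qed

text \<open>The tangent at the mean \<open>Y / m\<close> is integrated, which avoids normalising the
  measure. The mean may be \<open>0\<close>, where there is no tangent; hence \<open>Y\<close> is
  enlarged by \<open>e > 0\<close>, which is removed in the limit.\<close>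

lemma integral_powr_Jensen:
  fixes y v :: "real \<Rightarrow> real"
  assumes p: "0 < p" "p < 1" and m: "0 < m"
    and int: "v integrable_on S" "(\<lambda>x. y x * v x) integrable_on S" "(\<lambda>x. y x powr p * v x) integrable_on S"
    and nonneg: "\<And>x. x \<in> S \<Longrightarrow> 0 \<le> y x" "\<And>x. x \<in> S \<Longrightarrow> 0 \<le> v x" and vm: "integral S v \<le> m"
  shows "integral S (\<lambda>x. y x powr p * v x) \<le> m powr (1 - p) * integral S (\<lambda>x. y x * v x) powr p"
proof -
  let ?X = "integral S (\<lambda>x. y x powr p * v x)"
  define Y where "Y = integral S (\<lambda>x. y x * v x)"
  have Y0: "Y \<ge> 0" unfolding Y_def using nonneg by (intro integral_nonneg int) auto
  have *: "?X \<le> m powr (1 - p) * (Y + e) powr p" if e: "e > 0" for e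
  proof -
    define lam where "lam = (Y + e) / m"
    have lam: "lam > 0" using Y0 e m by (simp add: lam_def)
    have "?X \<le> integral S (\<lambda>x. p * lam powr (p - 1) * (y x * v x) + (1 - p) * lam powr p * v x)"
    proof (rule integral_le)
      fix x assume x: "x \<in> S"
      have "y x powr p * v x \<le> (p * lam powr (p - 1) * y x + (1 - p) * lam powr p) * v x"
        using nonneg[OF x] lam p by (intro mult_right_mono powr_le_tangent) auto
      then show "y x powr p * v x \<le> p * lam powr (p - 1) * (y x * v x) + (1 - p) * lam powr p * v x"
        by (simp add: algebra_simps)
    qed (intro int integrable_add integrable_on_mult_right)+
    also have "\<dots> = p * lam powr (p - 1) * Y + (1 - p) * lam powr p * integral S v"
      unfolding Y_def using int by (simp add: Henstock_Kurzweil_Integration.integral_add integrable_on_mult_right)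
    also have "\<dots> \<le> p * lam powr (p - 1) * (lam * m) + (1 - p) * lam powr p * m"
      using p e m vm lam by (intro add_mono mult_left_mono) (auto simp: lam_def)
    also have "\<dots> = lam powr p * m"
    proof -
      have "p * lam powr (p - 1) * (lam * m) = p * m * (lam * lam powr (p - 1))" by (simp only: mult_ac)
      also have "\<dots> = p * m * lam powr p" using lam by (simp add: powr_mult_base)
      finally show ?thesis by (simp add: algebra_simps)
    qed
    also have "\<dots> = m powr (1 - p) * (Y + e) powr p"
      using m Y0 e by (simp add: lam_def powr_divide powr_diff field_simps)
    finally show ?thesis .
  qed
  have "((\<lambda>e. m powr (1 - p) * (Y + e) powr p) \<longlongrightarrow> m powr (1 - p) * (Y + 0) powr p) (at_right 0)"
    using p Y0 by (intro tendsto_mult tendsto_const tendsto_powr' tendsto_add tendsto_ident_at)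
      (auto intro: eventually_mono[OF eventually_at_right_less[of 0]])
  moreover have "\<forall>\<^sub>F e in at_right 0. ?X \<le> m powr (1 - p) * (Y + e) powr p"
    by (rule eventually_mono[OF eventually_at_right_less[of 0]]) (rule *)
  ultimately have "?X \<le> m powr (1 - p) * (Y + 0) powr p"
    by (rule tendsto_lowerbound) simp
  then show ?thesis by (simp add: Y_def)
qed

text \<open>Integration by parts, with \<open>1 - cos\<close> as the antiderivative of
  \<open>sin\<close> that vanishes at \<open>0\<close>.\<close>

lemma integral_tail_sin:
  fixes w :: "real \<Rightarrow> real"
  assumes "0 \<le> \<alpha>" and w: "continuous_on {0..\<alpha>} w"
  shows "integral {0..\<alpha>} (\<lambda>\<theta>. integral {\<theta>..\<alpha>} w * sin \<theta>) = integral {0..\<alpha>} (\<lambda>\<tau>. (1 - cos \<tau>) * w \<tau>)"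
    and "continuous_on {0..\<alpha>} (\<lambda>\<theta>. integral {\<theta>..\<alpha>} w)"
proof -
  have wi: "w integrable_on {a..b}" if "0 \<le> a" "b \<le> \<alpha>" for a b
    using w that by (intro integrable_continuous_real) (auto intro: continuous_on_subset)
  have eq: "integral {\<theta>..\<alpha>} w = integral {0..\<alpha>} w - integral {0..\<theta>} w" if "\<theta> \<in> {0..\<alpha>}" for \<theta>
    using Henstock_Kurzweil_Integration.integral_combine[of 0 \<theta> \<alpha> w] that wi[of 0 \<alpha>] by simp
  have cont: "continuous_on {0..\<alpha>} (\<lambda>\<theta>. integral {0..\<alpha>} w - integral {0..\<theta>} w)"
    by (intro continuous_intros indefinite_integral_continuous_1 wi) auto
  then show c: "continuous_on {0..\<alpha>} (\<lambda>\<theta>. integral {\<theta>..\<alpha>} w)"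
    by (rule continuous_on_eq) (rule eq[symmetric])
  define G where "G = (\<lambda>\<theta>. (1 - cos \<theta>) * (integral {0..\<alpha>} w - integral {0..\<theta>} w))"
  have "((\<lambda>\<theta>. sin \<theta> * (integral {0..\<alpha>} w - integral {0..\<theta>} w) - (1 - cos \<theta>) * w \<theta>) has_integral (G \<alpha> - G 0)) {0..\<alpha>}"
  proof (rule fundamental_theorem_of_calculus)
    fix x assume x: "x \<in> {0..\<alpha>}"
    have "((\<lambda>\<theta>. integral {0..\<theta>} w) has_real_derivative w x) (at x within {0..\<alpha>})"
      using integral_has_vector_derivative[OF w x] by (simp add: has_real_derivative_iff_has_vector_derivative)
    then have "(G has_real_derivative sin x * (integral {0..\<alpha>} w - integral {0..x} w) - (1 - cos x) * w x) (at x within {0..\<alpha>})"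
      unfolding G_def by (auto intro!: derivative_eq_intros)
    then show "(G has_vector_derivative sin x * (integral {0..\<alpha>} w - integral {0..x} w) - (1 - cos x) * w x) (at x within {0..\<alpha>})"
      by (simp add: has_real_derivative_iff_has_vector_derivative)
  qed (use assms in auto)
  moreover have "G \<alpha> - G 0 = 0" by (simp add: G_def)
  ultimately have "integral {0..\<alpha>} (\<lambda>\<theta>. sin \<theta> * (integral {0..\<alpha>} w - integral {0..\<theta>} w) - (1 - cos \<theta>) * w \<theta>) = 0"
    by (simp add: integral_unique)
  moreover have "integral {0..\<alpha>} (\<lambda>\<theta>. sin \<theta> * (integral {0..\<alpha>} w - integral {0..\<theta>} w) - (1 - cos \<theta>) * w \<theta>)
     = integral {0..\<alpha>} (\<lambda>\<theta>. sin \<theta> * (integral {0..\<alpha>} w - integral {0..\<theta>} w)) - integral {0..\<alpha>} (\<lambda>\<theta>. (1 - cos \<theta>) * w \<theta>)"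
    by (intro Henstock_Kurzweil_Integration.integral_diff integrable_continuous_real continuous_intros w indefinite_integral_continuous_1 wi) auto
  moreover have "integral {0..\<alpha>} (\<lambda>\<theta>. integral {\<theta>..\<alpha>} w * sin \<theta>) = integral {0..\<alpha>} (\<lambda>\<theta>. sin \<theta> * (integral {0..\<alpha>} w - integral {0..\<theta>} w))"
    by (rule integral_cong) (subst eq, auto)
  ultimately show "integral {0..\<alpha>} (\<lambda>\<theta>. integral {\<theta>..\<alpha>} w * sin \<theta>) = integral {0..\<alpha>} (\<lambda>\<tau>. (1 - cos \<tau>) * w \<tau>)"
    by simp
qed

text \<open>Jensen's inequality for the measure \<open>sin \<theta> d\<theta>\<close>, whose mass on
  the arc is \<open>1 - cos \<alpha>\<close>. A short arc thus gains the factor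
  \<open>m^(1-p)\<close>.\<close>

lemma integral_tail_powr_sin_le:
  fixes w :: "real \<Rightarrow> real"
  assumes p: "0 < p" "p < 1" and \<alpha>: "0 < \<alpha>" "\<alpha> \<le> pi" and w: "continuous_on {0..\<alpha>} w" "\<And>\<tau>. \<tau> \<in> {0..\<alpha>} \<Longrightarrow> 0 \<le> w \<tau>"
    and m: "1 - cos \<alpha> \<le> m" "0 < m"
  shows "integral {0..\<alpha>} (\<lambda>\<theta>. integral {\<theta>..\<alpha>} w powr p * sin \<theta>)
     \<le> m powr (1 - p) * integral {0..\<alpha>} (\<lambda>\<tau>. (1 - cos \<tau>) * w \<tau>) powr p"
proof -
  have c: "continuous_on {0..\<alpha>} (\<lambda>\<theta>. integral {\<theta>..\<alpha>} w)" by (rule integral_tail_sin(2)) (use \<alpha> w in auto)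
  have nn: "integral {\<theta>..\<alpha>} w \<ge> 0" if "\<theta> \<in> {0..\<alpha>}" for \<theta>
    using w that by (intro integral_nonneg integrable_continuous_real) (auto intro: continuous_on_subset)
  have "(sin has_integral (- cos \<alpha> - (- cos 0))) {0..\<alpha>}"
    by (rule fundamental_theorem_of_calculus)
       (use \<alpha> in \<open>auto intro!: derivative_eq_intros simp: has_real_derivative_iff_has_vector_derivative[symmetric]\<close>)
  then have sm: "integral {0..\<alpha>} sin \<le> m" using m by (simp add: integral_unique)
  have "integral {0..\<alpha>} (\<lambda>\<theta>. integral {\<theta>..\<alpha>} w powr p * sin \<theta>)
     \<le> m powr (1 - p) * integral {0..\<alpha>} (\<lambda>\<theta>. integral {\<theta>..\<alpha>} w * sin \<theta>) powr p"
    using c nn p \<alpha>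
    by (intro integral_powr_Jensen p m sm integrable_continuous_real continuous_intros continuous_on_powr') (auto intro: sin_ge_zero)
  then show ?thesis using integral_tail_sin(1)[of \<alpha> w] \<alpha> w by simp
qed

section \<open>Taylor's formula and polynomials given by integrals\<close>

lemma poly_taylor_DERIV:
  fixes F :: "real poly"
  shows "((\<lambda>y. \<Sum>i\<le>k. (x - y) ^ i / fact i * poly ((pderiv ^^ i) F) y) has_real_derivative
      (x - y) ^ k / fact k * poly ((pderiv ^^ Suc k) F) y) (at y)"
proof (induction k)
  case 0
  show ?case by (auto intro: poly_DERIV)
next
  case (Suc k)
  have "((\<lambda>y. (x - y) ^ Suc k / fact (Suc k) * poly ((pderiv ^^ Suc k) F) y) has_real_derivative
      (- ((x - y) ^ k / fact k)) * poly ((pderiv ^^ Suc k) F) y + (x - y) ^ Suc k / fact (Suc k) * poly ((pderiv ^^ Suc (Suc k)) F) y) (at y)"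
  proof -
    have "((\<lambda>y. (x - y) ^ Suc k / fact (Suc k)) has_real_derivative - ((x - y) ^ k / fact k)) (at y)"
    proof -
      have "((\<lambda>y. x - y) has_real_derivative - 1) (at y)" by (auto intro!: derivative_eq_intros)
      from DERIV_cdivide[OF DERIV_chain2[OF DERIV_pow[of "Suc k" "x - y" UNIV] this], of "fact (Suc k)"]
      show ?thesis by (simp add: field_simps del: of_nat_Suc)
    qed
    from DERIV_mult[OF this poly_DERIV[of "(pderiv ^^ Suc k) F" y]]
    show ?thesis by (simp add: algebra_simps)
  qed
  from DERIV_add[OF Suc.IH this] show ?case by simp
qed

text \<open>Taylor's formula at \<open>-1 = cos pi\<close>. Since \<open>cos\<close> decreases on
  \<open>[0, pi]\<close>, the remainder runs over \<tau> from \<theta> to \<open>pi\<close>; read as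
  an integral over all of \<open>[0, pi]\<close> it contains the indicator of
  \<open>\<theta> < \<tau>\<close>, the only factor that is not polynomial in
  \<open>cos \<theta>\<close>.\<close>

lemma poly_taylor_trig:
  fixes F :: "real poly"
  assumes r: "r \<ge> 1"
  obtains T where "degree T \<le> r - 1"
    "\<And>\<theta>. \<theta> \<in> {0..pi} \<Longrightarrow> poly F (cos \<theta>) = poly T (cos \<theta>) +
      integral {\<theta>..pi} (\<lambda>\<tau>. (cos \<theta> - cos \<tau>) ^ (r - 1) / fact (r - 1) * poly ((pderiv ^^ r) F) (cos \<tau>) * sin \<tau>)"
proof -
  define T where "T = (\<Sum>i\<le>r - 1. smult (poly ((pderiv ^^ i) F) (- 1) / fact i) ([:1, 1:] ^ i))"
  have "degree T \<le> r - 1" unfolding T_def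
  proof (rule degree_sum_le)
    fix i assume "i \<in> {..r - 1}"
    have "degree ([:1, 1::real:] ^ i) \<le> i" using degree_power_le[of "[:1, 1::real:]" i] by simp
    then show "degree (smult (poly ((pderiv ^^ i) F) (- 1) / fact i) ([:1, 1:] ^ i)) \<le> r - 1"
      using \<open>i \<in> {..r - 1}\<close> by (intro order_trans[OF degree_smult_le]) auto
  qed auto
  moreover have "poly F (cos \<theta>) = poly T (cos \<theta>) +
      integral {\<theta>..pi} (\<lambda>\<tau>. (cos \<theta> - cos \<tau>) ^ (r - 1) / fact (r - 1) * poly ((pderiv ^^ r) F) (cos \<tau>) * sin \<tau>)"
    if \<theta>: "\<theta> \<in> {0..pi}" for \<theta>
  proof -
    define h where "h = (\<lambda>y. \<Sum>i\<le>r - 1. (cos \<theta> - y) ^ i / fact i * poly ((pderiv ^^ i) F) y)"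
    have hi: "((\<lambda>\<tau>. (cos \<theta> - cos \<tau>) ^ (r - 1) / fact (r - 1) * poly ((pderiv ^^ r) F) (cos \<tau>) * sin \<tau>)
       has_integral (- h (cos pi) - (- h (cos \<theta>)))) {\<theta>..pi}"
    proof (rule fundamental_theorem_of_calculus)
      fix \<tau> :: real
      have "(h has_real_derivative (cos \<theta> - cos \<tau>) ^ (r - 1) / fact (r - 1) * poly ((pderiv ^^ r) F) (cos \<tau>)) (at (cos \<tau>))"
        using poly_taylor_DERIV[where k = "r - 1" and x = "cos \<theta>" and y = "cos \<tau>" and F = F] r by (simp add: h_def)
      from DERIV_minus[OF DERIV_chain2[OF this DERIV_cos[of \<tau>]]]
      have "((\<lambda>\<tau>. - h (cos \<tau>)) has_real_derivative
         (cos \<theta> - cos \<tau>) ^ (r - 1) / fact (r - 1) * poly ((pderiv ^^ r) F) (cos \<tau>) * sin \<tau>) (at \<tau>)"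
        by simp
      then show "((\<lambda>\<tau>. - h (cos \<tau>)) has_vector_derivative
         (cos \<theta> - cos \<tau>) ^ (r - 1) / fact (r - 1) * poly ((pderiv ^^ r) F) (cos \<tau>) * sin \<tau>) (at \<tau> within {\<theta>..pi})"
        unfolding has_real_derivative_iff_has_vector_derivative[symmetric]
        by (rule has_field_derivative_at_within)
    qed (use \<theta> in auto)
    moreover have "h (cos \<theta>) = poly F (cos \<theta>)"
    proof -
      have "h (cos \<theta>) = (\<Sum>i\<le>r - 1. if i = 0 then poly F (cos \<theta>) else 0)"
        unfolding h_def by (rule sum.cong) auto
      then show ?thesis by simp
    qed
    moreover have "h (cos pi) = poly T (cos \<theta>)"
      by (simp add: h_def T_def poly_sum poly_power add.commute mult.commute)
    ultimately show ?thesis unfolding integral_unique[OF hi] by simp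
  qed
  ultimately show ?thesis by (rule that)
qed

text \<open>Chebyshev polynomials, by their three-term recursion.\<close>

lemma cos_multiple_poly:
  obtains T :: "real poly" where "degree T \<le> k" "\<And>\<theta>. poly T (cos \<theta>) = cos (real k * \<theta>)"
proof -
  have "\<exists>T :: real poly. degree T \<le> k \<and> (\<forall>\<theta>. poly T (cos \<theta>) = cos (real k * \<theta>))"
  proof (induction k rule: less_induct)
    case (less k)
    consider "k = 0" | "k = 1" | j where "k = Suc (Suc j)" by (metis One_nat_def not0_implies_Suc)
    then show ?case
    proof cases
      case 1 then show ?thesis by (intro exI[of _ 1]) auto
    next
      case 2 then show ?thesis by (intro exI[of _ "[:0,1:]"]) auto
    next
      case 3
      obtain A B :: "real poly" where A: "degree A \<le> Suc j" "\<And>\<theta>. poly A (cos \<theta>) = cos (real (Suc j) * \<theta>)"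
        and B: "degree B \<le> j" "\<And>\<theta>. poly B (cos \<theta>) = cos (real j * \<theta>)"
        using less.IH[of "Suc j"] less.IH[of j] 3 by auto
      have "cos (real k * \<theta>) = 2 * cos \<theta> * cos (real (Suc j) * \<theta>) - cos (real j * \<theta>)" for \<theta>
        using cos_add[of "real (Suc j) * \<theta>" \<theta>] cos_diff[of "real (Suc j) * \<theta>" \<theta>] 3
        by (simp add: algebra_simps)
      moreover have "degree ([:0, 2:] * A - B) \<le> k"
        using A B 3 degree_mult_le[of "[:0, 2:]" A] by (intro degree_diff_le) auto
      ultimately show ?thesis using A B by (intro exI[of _ "[:0, 2:] * A - B"]) (simp add: mult.assoc)
    qed
  qed
  then show ?thesis using that by blast
qed

lemma poly_integral_parameter:
  fixes b :: "'i \<Rightarrow> real \<Rightarrow> real" and T :: "'i \<Rightarrow> real poly"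
  assumes I: "finite I" and b: "\<And>k. k \<in> I \<Longrightarrow> continuous_on {u..v} (b k)" and T: "\<And>k. k \<in> I \<Longrightarrow> degree (T k) \<le> e"
  shows "\<exists>P. degree P \<le> e \<and> (\<forall>x. poly P x = integral {u..v} (\<lambda>\<tau>. \<Sum>k\<in>I. b k \<tau> * poly (T k) x))"
proof (intro exI[of _ "\<Sum>k\<in>I. smult (integral {u..v} (b k)) (T k)"] conjI allI)
  show "degree (\<Sum>k\<in>I. smult (integral {u..v} (b k)) (T k)) \<le> e"
    using T I by (intro degree_sum_le) (auto intro: order_trans[OF degree_smult_le])
  fix x
  have "integral {u..v} (\<lambda>\<tau>. \<Sum>k\<in>I. b k \<tau> * poly (T k) x) = (\<Sum>k\<in>I. integral {u..v} (\<lambda>\<tau>. b k \<tau> * poly (T k) x))"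
    using b I by (intro integral_sum integrable_continuous_real continuous_intros) auto
  then show "poly (\<Sum>k\<in>I. smult (integral {u..v} (b k)) (T k)) x = integral {u..v} (\<lambda>\<tau>. \<Sum>k\<in>I. b k \<tau> * poly (T k) x)"
    by (simp add: poly_sum)
qed

text \<open>The binomial theorem separates \<theta> from \<tau>, so that integration over \<tau>
  leaves a linear combination of polynomials in \<open>cos \<theta>\<close>.\<close>

lemma poly_power_kernel_integral:
  fixes b :: "nat \<Rightarrow> real \<Rightarrow> real"
  assumes b: "\<And>k. k \<le> d \<Longrightarrow> continuous_on {u..v} (b k)" and g: "continuous_on {u..v} g"
  shows "\<exists>P. degree P \<le> m + d \<and> (\<forall>\<theta>. poly P (cos \<theta>) =
    integral {u..v} (\<lambda>\<tau>. (cos \<theta> - cos \<tau>) ^ m / fact m * g \<tau> * (\<Sum>k\<le>d. b k \<tau> * cos (real k * \<theta>))))"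
proof -
  have "\<forall>k. \<exists>T :: real poly. degree T \<le> k \<and> (\<forall>\<theta>. poly T (cos \<theta>) = cos (real k * \<theta>))"
    by (metis cos_multiple_poly)
  then obtain T :: "nat \<Rightarrow> real poly" where T: "\<And>k. degree (T k) \<le> k" "\<And>k \<theta>. poly (T k) (cos \<theta>) = cos (real k * \<theta>)"
    by metis
  define c where "c = (\<lambda>(j, k) \<tau>. of_nat (m choose j) * (- cos \<tau>) ^ (m - j) / fact m * g \<tau> * b k \<tau>)"
  define Q where "Q = (\<lambda>(j, k). monom 1 j * T k)"
  have Q: "degree (Q jk) \<le> m + d" if "jk \<in> {..m} \<times> {..d}" for jk
  proof (cases jk)
    case (Pair j k)
    then have "j \<le> m" "k \<le> d" using that by auto
    have "degree (monom 1 j * T k) \<le> j + k"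
      using degree_mult_le[of "monom 1 j" "T k"] degree_monom_le[of "1::real" j] T(1)[of k] by linarith
    then show ?thesis using Pair \<open>j \<le> m\<close> \<open>k \<le> d\<close> by (simp add: Q_def)
  qed
  obtain P where P: "degree P \<le> m + d" 
    "\<And>x. poly P x = integral {u..v} (\<lambda>\<tau>. \<Sum>k\<in>{..m} \<times> {..d}. c k \<tau> * poly (Q k) x)"
  proof -
    have "continuous_on {u..v} (c jk)" if "jk \<in> {..m} \<times> {..d}" for jk
      using that b g by (cases jk) (auto simp: c_def intro!: continuous_intros)
    then have "\<exists>P. degree P \<le> m + d \<and> (\<forall>x. poly P x = integral {u..v} (\<lambda>\<tau>. \<Sum>k\<in>{..m} \<times> {..d}. c k \<tau> * poly (Q k) x))"
      using Q by (intro poly_integral_parameter) auto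
    then show ?thesis using that by blast
  qed
  have "(\<Sum>k\<in>{..m} \<times> {..d}. c k \<tau> * poly (Q k) (cos \<theta>)) =
     (cos \<theta> - cos \<tau>) ^ m / fact m * g \<tau> * (\<Sum>k\<le>d. b k \<tau> * cos (real k * \<theta>))" for \<theta> \<tau>
  proof -
    have "(cos \<theta> - cos \<tau>) ^ m = (\<Sum>j\<le>m. of_nat (m choose j) * cos \<theta> ^ j * (- cos \<tau>) ^ (m - j))"
      using binomial_ring[of "cos \<theta>" "- cos \<tau>" m] by simp
    then have "(cos \<theta> - cos \<tau>) ^ m / fact m * g \<tau> * (\<Sum>k\<le>d. b k \<tau> * cos (real k * \<theta>))
       = (\<Sum>j\<le>m. \<Sum>k\<le>d. (of_nat (m choose j) * cos \<theta> ^ j * (- cos \<tau>) ^ (m - j) / fact m * g \<tau>) * (b k \<tau> * cos (real k * \<theta>)))"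
      by (simp add: sum_divide_distrib sum_distrib_right sum_distrib_left mult_ac)
    then show ?thesis unfolding sum.cartesian_product
      by (simp add: c_def Q_def poly_monom T(2) case_prod_unfold mult_ac)
  qed
  then show ?thesis using P by (intro exI[of _ P]) auto
qed

section \<open>Weighted polynomials in the variable \<open>t\<close>, where
  \<open>x = cos t\<close>\<close>

lemma integral_reflect_about:
  fixes g :: "real \<Rightarrow> real"
  shows "integral {c - b..c - a} (\<lambda>x. g (c - x)) = integral {a..b} g"
proof -
  have "integral {- (b - c)..- (a - c)} (\<lambda>x. (g \<circ> (+) c) (- x)) = integral {a - c..b - c} (g \<circ> (+) c)"
    by (rule Henstock_Kurzweil_Integration.integral_reflect_real)
  also have "\<dots> = integral {a..b} g" using integral_shift_Icc_real[of "a - c" "b - c" g c] by simp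
  finally show ?thesis by (simp add: o_def)
qed

text \<open>The image of \<open>phi^r R\<close> under \<open>x = cos t\<close>. Written with
  \<open>sin t\<close>, which equals \<open>phi (cos t)\<close> on \<open>[0, pi]\<close>, it is a
  trigonometric polynomial on the whole circle.\<close>

definition trig_weighted :: "nat \<Rightarrow> real poly \<Rightarrow> real \<Rightarrow> real" where
  "trig_weighted r R t = sin t ^ r * poly R (cos t)"

text \<open>The factor \<open>sin t\<close> is the Jacobian of \<open>x = cos t\<close>, so this is
  the p-th power of a weighted quasi-norm on \<open>[-1, 1]\<close>.\<close>

definition trig_mass :: "real \<Rightarrow> nat \<Rightarrow> real poly \<Rightarrow> real" where
  "trig_mass p r R = integral {0..pi} (\<lambda>t. \<bar>trig_weighted r R t\<bar> powr p * sin t)"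

lemma continuous_on_trig_weighted [continuous_intros]:
  fixes g :: "'a::t2_space \<Rightarrow> real"
  shows "continuous_on S g \<Longrightarrow> continuous_on S (\<lambda>x. trig_weighted r R (g x))"
  unfolding trig_weighted_def by (auto intro!: continuous_intros)

lemma trig_poly_trig_weighted: "degree R + r \<le> N \<Longrightarrow> trig_poly N (trig_weighted r R)"
proof (rule trig_poly_mono)
  have "trig_poly (r * 1 + degree R) (\<lambda>t. sin t ^ r * poly R (cos t))"
    by (intro trig_poly_mult trig_poly_power trig_poly_sin trig_poly_poly_cos)
  then show "trig_poly (r * 1 + degree R) (trig_weighted r R)" by (simp add: trig_weighted_def[abs_def])
qed simp

lemma trig_weighted_minus: "\<bar>trig_weighted r R (- t)\<bar> = \<bar>trig_weighted r R t\<bar>"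
  by (simp add: trig_weighted_def abs_mult power_abs)

lemma continuous_on_abs_powr:
  fixes g :: "real \<Rightarrow> real"
  assumes "continuous_on S g" "0 < p" shows "continuous_on S (\<lambda>x. \<bar>g x\<bar> powr p)"
  using assms by (intro continuous_on_powr' continuous_intros) auto

lemma trig_mass_nonneg: "0 < p \<Longrightarrow> 0 \<le> trig_mass p r R"
  unfolding trig_mass_def
  by (intro integral_nonneg integrable_continuous_real continuous_on_mult continuous_on_abs_powr continuous_intros)
    (auto intro!: sin_ge_zero mult_nonneg_nonneg)

lemma trig_weighted_Nikolskii:
  assumes p: "0 < p" "p < 1" and N: "degree R + r \<le> N" "N \<ge> 1"
  shows "integral {0..pi} (\<lambda>t. \<bar>trig_weighted r R t\<bar> * sin t) powr p \<le> (4608 * (real N)\<^sup>2) powr (1 - p) * trig_mass p r R"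
proof -
  obtain q where q: "degree q \<le> 2 * N" "\<And>t. norm (poly q (cis t)) = \<bar>trig_weighted r R t\<bar>"
    using trig_polyE[OF trig_poly_trig_weighted[OF N(1)]] by blast
  \<comment> \<open>The polynomial \<open>q\<close> on the circle has degree up to
    \<open>2 N\<close>, which quadruples the constant.\<close>
  have "1152 * (real (2 * N))\<^sup>2 = 4608 * (real N)\<^sup>2" by (simp add: power_mult_distrib)
  then show ?thesis
    using Nikolskii_circle_sin_weight[OF p q(1)] N(2) by (simp add: q(2) trig_weighted_minus trig_mass_def)
qed

text \<open>The part of the Taylor remainder on an end arc, where nothing is smoothed. Jensen's
  inequality on an arc of mass at most \<open>1/l^2\<close> gains \<open>l^(-2(1-p))\<close>,
  Nikolskii's inequality loses \<open>N^(2(1-p))\<close>; together they form the factor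
  \<open>(N/l)^(2-2p)\<close> of the final estimate.\<close>

lemma end_integral_le:
  assumes p: "0 < p" "p < 1" and l: "l \<ge> 1" and r: "r \<ge> 1" and \<alpha>: "0 < \<alpha>" "\<alpha> \<le> pi / 2" "sin \<alpha> = 1 / real l"
    and N: "degree R + r \<le> N" "N \<ge> 1"
  shows "integral {0..\<alpha>} (\<lambda>\<theta>. integral {\<theta>..\<alpha>} (\<lambda>\<tau>. (1 - cos \<tau>) ^ (r - 1) * \<bar>poly R (cos \<tau>)\<bar> * sin \<tau>) powr p * sin \<theta>)
    \<le> 4608 powr (1 - p) * (real N / real l) powr (2 - 2 * p) * (1 / real l) powr (real r * p) * trig_mass p r R"
proof -
  have l0: "real l > 0" using l by simp
  let ?w = "\<lambda>\<tau>. (1 - cos \<tau>) ^ (r - 1) * \<bar>poly R (cos \<tau>)\<bar> * sin \<tau>"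
  let ?X1 = "integral {0..pi} (\<lambda>t. \<bar>trig_weighted r R t\<bar> * sin t)"
  have one_minus_cos: "0 \<le> 1 - cos \<tau>" "1 - cos \<tau> \<le> (sin \<tau>)\<^sup>2" if "0 \<le> \<tau>" "\<tau> \<le> pi / 2" for \<tau> :: real
  proof -
    show 0: "0 \<le> 1 - cos \<tau>" by simp
    have "cos \<tau> \<ge> 0" using that by (intro cos_ge_zero) auto
    then have "(1 - cos \<tau>) * 1 \<le> (1 - cos \<tau>) * (1 + cos \<tau>)" using 0 by (intro mult_left_mono) auto
    also have "\<dots> = (sin \<tau>)\<^sup>2" using sin_cos_squared_add[of \<tau>] by (simp add: power2_eq_square algebra_simps)
    finally show "1 - cos \<tau> \<le> (sin \<tau>)\<^sup>2" by simp
  qed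
  have X1: "?X1 \<ge> 0"
    by (intro integral_nonneg integrable_continuous_real continuous_intros) (auto intro!: sin_ge_zero mult_nonneg_nonneg)
  have wc: "continuous_on S ?w" for S by (intro continuous_intros)
  have "integral {0..\<alpha>} (\<lambda>\<theta>. integral {\<theta>..\<alpha>} ?w powr p * sin \<theta>)
      \<le> ((1 / real l)\<^sup>2) powr (1 - p) * integral {0..\<alpha>} (\<lambda>\<tau>. (1 - cos \<tau>) * ?w \<tau>) powr p"
  proof (rule integral_tail_powr_sin_le[OF p])
    show "1 - cos \<alpha> \<le> (1 / real l)\<^sup>2" using one_minus_cos(2)[of \<alpha>] \<alpha> by simp
    show "0 \<le> ?w \<tau>" if "\<tau> \<in> {0..\<alpha>}" for \<tau> using that \<alpha> by (auto intro!: mult_nonneg_nonneg sin_ge_zero)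
  qed (use \<alpha> l0 wc in auto)
  \<comment> \<open>On the arc
    \<open>1 - cos \<tau> \<le> sin^2 \<tau> \<le> sin \<tau> / l\<close>, so each factor
    \<open>1 - cos \<tau>\<close> yields one \<open>sin\<close> for the weight and one
    \<open>1/l\<close>. The factor from integration by parts completes the exponent
    \<open>r - 1\<close> to \<open>r\<close>.\<close>
  also have "integral {0..\<alpha>} (\<lambda>\<tau>. (1 - cos \<tau>) * ?w \<tau>) \<le> (1 / real l) ^ r * ?X1"
  proof -
    have "integral {0..\<alpha>} (\<lambda>\<tau>. (1 - cos \<tau>) * ?w \<tau>) \<le> integral {0..\<alpha>} (\<lambda>\<tau>. (1 / real l) ^ r * (\<bar>trig_weighted r R \<tau>\<bar> * sin \<tau>))"
    proof (rule integral_le)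
      fix \<tau> assume \<tau>: "\<tau> \<in> {0..\<alpha>}"
      have s: "0 \<le> sin \<tau>" using \<tau> \<alpha> by (intro sin_ge_zero) auto
      have sl: "sin \<tau> \<le> 1 / real l" using \<tau> \<alpha> sin_monotone_2pi_le[of \<tau> \<alpha>] by auto
      have "(1 - cos \<tau>) \<le> 1 / real l * sin \<tau>"
        using one_minus_cos(2)[of \<tau>] mult_right_mono[OF sl s] \<tau> \<alpha> by (simp add: power2_eq_square)
      then have "(1 - cos \<tau>) ^ r \<le> (1 / real l * sin \<tau>) ^ r" using one_minus_cos(1)[of \<tau>] \<tau> \<alpha> by (intro power_mono) auto
      then have "(1 - cos \<tau>) ^ r * (\<bar>poly R (cos \<tau>)\<bar> * sin \<tau>) \<le> (1 / real l * sin \<tau>) ^ r * (\<bar>poly R (cos \<tau>)\<bar> * sin \<tau>)"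
        using s by (intro mult_right_mono) auto
      moreover have "(1 - cos \<tau>) ^ r = (1 - cos \<tau>) * (1 - cos \<tau>) ^ (r - 1)" using r by (cases r) auto
      ultimately show "(1 - cos \<tau>) * ?w \<tau> \<le> (1 / real l) ^ r * (\<bar>trig_weighted r R \<tau>\<bar> * sin \<tau>)"
        using s by (simp add: trig_weighted_def abs_mult power_abs power_mult_distrib power_divide mult_ac)
    qed (auto intro!: integrable_continuous_real continuous_intros)
    also have "\<dots> = (1 / real l) ^ r * integral {0..\<alpha>} (\<lambda>\<tau>. \<bar>trig_weighted r R \<tau>\<bar> * sin \<tau>)" by simp
    also have "\<dots> \<le> (1 / real l) ^ r * ?X1"
      using \<alpha> pi_gt_zero by (intro mult_left_mono integral_subset_le integrable_continuous_real continuous_intros) 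
        (auto intro!: sin_ge_zero mult_nonneg_nonneg)
    finally show ?thesis .
  qed
  then have "((1 / real l)\<^sup>2) powr (1 - p) * integral {0..\<alpha>} (\<lambda>\<tau>. (1 - cos \<tau>) * ?w \<tau>) powr p
     \<le> ((1 / real l)\<^sup>2) powr (1 - p) * ((1 / real l) ^ r * ?X1) powr p"
    using p \<alpha> by (intro mult_left_mono powr_mono2 integral_nonneg integrable_continuous_real continuous_intros)
      (auto intro!: mult_nonneg_nonneg sin_ge_zero)
  also have "\<dots> = ((1 / real l)\<^sup>2) powr (1 - p) * ((1 / real l) powr (real r * p) * ?X1 powr p)"
  proof -
    have "((1 / real l) ^ r) powr p = (1 / real l) powr (real r * p)"
      using l0 by (simp add: powr_realpow[symmetric] powr_powr)
    then show ?thesis by (simp only: powr_mult)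
  qed
  also have "\<dots> \<le> ((1 / real l)\<^sup>2) powr (1 - p) * ((1 / real l) powr (real r * p) * ((4608 * (real N)\<^sup>2) powr (1 - p) * trig_mass p r R))"
    by (intro mult_left_mono trig_weighted_Nikolskii[OF p N]) auto
  also have "\<dots> = 4608 powr (1 - p) * (real N / real l) powr (2 - 2 * p) * (1 / real l) powr (real r * p) * trig_mass p r R"
  proof -
    have "((1 / real l)\<^sup>2) powr (1 - p) * (4608 * (real N)\<^sup>2) powr (1 - p) = (4608 * (real N / real l)\<^sup>2) powr (1 - p)"
      by (simp add: powr_mult[symmetric] power_divide)
    also have "\<dots> = 4608 powr (1 - p) * ((real N / real l)\<^sup>2) powr (1 - p)" by (simp add: powr_mult)
    also have "((real N / real l)\<^sup>2) powr (1 - p) = (real N / real l) powr (2 - 2 * p)"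
    proof -
      have "0 < real N / real l" using N l0 by simp
      then have "((real N / real l)\<^sup>2) powr (1 - p) = ((real N / real l) powr 2) powr (1 - p)" by simp
      also have "\<dots> = (real N / real l) powr (2 * (1 - p))" by (rule powr_powr)
      finally show ?thesis by (simp add: right_diff_distrib)
    qed
    finally show ?thesis by (simp add: mult_ac)
  qed
  finally show ?thesis .
qed

text \<open>Expansion about \<tau>. The quadratic term carries no factor \<open>sin \<tau>\<close>;
  the hypothesis \<open>1/l \<le> sin \<tau>\<close> supplies it, which is why the end arcs are
  treated apart.\<close>

lemma abs_cos_diff_le:
  assumes "l \<ge> 1" "1 / real l \<le> sin \<tau>"
  shows "\<bar>cos \<theta> - cos \<tau>\<bar> \<le> sin \<tau> / real l * (1 + real l * \<bar>\<theta> - \<tau>\<bar>)\<^sup>2"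
proof -
  define \<delta> where "\<delta> = \<theta> - \<tau>"
  have l0: "real l > 0" using assms by simp
  have s0: "sin \<tau> > 0" using assms l0 by (smt (verit) divide_pos_pos)
  have "cos \<theta> - cos \<tau> = cos \<tau> * (cos \<delta> - 1) - sin \<tau> * sin \<delta>"
    using cos_add[of \<tau> \<delta>] by (simp add: \<delta>_def algebra_simps)
  then have "\<bar>cos \<theta> - cos \<tau>\<bar> \<le> \<bar>cos \<tau> * (cos \<delta> - 1)\<bar> + \<bar>sin \<tau> * sin \<delta>\<bar>" by (simp only: abs_triangle_ineq4)
  also have "\<bar>cos \<tau> * (cos \<delta> - 1)\<bar> \<le> 1 * \<delta>\<^sup>2"
    unfolding abs_mult
  proof (rule mult_mono)
    have "1 - cos \<delta> = 2 * (sin (\<delta> / 2))\<^sup>2" using cos_double_sin[of "\<delta> / 2"] by simp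
    also have "\<dots> \<le> 2 * \<bar>\<delta> / 2\<bar>\<^sup>2"
      using power_mono[OF abs_sin_x_le_abs_x[of "\<delta>/2"], of 2] by simp
    also have "\<dots> \<le> \<delta>\<^sup>2" by (simp add: power2_eq_square)
    finally show "\<bar>cos \<delta> - 1\<bar> \<le> \<delta>\<^sup>2" using cos_le_one[of \<delta>] by simp
  qed auto
  also have "\<bar>sin \<tau> * sin \<delta>\<bar> \<le> sin \<tau> * \<bar>\<delta>\<bar>"
    unfolding abs_mult using s0 abs_sin_x_le_abs_x[of \<delta>] by (simp add: mult_left_mono)
  also have "1 * \<delta>\<^sup>2 + sin \<tau> * \<bar>\<delta>\<bar> \<le> sin \<tau> / real l * (1 + real l * \<bar>\<delta>\<bar>)\<^sup>2"
  proof -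
    have "1 \<le> real l * sin \<tau>" using assms l0 by (simp add: field_simps)
    then have "1 * \<delta>\<^sup>2 \<le> (real l * sin \<tau>) * \<delta>\<^sup>2" by (intro mult_right_mono) auto
    moreover have "sin \<tau> / real l * (1 + real l * \<bar>\<delta>\<bar>)\<^sup>2 = sin \<tau> / real l + 2 * (sin \<tau> * \<bar>\<delta>\<bar>) + (real l * sin \<tau>) * \<delta>\<^sup>2"
      using l0 by (simp add: power2_eq_square field_simps)
    moreover have "0 \<le> sin \<tau> / real l" "0 \<le> sin \<tau> * \<bar>\<delta>\<bar>" using s0 l0 by auto
    ultimately show ?thesis by linarith
  qed
  finally show ?thesis by (simp add: \<delta>_def)
qed

text \<open>The intervals of integration in \<tau> are closed and meet at \<theta>, so at
  \<open>\<theta> = \<tau>\<close> both values of the indicator occur. The price is \<open>9\<close>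
  in place of \<open>8\<close>.\<close>

lemma step_kernel_error_at_jump:
  assumes l: "l \<ge> 1" and s: "s \<ge> 1" and \<theta>: "0 \<le> \<theta>" "\<theta> \<le> pi" and \<tau>: "0 \<le> \<tau>" "\<tau> \<le> pi"
    and c: "\<theta> < \<tau> \<Longrightarrow> c = 1" "\<tau> < \<theta> \<Longrightarrow> c = 0" "c = 0 \<or> c = 1"
  shows "\<bar>c - step_kernel l s \<tau> \<theta>\<bar> \<le> 9 * 72 ^ s / (1 + real l * \<bar>\<theta> - \<tau>\<bar>) ^ (2 * s - 2)"
proof (cases "\<theta> = \<tau>")
  case True
  have "\<bar>step_kernel l s \<tau> \<theta>\<bar> \<le> 8 * 72 ^ s" using step_kernel_error[OF l s \<theta> \<tau>] True by simp
  moreover have "(1::real) \<le> 72 ^ s" by simp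
  moreover have "\<bar>c - step_kernel l s \<tau> \<theta>\<bar> \<le> 1 + \<bar>step_kernel l s \<tau> \<theta>\<bar>" using c(3) by auto
  ultimately have "\<bar>c - step_kernel l s \<tau> \<theta>\<bar> \<le> 9 * 72 ^ s" by linarith
  then show ?thesis using True by simp
next
  case False
  then have "c = (if \<theta> < \<tau> then 1 else 0)" using c(1,2) by auto
  then have "\<bar>c - step_kernel l s \<tau> \<theta>\<bar> \<le> 8 * 72 ^ s / (1 + real l * \<bar>\<theta> - \<tau>\<bar>) ^ (2 * s - 2)"
    using step_kernel_error[OF l s \<theta> \<tau>] by simp
  also have "\<dots> \<le> 9 * 72 ^ s / (1 + real l * \<bar>\<theta> - \<tau>\<bar>) ^ (2 * s - 2)" by (intro divide_right_mono) auto
  finally show ?thesis .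
qed

text \<open>The exponent \<open>a + r\<close> of the kernel provides \<open>2 (a + r) - 2\<close>
  powers of decay: \<open>2 (r - 1)\<close> are spent on the power of
  \<open>cos \<theta> - cos \<tau>\<close>, the other \<open>2 a\<close> are dominated by
  \<open>fejer_pair^a\<close>. The bound thus becomes the modulus of a trigonometric polynomial in
  \<tau>.\<close>

lemma middle_kernel_le:
  assumes l: "l \<ge> 1" and r: "r \<ge> 1" and \<theta>: "0 \<le> \<theta>" "\<theta> \<le> pi" and \<tau>: "0 \<le> \<tau>" "\<tau> \<le> pi" "1 / real l \<le> sin \<tau>"
    and c: "\<theta> < \<tau> \<Longrightarrow> c = 1" "\<tau> < \<theta> \<Longrightarrow> c = 0" "c = 0 \<or> c = 1"
  shows "\<bar>(cos \<theta> - cos \<tau>) ^ (r - 1) / fact (r - 1) * poly R (cos \<tau>) * sin \<tau> * (c - step_kernel l (a + r) \<tau> \<theta>)\<bar>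
    \<le> 9 * 72 ^ (a + r) * (4/3) ^ a * (1 / real l) ^ (r - 1) *
        (\<bar>trig_weighted r R \<tau>\<bar> * damping l a \<tau> * fejer_pair l (\<theta> - \<tau>) ^ a)"
proof -
  have l0: "real l > 0" using l by simp
  have s0: "sin \<tau> > 0" using \<tau> l0 by (smt (verit) divide_pos_pos)
  define b where "b = 1 + real l * \<bar>\<theta> - \<tau>\<bar>"
  have b: "b \<ge> 1" using l0 by (simp add: b_def)
  have 1: "\<bar>(cos \<theta> - cos \<tau>) ^ (r - 1) / fact (r - 1)\<bar> \<le> (1 / real l) ^ (r - 1) * sin \<tau> ^ (r - 1) * b ^ (2 * (r - 1))"
  proof -
    have "\<bar>(cos \<theta> - cos \<tau>) ^ (r - 1) / fact (r - 1)\<bar> \<le> \<bar>cos \<theta> - cos \<tau>\<bar> ^ (r - 1) / 1"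
      unfolding abs_divide power_abs by (intro divide_left_mono) (auto simp: fact_ge_1)
    also have "\<dots> \<le> (sin \<tau> / real l * b\<^sup>2) ^ (r - 1)"
      using abs_cos_diff_le[OF l \<tau>(3), of \<theta>] by (simp add: b_def power_mono)
    also have "\<dots> = (1 / real l) ^ (r - 1) * sin \<tau> ^ (r - 1) * b ^ (2 * (r - 1))"
      by (simp add: power_mult_distrib power_divide power_mult)
    finally show ?thesis .
  qed
  have 2: "\<bar>c - step_kernel l (a + r) \<tau> \<theta>\<bar> \<le> 9 * 72 ^ (a + r) / b ^ (2 * (a + r) - 2)"
    unfolding b_def using r by (intro step_kernel_error_at_jump l \<theta> \<tau>(1,2) c) auto
  have 3: "(1 / b\<^sup>2) ^ a \<le> (4/3) ^ a * damping l a \<tau> * fejer_pair l (\<theta> - \<tau>) ^ a"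
  proof -
    have "(1 / b\<^sup>2) ^ a \<le> fejer_pair l (\<theta> - \<tau>) ^ a"
      using fejer_pair_ge[OF l, of "\<theta> - \<tau>"] by (intro power_mono) (auto simp: b_def)
    \<comment> \<open>On the middle arc the damping factor is inserted at the cost of
      \<open>(4/3)^a\<close>. Its effect is needed near the multiples of \<open>pi\<close>, because
      the bound will be integrated over the whole circle.\<close>
    also have "\<dots> = ((4/3) ^ a * (3/4) ^ a) * fejer_pair l (\<theta> - \<tau>) ^ a" by (simp add: power_mult_distrib[symmetric])
    also have "\<dots> \<le> ((4/3) ^ a * damping l a \<tau>) * fejer_pair l (\<theta> - \<tau>) ^ a"
      using damping_ge[OF l, of \<tau> a] \<tau>(3) s0 by (intro mult_right_mono mult_left_mono) auto
    finally show ?thesis .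
  qed
  have bb: "b ^ (2 * (r - 1)) / b ^ (2 * (a + r) - 2) = (1 / b\<^sup>2) ^ a"
  proof -
    have "2 * (a + r) - 2 = 2 * (r - 1) + 2 * a" using r by simp
    then have "b ^ (2 * (a + r) - 2) = b ^ (2 * (r - 1)) * (b\<^sup>2) ^ a" by (simp add: power_add power_mult)
    then show ?thesis using b by (simp add: power_divide)
  qed
  have "\<bar>(cos \<theta> - cos \<tau>) ^ (r - 1) / fact (r - 1) * poly R (cos \<tau>) * sin \<tau> * (c - step_kernel l (a + r) \<tau> \<theta>)\<bar>
     = \<bar>(cos \<theta> - cos \<tau>) ^ (r - 1) / fact (r - 1)\<bar> * (\<bar>poly R (cos \<tau>)\<bar> * sin \<tau>) * \<bar>c - step_kernel l (a + r) \<tau> \<theta>\<bar>"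
    using s0 by (simp only: abs_mult abs_of_pos mult.assoc)
  also have "\<dots> \<le> ((1 / real l) ^ (r - 1) * sin \<tau> ^ (r - 1) * b ^ (2 * (r - 1))) * (\<bar>poly R (cos \<tau>)\<bar> * sin \<tau>) * (9 * 72 ^ (a + r) / b ^ (2 * (a + r) - 2))"
    using s0 b by (intro mult_mono 1 2 order_refl) auto
  also have "\<dots> = 9 * 72 ^ (a + r) * (1 / real l) ^ (r - 1) * (\<bar>poly R (cos \<tau>)\<bar> * (sin \<tau> ^ (r - 1) * sin \<tau>)) * (b ^ (2 * (r - 1)) / b ^ (2 * (a + r) - 2))"
    by (simp add: mult_ac)
  also have "\<bar>poly R (cos \<tau>)\<bar> * (sin \<tau> ^ (r - 1) * sin \<tau>) = \<bar>trig_weighted r R \<tau>\<bar>"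
    using r s0 by (cases r) (auto simp: trig_weighted_def abs_mult power_abs mult_ac)
  also have "9 * 72 ^ (a + r) * (1 / real l) ^ (r - 1) * \<bar>trig_weighted r R \<tau>\<bar> * (b ^ (2 * (r - 1)) / b ^ (2 * (a + r) - 2))
     \<le> 9 * 72 ^ (a + r) * (1 / real l) ^ (r - 1) * \<bar>trig_weighted r R \<tau>\<bar> * ((4/3) ^ a * damping l a \<tau> * fejer_pair l (\<theta> - \<tau>) ^ a)"
    unfolding bb by (intro mult_left_mono 3) auto
  finally show ?thesis by (simp add: mult_ac)
qed

text \<open>Nikolskii's inequality in \<tau> moves the p-th power inside; then the integrations are
  interchanged and the kernel is integrated over \<theta> first. The inequality is one for the whole
  circle, although the error concerns only the middle arc, and \<open>damping\<close> repairs the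
  weight \<open>|sin \<tau>| + 1/l\<close> that arises near the ends.\<close>

lemma middle_integral_le:
  assumes p: "0 < p" "p < 1" and a: "real a * p \<ge> 2" and l: "l \<ge> 1" "l \<le> N" and N: "degree R + r \<le> N"
  defines "U \<equiv> \<lambda>\<theta> \<tau>. \<bar>trig_weighted r R \<tau>\<bar> * damping l a \<tau> * fejer_pair l (\<theta> - \<tau>) ^ a"
  shows "integral {0..pi} (\<lambda>\<theta>. integral {-pi..pi} (U \<theta>) powr p * sin \<theta>)
    \<le> (24 * (1 + 5 * real a) * real N) powr (1 - p) * (2 powr (real a * p) * 279936) / real l * trig_mass p r R"
proof -
  have a1: "real a * p \<ge> 1" using a by simp
  have a0: "a > 0" using a by (cases a) auto
  define K where "K = (24 * (1 + 5 * real a) * real N) powr (1 - p)"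
  define V where "V = (\<lambda>\<theta> \<tau>. \<bar>trig_weighted r R \<tau>\<bar> powr p * damping l a \<tau> powr p * fejer_pair l (\<theta> - \<tau>) powr (real a * p))"
  have U0: "U \<theta> \<tau> \<ge> 0" for \<theta> \<tau> by (simp add: U_def)
  have UV: "U \<theta> \<tau> powr p = V \<theta> \<tau>" for \<theta> \<tau>
  proof -
    have "(fejer_pair l (\<theta> - \<tau>) ^ a) powr p = fejer_pair l (\<theta> - \<tau>) powr (real a * p)"
      using a0 by (intro power_powr_eq) auto
    then show ?thesis by (simp add: U_def V_def powr_mult)
  qed
  have Ucont: "continuous_on S (\<lambda>x. U (fst x) (snd x))" for S unfolding U_def by (intro continuous_intros)
  have Vcont: "continuous_on S (\<lambda>x. V (g x) (h x))" if "continuous_on S g" "continuous_on S h" for S :: "'b::t2_space set" and g h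
    unfolding V_def using p a1 that
    by (intro continuous_on_mult continuous_on_abs_powr continuous_intros continuous_on_powr') auto
  have nik: "integral {-pi..pi} (U \<theta>) powr p \<le> K * integral {-pi..pi} (V \<theta>)" for \<theta>
  proof -
    \<comment> \<open>The weighted polynomial contributes \<open>N\<close> to the degree, the
      damping \<open>4 a l\<close> and the kernel \<open>a l\<close>; the sum is at most
      \<open>(1 + 5 a) N\<close> because \<open>l \<le> N\<close>.\<close>
    have "trig_poly ((N + a * (4 * l)) + a * l) (\<lambda>\<tau>. trig_weighted r R \<tau> * damping l a \<tau> * fejer_pair l (\<theta> - \<tau>) ^ a)"
      by (intro trig_poly_mult trig_poly_power trig_poly_fejer_pair trig_poly_damping trig_poly_trig_weighted N)
    moreover have "(N + a * (4 * l)) + a * l \<le> (1 + 5 * a) * N"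
    proof -
      have "a * l \<le> a * N" using l by simp
      then show ?thesis by (simp add: algebra_simps)
    qed
    ultimately have "trig_poly ((1 + 5 * a) * N) (\<lambda>\<tau>. trig_weighted r R \<tau> * damping l a \<tau> * fejer_pair l (\<theta> - \<tau>) ^ a)"
      by (rule trig_poly_mono)
    then obtain q where q: "degree q \<le> 2 * ((1 + 5 * a) * N)" "\<And>t. norm (poly q (cis t)) = U \<theta> t"
      by (rule trig_polyE) (simp add: U_def abs_mult)
    have "integral {-pi..pi} (U \<theta>) powr p \<le> (12 * real (2 * ((1 + 5 * a) * N))) powr (1 - p) * integral {-pi..pi} (\<lambda>t. U \<theta> t powr p)"
      using Nikolskii_circle[OF p q(1)] l by (simp add: q(2))
    moreover have "12 * real (2 * ((1 + 5 * a) * N)) = 24 * (1 + 5 * real a) * real N" by (simp add: algebra_simps)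
    ultimately show ?thesis by (simp add: K_def UV)
  qed
  have K0: "K \<ge> 0" by (simp add: K_def)
  have "integral {0..pi} (\<lambda>\<theta>. integral {-pi..pi} (U \<theta>) powr p * sin \<theta>)
      \<le> integral {0..pi} (\<lambda>\<theta>. K * (integral {-pi..pi} (V \<theta>) * sin \<theta>))"
  proof (rule integral_le)
    have "continuous_on {0..pi} (\<lambda>\<theta>. integral (cbox (-pi) pi) (U \<theta>))"
      using Ucont by (intro integral_continuous_on_param) (simp add: case_prod_unfold)
    then show "(\<lambda>\<theta>. integral {-pi..pi} (U \<theta>) powr p * sin \<theta>) integrable_on {0..pi}"
      using p U0 by (intro integrable_continuous_real continuous_on_mult continuous_on_powr' continuous_intros)
        (auto simp: box_real intro!: integral_nonneg integrable_continuous_real continuous_intros simp: U_def)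
    have "continuous_on {0..pi} (\<lambda>\<theta>. integral (cbox (-pi) pi) (V \<theta>))"
      by (intro integral_continuous_on_param) (auto simp: case_prod_unfold intro!: Vcont continuous_intros)
    then show "(\<lambda>\<theta>. K * (integral {-pi..pi} (V \<theta>) * sin \<theta>)) integrable_on {0..pi}"
      by (intro integrable_continuous_real continuous_intros) (simp add: box_real)
    fix \<theta> assume "\<theta> \<in> {0..pi}"
    then have "0 \<le> sin \<theta>" by (auto intro: sin_ge_zero)
    then show "integral {-pi..pi} (U \<theta>) powr p * sin \<theta> \<le> K * (integral {-pi..pi} (V \<theta>) * sin \<theta>)"
      using mult_right_mono[OF nik[of \<theta>]] by (simp add: mult.assoc)
  qed
  also have "\<dots> = K * integral {0..pi} (\<lambda>\<theta>. integral {-pi..pi} (\<lambda>\<tau>. V \<theta> \<tau> * sin \<theta>))" by simp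
  also have "integral {0..pi} (\<lambda>\<theta>. integral {-pi..pi} (\<lambda>\<tau>. V \<theta> \<tau> * sin \<theta>))
     = integral {-pi..pi} (\<lambda>\<tau>. integral {0..pi} (\<lambda>\<theta>. V \<theta> \<tau> * sin \<theta>))"
  proof -
    have "continuous_on (cbox (0, -pi) (pi, pi)) (\<lambda>(\<theta>, \<tau>). V \<theta> \<tau> * sin \<theta>)"
      by (auto simp: case_prod_unfold intro!: continuous_intros Vcont)
    from integral_swap_continuous[OF this] show ?thesis by (simp only: box_real)
  qed
  \<comment> \<open>After taking p-th powers \<open>fejer_pair\<close> has the exponent
    \<open>a p \<ge> 2\<close>, as its integral against \<open>sin\<close> requires.
    \<open>139968 = 9 * 15552\<close>, and the two halves of the circle will double it.\<close>
  also have "K * \<dots> \<le> K * integral {-pi..pi} (\<lambda>\<tau>. (2 powr (real a * p) * 139968 / real l) * (\<bar>trig_weighted r R \<tau>\<bar> powr p * \<bar>sin \<tau>\<bar>))"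
  proof (intro mult_left_mono integral_le)
    have "continuous_on {-pi..pi} (\<lambda>\<tau>. integral (cbox 0 pi) (\<lambda>\<theta>. V \<theta> \<tau> * sin \<theta>))"
      by (intro integral_continuous_on_param) (auto simp: case_prod_unfold intro!: Vcont continuous_intros)
    then show "(\<lambda>\<tau>. integral {0..pi} (\<lambda>\<theta>. V \<theta> \<tau> * sin \<theta>)) integrable_on {-pi..pi}"
      by (intro integrable_continuous_real) (simp add: box_real)
    show "(\<lambda>\<tau>. (2 powr (real a * p) * 139968 / real l) * (\<bar>trig_weighted r R \<tau>\<bar> powr p * \<bar>sin \<tau>\<bar>)) integrable_on {-pi..pi}"
      using p by (intro integrable_continuous_real continuous_on_mult continuous_on_abs_powr continuous_intros)
    fix \<tau> assume \<tau>: "\<tau> \<in> {-pi..pi}"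
    let ?W = "\<bar>trig_weighted r R \<tau>\<bar> powr p * damping l a \<tau> powr p"
    have "integral {0..pi} (\<lambda>\<theta>. V \<theta> \<tau> * sin \<theta>) = ?W * integral {0..pi} (\<lambda>\<theta>. fejer_pair l (\<theta> - \<tau>) powr (real a * p) * sin \<theta>)"
      unfolding V_def by (simp only: mult.assoc integral_mult_right)
    also have "\<dots> \<le> ?W * (2 powr (real a * p) * 15552 * (\<bar>sin \<tau>\<bar> + 1 / real l) / real l)"
      by (intro mult_left_mono fejer_pair_sin_integral l(1) a \<tau>) auto
    also have "\<dots> = (2 powr (real a * p) * 15552 / real l) * (\<bar>trig_weighted r R \<tau>\<bar> powr p * (damping l a \<tau> powr p * (\<bar>sin \<tau>\<bar> + 1 / real l)))"
      by (simp only: times_divide_eq_left times_divide_eq_right mult_ac)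
    also have "\<dots> \<le> (2 powr (real a * p) * 15552 / real l) * (\<bar>trig_weighted r R \<tau>\<bar> powr p * (9 * \<bar>sin \<tau>\<bar>))"
      by (intro mult_left_mono damping_weight l(1) a1 p(1)) auto
    finally show "integral {0..pi} (\<lambda>\<theta>. V \<theta> \<tau> * sin \<theta>) \<le> (2 powr (real a * p) * 139968 / real l) * (\<bar>trig_weighted r R \<tau>\<bar> powr p * \<bar>sin \<tau>\<bar>)"
      by (simp add: mult_ac)
  qed (rule K0)
  also have "integral {-pi..pi} (\<lambda>\<tau>. (2 powr (real a * p) * 139968 / real l) * (\<bar>trig_weighted r R \<tau>\<bar> powr p * \<bar>sin \<tau>\<bar>))
     = (2 powr (real a * p) * 139968 / real l) * (2 * trig_mass p r R)"
  proof -
    let ?h = "\<lambda>\<tau>. \<bar>trig_weighted r R \<tau>\<bar> powr p * \<bar>sin \<tau>\<bar>"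
    have hi: "?h integrable_on {x..y}" for x y
      using p by (intro integrable_continuous_real continuous_on_mult continuous_on_abs_powr continuous_intros)
    have 1: "integral {0..pi} ?h = trig_mass p r R"
      unfolding trig_mass_def by (rule integral_cong) (use sin_ge_zero in auto)
    have "integral {-pi..-0} (\<lambda>\<tau>. ?h (- \<tau>)) = integral {0..pi} ?h" by (rule Henstock_Kurzweil_Integration.integral_reflect_real)
    then have 2: "integral {-pi..0} ?h = trig_mass p r R" using 1 by (simp add: trig_weighted_minus)
    have "integral {-pi..pi} ?h = 2 * trig_mass p r R"
      using Henstock_Kurzweil_Integration.integral_combine[of "-pi" 0 pi ?h] hi 1 2 by simp
    then show ?thesis by (simp only: integral_mult_right)
  qed
  finally show ?thesis by (simp add: K_def mult_ac)
qed

lemma trig_mass_reflect: "trig_mass p r (pcompose R [:0, -1:]) = trig_mass p r R"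
proof -
  let ?g = "\<lambda>t. \<bar>trig_weighted r R t\<bar> powr p * sin t"
  have "trig_mass p r R = integral {pi - pi..pi - 0} (\<lambda>t. ?g (pi - t))"
    unfolding trig_mass_def by (rule integral_reflect_about[symmetric])
  also have "\<dots> = trig_mass p r (pcompose R [:0, -1:])"
    by (simp add: trig_mass_def trig_weighted_def poly_pcompose)
  finally show ?thesis by simp
qed

text \<open>The reflection \<open>t -> pi - t\<close> turns \<open>R (x)\<close> into
  \<open>R (-x)\<close> and reduces this end to the other one.\<close>

lemma other_end_integral_le:
  assumes p: "0 < p" "p < 1" and l: "l \<ge> 1" and r: "r \<ge> 1" and \<alpha>: "0 < \<alpha>" "\<alpha> \<le> pi / 2" "sin \<alpha> = 1 / real l"
    and N: "degree R + r \<le> N" "N \<ge> 1"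
  shows "integral {pi - \<alpha>..pi} (\<lambda>\<theta>. integral {pi - \<alpha>..\<theta>} (\<lambda>\<tau>. (1 + cos \<tau>) ^ (r - 1) * \<bar>poly R (cos \<tau>)\<bar> * sin \<tau>) powr p * sin \<theta>)
    \<le> 4608 powr (1 - p) * (real N / real l) powr (2 - 2 * p) * (1 / real l) powr (real r * p) * trig_mass p r R"
proof -
  let ?w = "\<lambda>\<tau>. (1 + cos \<tau>) ^ (r - 1) * \<bar>poly R (cos \<tau>)\<bar> * sin \<tau>"
  let ?R = "pcompose R [:0, -1:]"
  have inner: "integral {pi - \<alpha>..pi - \<theta>} ?w = integral {\<theta>..\<alpha>} (\<lambda>\<tau>. (1 - cos \<tau>) ^ (r - 1) * \<bar>poly ?R (cos \<tau>)\<bar> * sin \<tau>)" for \<theta>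
    using integral_reflect_about[of pi \<alpha> \<theta> "\<lambda>x. ?w (pi - x)"] by (simp add: poly_pcompose)
  have "integral {pi - \<alpha>..pi} (\<lambda>\<theta>. integral {pi - \<alpha>..\<theta>} ?w powr p * sin \<theta>)
     = integral {0..\<alpha>} (\<lambda>\<theta>. integral {pi - \<alpha>..pi - \<theta>} ?w powr p * sin (pi - \<theta>))"
    using integral_reflect_about[of pi "pi" "pi - \<alpha>" "\<lambda>\<theta>. integral {pi - \<alpha>..\<theta>} ?w powr p * sin \<theta>"] by simp
  also have "\<dots> = integral {0..\<alpha>} (\<lambda>\<theta>. integral {\<theta>..\<alpha>} (\<lambda>\<tau>. (1 - cos \<tau>) ^ (r - 1) * \<bar>poly ?R (cos \<tau>)\<bar> * sin \<tau>) powr p * sin \<theta>)"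
    unfolding inner by simp
  also have "\<dots> \<le> 4608 powr (1 - p) * (real N / real l) powr (2 - 2 * p) * (1 / real l) powr (real r * p) * trig_mass p r ?R"
    using N by (intro end_integral_le p l r \<alpha>) (auto simp: degree_pcompose)
  finally show ?thesis by (simp add: trig_mass_reflect)
qed

text \<open>In the Taylor remainder of \<open>F\<close> the indicator of
  \<open>\<theta> < \<tau>\<close> is replaced by \<open>0\<close> for \<tau> on the left end arc,
  by \<open>step_kernel\<close> on the middle arc and by \<open>1\<close> on the right end arc.
  \<open>P1\<close> is the Taylor polynomial; \<open>P2\<close> and \<open>P3\<close> come from the
  middle and the right arc. Only the end arcs cost \<open>(N/l)^(2-2p)\<close>, the middle arc costs
  \<open>(N/l)^(1-p)\<close>.\<close>

lemma poly_approximation_trig: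
  assumes p: "0 < p" "p < 1" and a: "real a * p \<ge> 2" and r: "r \<ge> 1"
  shows "\<exists>C\<ge>0. \<forall>l N F. 1 \<le> l \<longrightarrow> l \<le> N \<longrightarrow> degree ((pderiv ^^ r) F) + r \<le> N \<longrightarrow>
    (\<exists>P. degree P \<le> (r - 1) + (a + r) * (l - 1) \<and>
      integral {0..pi} (\<lambda>\<theta>. \<bar>poly (F - P) (cos \<theta>)\<bar> powr p * sin \<theta>)
        \<le> C * (1 / real l) powr (real r * p) * (real N / real l) powr (2 - 2 * p) * trig_mass p r ((pderiv ^^ r) F))"
proof -
  define K0 where "K0 = (9 * 72 ^ (a + r) * (4/3) ^ a :: real)"
  define CM where "CM = K0 powr p * (24 * (1 + 5 * real a)) powr (1 - p) * (2 powr (real a * p) * 279936)"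
  define C where "C = CM + 2 * 4608 powr (1 - p)"
  have K0: "K0 \<ge> 0" by (simp add: K0_def)
  have C0: "C \<ge> 0" "CM \<ge> 0" by (simp_all add: C_def CM_def)
  have "\<exists>P. degree P \<le> (r - 1) + (a + r) * (l - 1) \<and>
      integral {0..pi} (\<lambda>\<theta>. \<bar>poly (F - P) (cos \<theta>)\<bar> powr p * sin \<theta>)
        \<le> C * (1 / real l) powr (real r * p) * (real N / real l) powr (2 - 2 * p) * trig_mass p r ((pderiv ^^ r) F)"
    if l: "1 \<le> l" "l \<le> N" and N: "degree ((pderiv ^^ r) F) + r \<le> N" for l N and F :: "real poly"
  proof -
    define R where "R = (pderiv ^^ r) F"
    have N1: "N \<ge> 1" using l by simp
    have l0: "real l > 0" using l by simp
    define X where "X = trig_mass p r R"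
    have X0: "X \<ge> 0" unfolding X_def using p(1) by (rule trig_mass_nonneg)
    \<comment> \<open>The cut is made where \<open>sin\<close> equals \<open>1/l\<close>, the width
      of the kernel. For \<open>l = 1\<close> the middle arc shrinks to the point
      \<open>pi/2\<close>.\<close>
    define \<alpha> where "\<alpha> = arcsin (1 / real l)"
    have l1: "0 < 1 / real l" "1 / real l \<le> 1" using l by auto
    have \<alpha>: "0 < \<alpha>" "\<alpha> \<le> pi / 2" "sin \<alpha> = 1 / real l"
    proof -
      have l2: "- 1 \<le> 1 / real l" using l1(1) by linarith
      show "0 < \<alpha>" using l1 arcsin_less_arcsin[of 0 "1 / real l"] by (simp add: \<alpha>_def)
      show "\<alpha> \<le> pi / 2" using arcsin_bounded[OF l2 l1(2)] by (simp add: \<alpha>_def)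
      show "sin \<alpha> = 1 / real l" using sin_arcsin[OF l2 l1(2)] by (simp add: \<alpha>_def)
    qed
    have sin_mid: "1 / real l \<le> sin \<tau>" if "\<tau> \<in> {\<alpha>..pi - \<alpha>}" for \<tau>
    proof (cases "\<tau> \<le> pi / 2")
      case True
      then show ?thesis using sin_monotone_2pi_le[of \<alpha> \<tau>] \<alpha> that by simp
    next
      case False
      then have "sin \<alpha> \<le> sin (pi - \<tau>)" using \<alpha> that by (intro sin_monotone_2pi_le) auto
      then show ?thesis using \<alpha> by simp
    qed
    define S where "S = step_kernel l (a + r)"
    define k where "k = (\<lambda>\<theta> \<tau>. (cos \<theta> - cos \<tau>) ^ (r - 1) / fact (r - 1) * poly R (cos \<tau>) * sin \<tau>)"
    obtain b where b: "\<And>j. continuous_on UNIV (b j)"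
      "\<And>\<tau> \<theta>. \<tau> \<ge> 0 \<Longrightarrow> S \<tau> \<theta> = (\<Sum>j\<le>(a + r) * (l - 1). b j \<tau> * cos (real j * \<theta>))"
      unfolding S_def using step_kernel_cos_expansion[of l "a + r"] by metis
    have bc: "continuous_on T (b j)" for T j using b(1) by (rule continuous_on_subset) simp
    have kc: "continuous_on T (k \<theta>)" for T \<theta> unfolding k_def by (intro continuous_intros) auto
    have Sc: "continuous_on T (\<lambda>\<tau>. S \<tau> \<theta>)" if "T \<subseteq> {0..}" for T \<theta>
    proof (rule continuous_on_eq)
      show "continuous_on T (\<lambda>\<tau>. \<Sum>j\<le>(a + r) * (l - 1). b j \<tau> * cos (real j * \<theta>))" by (intro continuous_intros bc)
    qed (use b(2) that in auto)
    obtain P1 where P1: "degree P1 \<le> r - 1" "\<And>\<theta>. \<theta> \<in> {0..pi} \<Longrightarrow> poly F (cos \<theta>) = poly P1 (cos \<theta>) + integral {\<theta>..pi} (k \<theta>)"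
      using poly_taylor_trig[OF r, of F] unfolding k_def R_def by blast
    obtain P2 where P2: "degree P2 \<le> (r - 1) + (a + r) * (l - 1)"
      "\<And>\<theta>. poly P2 (cos \<theta>) = integral {\<alpha>..pi - \<alpha>} (\<lambda>\<tau>. k \<theta> \<tau> * S \<tau> \<theta>)"
    proof -
      have "continuous_on {\<alpha>..pi - \<alpha>} (\<lambda>\<tau>. poly R (cos \<tau>) * sin \<tau>)" by (intro continuous_intros)
      from poly_power_kernel_integral[where b = b and d = "(a + r) * (l - 1)" and m = "r - 1", OF bc this]
      obtain P where P: "degree P \<le> (r - 1) + (a + r) * (l - 1)"
        "\<And>\<theta>. poly P (cos \<theta>) = integral {\<alpha>..pi - \<alpha>} (\<lambda>\<tau>. (cos \<theta> - cos \<tau>) ^ (r - 1) / fact (r - 1) * (poly R (cos \<tau>) * sin \<tau>) * (\<Sum>j\<le>(a + r) * (l - 1). b j \<tau> * cos (real j * \<theta>)))"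
        by blast
      have "poly P (cos \<theta>) = integral {\<alpha>..pi - \<alpha>} (\<lambda>\<tau>. k \<theta> \<tau> * S \<tau> \<theta>)" for \<theta>
        unfolding P(2) using \<alpha> by (intro integral_cong) (simp add: b(2) k_def mult.assoc)
      then show ?thesis using that P(1) by blast
    qed
    obtain P3 where P3: "degree P3 \<le> r - 1" "\<And>\<theta>. poly P3 (cos \<theta>) = integral {pi - \<alpha>..pi} (k \<theta>)"
    proof -
      have "continuous_on {pi - \<alpha>..pi} (\<lambda>\<tau>. poly R (cos \<tau>) * sin \<tau>)" by (intro continuous_intros)
      from poly_power_kernel_integral[where b = "\<lambda>_ _. 1" and d = 0 and m = "r - 1", OF continuous_on_const this]
      obtain P where P: "degree P \<le> r - 1"
        "\<And>\<theta>. poly P (cos \<theta>) = integral {pi - \<alpha>..pi} (\<lambda>\<tau>. (cos \<theta> - cos \<tau>) ^ (r - 1) / fact (r - 1) * (poly R (cos \<tau>) * sin \<tau>))"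
        by auto
      then show ?thesis using that by (simp add: k_def mult.assoc)
    qed
    define P where "P = P1 + P2 + P3"
    have degP: "degree P \<le> (r - 1) + (a + r) * (l - 1)"
      unfolding P_def using P1(1) P2(1) P3(1) by (intro degree_add_le) auto
    define U where "U = (\<lambda>\<theta> \<tau>. \<bar>trig_weighted r R \<tau>\<bar> * damping l a \<tau> * fejer_pair l (\<theta> - \<tau>) ^ a)"
    define K1 where "K1 = K0 * (1 / real l) ^ (r - 1)"
    have K1: "K1 \<ge> 0" using K0 by (simp add: K1_def)
    have Uc: "continuous_on T (U \<theta>)" for T \<theta> unfolding U_def by (intro continuous_intros)
    have U0: "U \<theta> \<tau> \<ge> 0" for \<theta> \<tau> by (simp add: U_def)
    have ki: "k \<theta> integrable_on {x..y}" for \<theta> x y using kc by (rule integrable_continuous_real)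
    have kSi: "(\<lambda>\<tau>. k \<theta> \<tau> * S \<tau> \<theta>) integrable_on {x..y}" if "0 \<le> x" for \<theta> x y
      by (intro integrable_continuous_real continuous_on_mult kc Sc) (use that in auto)
    have Ui: "U \<theta> integrable_on {x..y}" for \<theta> x y using Uc by (rule integrable_continuous_real)
    \<comment> \<open>The integral is extended to the whole circle, where Nikolskii's inequality
      applies.\<close>
    define E2 where "E2 = (\<lambda>\<theta>. K1 * integral {-pi..pi} (U \<theta>))"
    have E20: "E2 \<theta> \<ge> 0" for \<theta> unfolding E2_def using K1 U0 by (intro mult_nonneg_nonneg integral_nonneg Ui) auto
    \<comment> \<open>For \<tau> on one side of \<theta> the indicator is a constant
      \<open>c\<close>.\<close>
    have mid: "\<bar>integral {x..y} (\<lambda>\<tau>. k \<theta> \<tau> * (c - S \<tau> \<theta>))\<bar> \<le> K1 * integral {x..y} (U \<theta>)"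
      if \<theta>: "\<theta> \<in> {0..pi}" and xy: "\<alpha> \<le> x" "y \<le> pi - \<alpha>" and c: "c = 1 \<and> \<theta> \<le> x \<or> c = 0 \<and> y \<le> \<theta>" for \<theta> x y c
    proof -
      have "norm (integral {x..y} (\<lambda>\<tau>. k \<theta> \<tau> * (c - S \<tau> \<theta>))) \<le> integral {x..y} (\<lambda>\<tau>. K1 * U \<theta> \<tau>)"
      proof (rule integral_norm_bound_integral)
        show "(\<lambda>\<tau>. k \<theta> \<tau> * (c - S \<tau> \<theta>)) integrable_on {x..y}"
          using \<alpha> xy by (intro integrable_continuous_real continuous_intros kc Sc) auto
        show "(\<lambda>\<tau>. K1 * U \<theta> \<tau>) integrable_on {x..y}" by (intro integrable_on_mult_right Ui)
        fix \<tau> assume \<tau>: "\<tau> \<in> {x..y}"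
        then have "\<tau> \<in> {\<alpha>..pi - \<alpha>}" using xy by auto
        then have "1 / real l \<le> sin \<tau>" "0 \<le> \<tau>" "\<tau> \<le> pi" using sin_mid \<alpha> by auto
        then have "\<bar>k \<theta> \<tau> * (c - S \<tau> \<theta>)\<bar> \<le> K0 * (1 / real l) ^ (r - 1) * U \<theta> \<tau>"
          unfolding k_def S_def U_def K0_def using l(1) r \<theta> \<tau> c by (intro middle_kernel_le) auto
        then show "norm (k \<theta> \<tau> * (c - S \<tau> \<theta>)) \<le> K1 * U \<theta> \<tau>" by (simp add: K1_def)
      qed
      then show ?thesis by simp
    qed
    have Usub: "K1 * integral {x..y} (U \<theta>) \<le> E2 \<theta>" if "-pi \<le> x" "y \<le> pi" for x y \<theta>
      unfolding E2_def using that U0 K1 by (intro mult_left_mono integral_subset_le Ui) auto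
    define w1 where "w1 = (\<lambda>\<tau>. (1 - cos \<tau>) ^ (r - 1) * \<bar>poly R (cos \<tau>)\<bar> * sin \<tau>)"
    define w3 where "w3 = (\<lambda>\<tau>. (1 + cos \<tau>) ^ (r - 1) * \<bar>poly R (cos \<tau>)\<bar> * sin \<tau>)"
    have wc: "continuous_on T w1" "continuous_on T w3" for T unfolding w1_def w3_def by (auto intro!: continuous_intros)
    have wi: "w1 integrable_on {x..y}" "w3 integrable_on {x..y}" for x y using wc by (auto intro: integrable_continuous_real)
    have w0: "w1 \<tau> \<ge> 0" "w3 \<tau> \<ge> 0" if "\<tau> \<in> {0..pi}" for \<tau>
    proof -
      have "sin \<tau> \<ge> 0" using that by (auto intro: sin_ge_zero)
      moreover have "1 + cos \<tau> \<ge> 0" using cos_ge_minus_one[of \<tau>] by linarith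
      ultimately show "w1 \<tau> \<ge> 0" "w3 \<tau> \<ge> 0" by (auto simp: w1_def w3_def)
    qed
    have kle: "\<bar>k \<theta> \<tau>\<bar> \<le> (d ^ (r - 1)) * \<bar>poly R (cos \<tau>)\<bar> * sin \<tau>" if "\<tau> \<in> {0..pi}" "\<bar>cos \<theta> - cos \<tau>\<bar> \<le> d" for \<theta> \<tau> d
    proof -
      have s: "sin \<tau> \<ge> 0" using that by (auto intro: sin_ge_zero)
      have "\<bar>(cos \<theta> - cos \<tau>) ^ (r - 1) / fact (r - 1)\<bar> \<le> \<bar>cos \<theta> - cos \<tau>\<bar> ^ (r - 1) / 1"
        unfolding abs_divide power_abs by (intro divide_left_mono) (auto simp: fact_ge_1)
      also have "\<dots> \<le> d ^ (r - 1)" using that(2) by (simp add: power_mono)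
      finally have "\<bar>(cos \<theta> - cos \<tau>) ^ (r - 1) / fact (r - 1)\<bar> * (\<bar>poly R (cos \<tau>)\<bar> * sin \<tau>) \<le> d ^ (r - 1) * (\<bar>poly R (cos \<tau>)\<bar> * sin \<tau>)"
        using s by (intro mult_right_mono) auto
      then show ?thesis using s by (simp add: k_def abs_mult mult.assoc)
    qed
    define e where "e = (\<lambda>\<theta>. poly (F - P) (cos \<theta>))"
    have e_eq: "e \<theta> = integral {\<theta>..pi} (k \<theta>) - integral {\<alpha>..pi - \<alpha>} (\<lambda>\<tau>. k \<theta> \<tau> * S \<tau> \<theta>) - integral {pi - \<alpha>..pi} (k \<theta>)"
      if "\<theta> \<in> {0..pi}" for \<theta>
      using P1(2)[OF that] by (simp add: e_def P_def P2(2) P3(2))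
    have comb: "integral {x..y} (k \<theta>) + integral {y..z} (k \<theta>) = integral {x..z} (k \<theta>)" if "x \<le> y" "y \<le> z" for x y z \<theta>
      using that ki by (rule Henstock_Kurzweil_Integration.integral_combine)
    have dif: "integral {x..y} (\<lambda>\<tau>. k \<theta> \<tau> * (c - S \<tau> \<theta>)) = c * integral {x..y} (k \<theta>) - integral {x..y} (\<lambda>\<tau>. k \<theta> \<tau> * S \<tau> \<theta>)"
      if "0 \<le> x" for x y c \<theta>
    proof -
      have "integral {x..y} (\<lambda>\<tau>. k \<theta> \<tau> * (c - S \<tau> \<theta>)) = integral {x..y} (\<lambda>\<tau>. c * k \<theta> \<tau> - k \<theta> \<tau> * S \<tau> \<theta>)"
        by (simp add: algebra_simps)
      also have "\<dots> = integral {x..y} (\<lambda>\<tau>. c * k \<theta> \<tau>) - integral {x..y} (\<lambda>\<tau>. k \<theta> \<tau> * S \<tau> \<theta>)"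
        using that by (intro Henstock_Kurzweil_Integration.integral_diff integrable_on_mult_right ki kSi)
      finally show ?thesis by simp
    qed
    \<comment> \<open>For \<theta> on the left end arc the indicator equals \<open>1\<close> on the
      middle and the right arc, so the only unsmoothed error is the remainder over
      \<open>[\<theta>, \<alpha>]\<close>.\<close>
    have e1: "\<bar>e \<theta>\<bar> \<le> integral {\<theta>..\<alpha>} w1 + E2 \<theta>" if \<theta>: "\<theta> \<in> {0..\<alpha>}" for \<theta>
    proof -
      have \<theta>': "\<theta> \<in> {0..pi}" using \<theta> \<alpha> by auto
      have "e \<theta> = integral {\<theta>..\<alpha>} (k \<theta>) + integral {\<alpha>..pi - \<alpha>} (\<lambda>\<tau>. k \<theta> \<tau> * (1 - S \<tau> \<theta>))"
        using e_eq[OF \<theta>'] comb[of \<theta> \<alpha> "pi - \<alpha>" \<theta>] comb[of \<theta> "pi - \<alpha>" pi \<theta>] dif[of \<alpha> "pi - \<alpha>" \<theta> 1] \<theta> \<alpha> by auto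
      moreover have "\<bar>integral {\<alpha>..pi - \<alpha>} (\<lambda>\<tau>. k \<theta> \<tau> * (1 - S \<tau> \<theta>))\<bar> \<le> E2 \<theta>"
        using mid[of \<theta> \<alpha> "pi - \<alpha>" 1] Usub[of \<alpha> "pi - \<alpha>" \<theta>] \<theta> \<theta>' \<alpha> by auto
      moreover have "norm (integral {\<theta>..\<alpha>} (k \<theta>)) \<le> integral {\<theta>..\<alpha>} w1"
      proof (rule integral_norm_bound_integral[OF ki wi(1)])
        fix \<tau> assume \<tau>: "\<tau> \<in> {\<theta>..\<alpha>}"
        then have "cos \<tau> \<le> cos \<theta>" using \<theta> \<alpha> by (intro cos_monotone_0_pi_le) auto
        then have "\<bar>cos \<theta> - cos \<tau>\<bar> \<le> 1 - cos \<tau>" using cos_le_one[of \<theta>] by simp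
        then show "norm (k \<theta> \<tau>) \<le> w1 \<tau>" using kle[of \<tau> \<theta> "1 - cos \<tau>"] \<tau> \<theta> \<alpha> by (simp add: w1_def)
      qed
      ultimately show ?thesis by simp
    qed
    have e2: "\<bar>e \<theta>\<bar> \<le> E2 \<theta>" if \<theta>: "\<theta> \<in> {\<alpha>..pi - \<alpha>}" for \<theta>
    proof -
      have \<theta>': "\<theta> \<in> {0..pi}" using \<theta> \<alpha> by auto
      have "integral {\<alpha>..pi - \<alpha>} (\<lambda>\<tau>. k \<theta> \<tau> * S \<tau> \<theta>) = integral {\<alpha>..\<theta>} (\<lambda>\<tau>. k \<theta> \<tau> * S \<tau> \<theta>) + integral {\<theta>..pi - \<alpha>} (\<lambda>\<tau>. k \<theta> \<tau> * S \<tau> \<theta>)"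
        using \<theta> \<alpha> kSi[of \<alpha> \<theta> "pi - \<alpha>"] by (intro Henstock_Kurzweil_Integration.integral_combine[symmetric]) auto
      then have "e \<theta> = integral {\<alpha>..\<theta>} (\<lambda>\<tau>. k \<theta> \<tau> * (0 - S \<tau> \<theta>)) + integral {\<theta>..pi - \<alpha>} (\<lambda>\<tau>. k \<theta> \<tau> * (1 - S \<tau> \<theta>))"
        using e_eq[OF \<theta>'] comb[of \<theta> "pi - \<alpha>" pi \<theta>] dif[of \<theta> "pi - \<alpha>" \<theta> 1] dif[of \<alpha> \<theta> \<theta> 0] \<theta> \<alpha> by auto
      moreover have "\<bar>integral {\<alpha>..\<theta>} (\<lambda>\<tau>. k \<theta> \<tau> * (0 - S \<tau> \<theta>))\<bar> \<le> K1 * integral {\<alpha>..\<theta>} (U \<theta>)"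
        using \<theta> \<theta>' by (intro mid) auto
      moreover have "\<bar>integral {\<theta>..pi - \<alpha>} (\<lambda>\<tau>. k \<theta> \<tau> * (1 - S \<tau> \<theta>))\<bar> \<le> K1 * integral {\<theta>..pi - \<alpha>} (U \<theta>)"
        using \<theta> \<theta>' by (intro mid) auto
      moreover have "integral {\<alpha>..\<theta>} (U \<theta>) + integral {\<theta>..pi - \<alpha>} (U \<theta>) = integral {\<alpha>..pi - \<alpha>} (U \<theta>)"
        using \<theta> Ui by (intro Henstock_Kurzweil_Integration.integral_combine) auto
      then have "K1 * integral {\<alpha>..\<theta>} (U \<theta>) + K1 * integral {\<theta>..pi - \<alpha>} (U \<theta>) = K1 * integral {\<alpha>..pi - \<alpha>} (U \<theta>)"
        by (simp only: distrib_left[symmetric])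
      ultimately show ?thesis using Usub[of \<alpha> "pi - \<alpha>" \<theta>] \<alpha> by auto
    qed
    \<comment> \<open>On the right arc the indicator was replaced by \<open>1\<close> although it
      vanishes for \<open>\<tau> < \<theta>\<close>; this leaves the integral over
      \<open>[pi - \<alpha>, \<theta>]\<close>.\<close>
    have e3: "\<bar>e \<theta>\<bar> \<le> integral {pi - \<alpha>..\<theta>} w3 + E2 \<theta>" if \<theta>: "\<theta> \<in> {pi - \<alpha>..pi}" for \<theta>
    proof -
      have \<theta>': "\<theta> \<in> {0..pi}" using \<theta> \<alpha> by auto
      have "e \<theta> = integral {\<alpha>..pi - \<alpha>} (\<lambda>\<tau>. k \<theta> \<tau> * (0 - S \<tau> \<theta>)) - integral {pi - \<alpha>..\<theta>} (k \<theta>)"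
        using e_eq[OF \<theta>'] comb[of "pi - \<alpha>" \<theta> pi \<theta>] dif[of \<alpha> "pi - \<alpha>" \<theta> 0] \<theta> \<alpha> by auto
      moreover have "\<bar>integral {\<alpha>..pi - \<alpha>} (\<lambda>\<tau>. k \<theta> \<tau> * (0 - S \<tau> \<theta>))\<bar> \<le> E2 \<theta>"
        using mid[of \<theta> \<alpha> "pi - \<alpha>" 0] Usub[of \<alpha> "pi - \<alpha>" \<theta>] \<theta> \<theta>' \<alpha> by auto
      moreover have "norm (integral {pi - \<alpha>..\<theta>} (k \<theta>)) \<le> integral {pi - \<alpha>..\<theta>} w3"
      proof (rule integral_norm_bound_integral[OF ki wi(2)])
        fix \<tau> assume \<tau>: "\<tau> \<in> {pi - \<alpha>..\<theta>}"
        then have "cos \<theta> \<le> cos \<tau>" using \<theta> \<alpha> by (intro cos_monotone_0_pi_le) auto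
        then have "\<bar>cos \<theta> - cos \<tau>\<bar> \<le> 1 + cos \<tau>" using cos_ge_minus_one[of \<theta>] by simp
        then show "norm (k \<theta> \<tau>) \<le> w3 \<tau>" using kle[of \<tau> \<theta> "1 + cos \<tau>"] \<tau> \<theta> \<alpha> by (simp add: w3_def)
      qed
      ultimately show ?thesis by simp
    qed
    define y1 where "y1 = (\<lambda>\<theta>. integral {\<theta>..\<alpha>} w1)"
    define y3 where "y3 = (\<lambda>\<theta>. integral {pi - \<alpha>..\<theta>} w3)"
    have y1c: "continuous_on {0..\<alpha>} y1" unfolding y1_def using \<alpha> wc by (intro integral_tail_sin(2)) auto
    have y3c: "continuous_on {pi - \<alpha>..pi} y3" unfolding y3_def using wi by (intro indefinite_integral_continuous_1) auto
    have y10: "y1 \<theta> \<ge> 0" if "\<theta> \<in> {0..\<alpha>}" for \<theta> unfolding y1_def using that \<alpha> w0 by (intro integral_nonneg wi) auto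
    have y30: "y3 \<theta> \<ge> 0" if "\<theta> \<in> {pi - \<alpha>..pi}" for \<theta> unfolding y3_def using that \<alpha> w0 by (intro integral_nonneg wi) auto
    have E2c: "continuous_on T E2" for T
    proof -
      have "continuous_on T (\<lambda>\<theta>. integral (cbox (-pi) pi) (U \<theta>))"
        by (intro integral_continuous_on_param) (auto simp: U_def case_prod_unfold intro!: continuous_intros)
      then show ?thesis unfolding E2_def by (intro continuous_intros) (simp add: box_real)
    qed
    have I2: "(\<lambda>\<theta>. E2 \<theta> powr p * sin \<theta>) integrable_on {x..y}" for x y
      using E20 p by (intro integrable_continuous_real continuous_on_mult continuous_on_powr' E2c continuous_intros) auto
    have I1: "(\<lambda>\<theta>. y1 \<theta> powr p * sin \<theta>) integrable_on {0..\<alpha>}"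
      using y10 p by (intro integrable_continuous_real continuous_on_mult continuous_on_powr' y1c continuous_intros) auto
    have I3: "(\<lambda>\<theta>. y3 \<theta> powr p * sin \<theta>) integrable_on {pi - \<alpha>..pi}"
      using y30 p by (intro integrable_continuous_real continuous_on_mult continuous_on_powr' y3c continuous_intros) auto
    have Ie: "(\<lambda>\<theta>. \<bar>e \<theta>\<bar> powr p * sin \<theta>) integrable_on {x..y}" for x y
      unfolding e_def using p by (intro integrable_continuous_real continuous_on_mult continuous_on_abs_powr continuous_intros)
    have A1: "integral {0..\<alpha>} (\<lambda>\<theta>. \<bar>e \<theta>\<bar> powr p * sin \<theta>) \<le> integral {0..\<alpha>} (\<lambda>\<theta>. y1 \<theta> powr p * sin \<theta>) + integral {0..\<alpha>} (\<lambda>\<theta>. E2 \<theta> powr p * sin \<theta>)"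
      unfolding Henstock_Kurzweil_Integration.integral_add[OF I1 I2, symmetric]
    proof (rule integral_le[OF Ie integrable_add[OF I1 I2]])
      fix \<theta> assume \<theta>: "\<theta> \<in> {0..\<alpha>}"
      have "\<bar>e \<theta>\<bar> powr p \<le> (y1 \<theta> + E2 \<theta>) powr p" using e1[OF \<theta>] p by (intro powr_mono2) (auto simp: y1_def)
      also have "\<dots> \<le> y1 \<theta> powr p + E2 \<theta> powr p" using y10[OF \<theta>] E20 p by (intro powr_add_le) auto
      finally have "\<bar>e \<theta>\<bar> powr p * sin \<theta> \<le> (y1 \<theta> powr p + E2 \<theta> powr p) * sin \<theta>"
        using \<theta> \<alpha> by (intro mult_right_mono sin_ge_zero) auto
      then show "\<bar>e \<theta>\<bar> powr p * sin \<theta> \<le> y1 \<theta> powr p * sin \<theta> + E2 \<theta> powr p * sin \<theta>" by (simp add: distrib_right)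
    qed
    have A3: "integral {pi - \<alpha>..pi} (\<lambda>\<theta>. \<bar>e \<theta>\<bar> powr p * sin \<theta>) \<le> integral {pi - \<alpha>..pi} (\<lambda>\<theta>. y3 \<theta> powr p * sin \<theta>) + integral {pi - \<alpha>..pi} (\<lambda>\<theta>. E2 \<theta> powr p * sin \<theta>)"
      unfolding Henstock_Kurzweil_Integration.integral_add[OF I3 I2, symmetric]
    proof (rule integral_le[OF Ie integrable_add[OF I3 I2]])
      fix \<theta> assume \<theta>: "\<theta> \<in> {pi - \<alpha>..pi}"
      have "\<bar>e \<theta>\<bar> powr p \<le> (y3 \<theta> + E2 \<theta>) powr p" using e3[OF \<theta>] p by (intro powr_mono2) (auto simp: y3_def)
      also have "\<dots> \<le> y3 \<theta> powr p + E2 \<theta> powr p" using y30[OF \<theta>] E20 p by (intro powr_add_le) auto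
      finally have "\<bar>e \<theta>\<bar> powr p * sin \<theta> \<le> (y3 \<theta> powr p + E2 \<theta> powr p) * sin \<theta>"
        using \<theta> \<alpha> by (intro mult_right_mono sin_ge_zero) auto
      then show "\<bar>e \<theta>\<bar> powr p * sin \<theta> \<le> y3 \<theta> powr p * sin \<theta> + E2 \<theta> powr p * sin \<theta>" by (simp add: distrib_right)
    qed
    have A2: "integral {\<alpha>..pi - \<alpha>} (\<lambda>\<theta>. \<bar>e \<theta>\<bar> powr p * sin \<theta>) \<le> integral {\<alpha>..pi - \<alpha>} (\<lambda>\<theta>. E2 \<theta> powr p * sin \<theta>)"
    proof (rule integral_le[OF Ie I2])
      fix \<theta> assume \<theta>: "\<theta> \<in> {\<alpha>..pi - \<alpha>}"
      have "\<bar>e \<theta>\<bar> powr p \<le> E2 \<theta> powr p" using e2[OF \<theta>] p by (intro powr_mono2) auto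
      then show "\<bar>e \<theta>\<bar> powr p * sin \<theta> \<le> E2 \<theta> powr p * sin \<theta>"
        using \<theta> \<alpha> by (intro mult_right_mono sin_ge_zero) auto
    qed
    have split3: "integral {0..pi} g = integral {0..\<alpha>} g + integral {\<alpha>..pi - \<alpha>} g + integral {pi - \<alpha>..pi} g"
      if "\<And>x y. g integrable_on {x..y}" for g :: "real \<Rightarrow> real"
      using Henstock_Kurzweil_Integration.integral_combine[OF _ _ that, of 0 \<alpha> "pi - \<alpha>"]
        Henstock_Kurzweil_Integration.integral_combine[OF _ _ that, of 0 "pi - \<alpha>" pi] \<alpha> by simp
    let ?B = "(1 / real l) powr (real r * p) * (real N / real l) powr (2 - 2 * p) * X"
    have B1: "integral {0..\<alpha>} (\<lambda>\<theta>. y1 \<theta> powr p * sin \<theta>) \<le> 4608 powr (1 - p) * ?B"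
      using end_integral_le[OF p l(1) r \<alpha> N N1] by (simp add: y1_def w1_def R_def X_def mult_ac)
    have B3: "integral {pi - \<alpha>..pi} (\<lambda>\<theta>. y3 \<theta> powr p * sin \<theta>) \<le> 4608 powr (1 - p) * ?B"
      using other_end_integral_le[OF p l(1) r \<alpha> N N1] by (simp add: y3_def w3_def R_def X_def mult_ac)
    have B2: "integral {0..pi} (\<lambda>\<theta>. E2 \<theta> powr p * sin \<theta>) \<le> CM * ?B"
    proof -
      have "integral {0..pi} (\<lambda>\<theta>. E2 \<theta> powr p * sin \<theta>) = integral {0..pi} (\<lambda>\<theta>. K1 powr p * (integral {-pi..pi} (U \<theta>) powr p * sin \<theta>))"
        by (simp add: E2_def powr_mult mult.assoc)
      also have "\<dots> = K1 powr p * integral {0..pi} (\<lambda>\<theta>. integral {-pi..pi} (U \<theta>) powr p * sin \<theta>)" by simp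
      also have "\<dots> \<le> K1 powr p * ((24 * (1 + 5 * real a) * real N) powr (1 - p) * (2 powr (real a * p) * 279936) / real l * X)"
        unfolding U_def X_def by (intro mult_left_mono middle_integral_le[OF p a l] N[folded R_def]) auto
      also have "\<dots> = CM * ((1 / real l) powr (real r * p) * (real N / real l) powr (1 - p) * X)"
      proof -
        have h1: "K1 powr p = K0 powr p * (1 / real l) powr ((real r - 1) * p)"
          using l0 r by (simp add: K1_def powr_mult powr_realpow[symmetric] powr_powr of_nat_diff del: powr_realpow)
        have h2: "(24 * (1 + 5 * real a) * real N) powr (1 - p) = (24 * (1 + 5 * real a)) powr (1 - p) * real N powr (1 - p)"
          by (simp add: powr_mult)
        \<comment> \<open>The kernel bound has only \<open>r - 1\<close> factors \<open>1/l\<close>.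
          The missing p-th power is split off from the factor \<open>1/l\<close> of the integrated
          kernel, whose remaining part \<open>(1/l)^(1-p)\<close> joins
          \<open>N^(1-p)\<close>.\<close>
        have h3: "(1 / real l) powr ((real r - 1) * p) * real N powr (1 - p) / real l = (1 / real l) powr (real r * p) * (real N / real l) powr (1 - p)"
        proof -
          have "(1 / real l) powr (real r * p) * (real N / real l) powr (1 - p) = (1 / real l) powr (real r * p) * (1 / real l) powr (1 - p) * real N powr (1 - p)"
            using powr_mult[of "real N" "1 / real l" "1 - p"] by simp
          also have "(1 / real l) powr (real r * p) * (1 / real l) powr (1 - p) = (1 / real l) powr ((real r - 1) * p) * (1 / real l) powr 1"
            unfolding powr_add[symmetric] by (simp add: algebra_simps)
          finally show ?thesis using l0 by simp
        qed
        have "K1 powr p * ((24 * (1 + 5 * real a) * real N) powr (1 - p) * (2 powr (real a * p) * 279936) / real l * X)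
            = CM * ((1 / real l) powr ((real r - 1) * p) * real N powr (1 - p) / real l * X)"
          unfolding h1 h2 CM_def by (simp only: times_divide_eq_left times_divide_eq_right mult_ac)
        then show ?thesis unfolding h3 .
      qed
      \<comment> \<open>Because \<open>N/l \<ge> 1\<close>, the exponent \<open>1 - p\<close> may be
        raised to that of the end arcs.\<close>
      also have "\<dots> \<le> CM * ?B"
      proof (intro mult_left_mono mult_right_mono C0 X0)
        have "1 \<le> real N / real l" using l l0 by simp
        then show "(real N / real l) powr (1 - p) \<le> (real N / real l) powr (2 - 2 * p)" using p by (intro powr_mono) auto
      qed auto
      finally show ?thesis .
    qed
    have "integral {0..pi} (\<lambda>\<theta>. \<bar>e \<theta>\<bar> powr p * sin \<theta>) \<le> CM * ?B + 4608 powr (1 - p) * ?B + 4608 powr (1 - p) * ?B"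
      using A1 A2 A3 B1 B2 B3 split3[OF Ie] split3[OF I2] by linarith
    also have "\<dots> = C * ?B" by (simp add: C_def algebra_simps)
    finally show ?thesis using degP by (intro exI[of _ P]) (simp add: e_def X_def R_def mult.assoc)
  qed
  then show ?thesis using C0(1) by blast
qed

text \<open>The p-th power of \<open>Lp_norm\<close>: for \<open>p \<le> 1\<close> it is subadditive
  on integrable functions, so it replaces the quasi-norm in the estimates.\<close>

definition Lp_mass :: "real \<Rightarrow> (real \<Rightarrow> real) \<Rightarrow> real" where
  "Lp_mass p u = (LINT x:{-1..1}|lebesgue. \<bar>u x\<bar> powr p)"

lemma Lp_mass_continuous:
  assumes "continuous_on {-1..1} u" "0 < p"
  shows "Lp_mass p u = integral {0..pi} (\<lambda>t. \<bar>u (cos t)\<bar> powr p * sin t)"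
proof -
  let ?h = "\<lambda>x. \<bar>u x\<bar> powr p"
  have c: "continuous_on {-1..1} ?h" using assms by (rule continuous_on_abs_powr)
  have "Lp_mass p u = integral {-1..1} ?h"
    unfolding Lp_mass_def by (rule set_lebesgue_integral_eq_integral(2)[OF absolutely_integrable_continuous_real[OF c]])
  \<comment> \<open>The reflection lets the substitution be made with the increasing function
    \<open>-cos\<close>.\<close>
  also have "\<dots> = integral {-1..- (-1)} (\<lambda>y. ?h (- y))"
    by (rule Henstock_Kurzweil_Integration.integral_reflect_real[symmetric])
  also have "\<dots> = integral {0..pi} (\<lambda>t. \<bar>u (cos t)\<bar> powr p * sin t)"
  proof -
    have c': "continuous_on {-1..1} (\<lambda>y. ?h (- y))"
      by (rule continuous_on_compose2[OF c]) (auto intro!: continuous_intros)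
    have "((\<lambda>t. sin t *\<^sub>R ?h (- (- cos t))) has_integral integral {- cos 0..- cos pi} (\<lambda>y. ?h (- y))) {0..pi}"
    proof (rule has_integral_substitution[OF _ _ _ c'])
      show "((\<lambda>t. - cos t) has_real_derivative sin t) (at t within {0..pi})" for t
        by (auto intro!: derivative_eq_intros)
    qed (auto simp: cos_ge_minus_one cos_le_one)
    then show ?thesis by (simp add: integral_unique mult.commute)
  qed
  finally show ?thesis .
qed

lemma phi_cos: "t \<in> {0..pi} \<Longrightarrow> phi (cos t) = sin t"
  using sin_ge_zero[of t] by (simp add: phi_def sin_squared_eq[symmetric])

lemma continuous_on_phi [continuous_intros]: "continuous_on S g \<Longrightarrow> continuous_on S (\<lambda>x. phi (g x))"
  unfolding phi_def by (intro continuous_intros)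

lemma trig_mass_eq_Lp_mass:
  assumes "0 < p" shows "trig_mass p r R = Lp_mass p (\<lambda>x. phi x ^ r * poly R x)"
proof -
  have "Lp_mass p (\<lambda>x. phi x ^ r * poly R x) = integral {0..pi} (\<lambda>t. \<bar>phi (cos t) ^ r * poly R (cos t)\<bar> powr p * sin t)"
    using assms by (intro Lp_mass_continuous continuous_intros)
  also have "\<dots> = trig_mass p r R"
    unfolding trig_mass_def trig_weighted_def by (rule integral_cong) (simp add: phi_cos)
  finally show ?thesis by simp
qed

lemma weighted_Nikolskii:
  assumes p: "0 < p" "p < 1" and N: "degree R + r \<le> N" "N \<ge> 1"
  shows "Lp_mass 1 (\<lambda>x. phi x ^ r * poly R x) powr p \<le> (4608 * (real N)\<^sup>2) powr (1 - p) * Lp_mass p (\<lambda>x. phi x ^ r * poly R x)"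
proof -
  have "Lp_mass 1 (\<lambda>x. phi x ^ r * poly R x) = integral {0..pi} (\<lambda>t. \<bar>trig_weighted r R t\<bar> * sin t)"
    using trig_mass_eq_Lp_mass[of 1 r R] by (simp add: trig_mass_def)
  then show ?thesis using trig_weighted_Nikolskii[OF p N] trig_mass_eq_Lp_mass[OF p(1), of r R] by simp
qed

text \<open>For given \<open>n\<close> the parameter \<open>l\<close> is as large as the degree
  bound permits, and \<open>n \<le> s l\<close> then converts powers of \<open>1/l\<close> into
  powers of \<open>1/n\<close>. The exponent \<open>a\<close> is fixed by \<open>p\<close> through
  \<open>a p \<ge> 2\<close>.\<close>

lemma poly_approximation:
  assumes p: "0 < p" "p < 1" and r: "r \<ge> 1"
  shows "\<exists>C\<ge>0. \<forall>n N F. r \<le> n \<longrightarrow> n \<le> N \<longrightarrow> degree ((pderiv ^^ r) F) + r \<le> N \<longrightarrow>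
    (\<exists>P. degree P \<le> n \<and> Lp_mass p (poly (F - P))
        \<le> C / real n powr (real r * p) * (real N / real n) powr (2 - 2 * p) * Lp_mass p (\<lambda>x. phi x ^ r * poly ((pderiv ^^ r) F) x))"
proof -
  obtain a :: nat where "real a \<ge> 2 / p" using real_arch_simple by blast
  then have a: "real a * p \<ge> 2" using p by (simp add: field_simps)
  then have a1: "a \<ge> 1" by (cases a) auto
  obtain C where C: "C \<ge> 0" "\<And>l N F. 1 \<le> l \<Longrightarrow> l \<le> N \<Longrightarrow> degree ((pderiv ^^ r) F) + r \<le> N \<Longrightarrow>
    (\<exists>P. degree P \<le> (r - 1) + (a + r) * (l - 1) \<and>
      integral {0..pi} (\<lambda>\<theta>. \<bar>poly (F - P) (cos \<theta>)\<bar> powr p * sin \<theta>)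
        \<le> C * (1 / real l) powr (real r * p) * (real N / real l) powr (2 - 2 * p) * trig_mass p r ((pderiv ^^ r) F))"
    using poly_approximation_trig[OF p a r] by blast
  define s where "s = a + 2 * r"
  define C' where "C' = C * (real s powr (real r * p) * real s powr (2 - 2 * p))"
  have "\<exists>P. degree P \<le> n \<and> Lp_mass p (poly (F - P))
        \<le> C' / real n powr (real r * p) * (real N / real n) powr (2 - 2 * p) * Lp_mass p (\<lambda>x. phi x ^ r * poly ((pderiv ^^ r) F) x)"
    if n: "r \<le> n" "n \<le> N" and F: "degree ((pderiv ^^ r) F) + r \<le> N" for n N F
  proof -
    \<comment> \<open>The integer part makes \<open>(r - 1) + (a + r) (l - 1)\<close> at most
      \<open>n\<close>; since \<open>a + r \<ge> 2\<close>, also \<open>l \<le> n\<close>.\<close>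
    define l where "l = (n - (r - 1)) div (a + r) + 1"
    have n1: "n \<ge> 1" using n r by simp
    have s2: "a + r \<ge> 2" using a1 r by simp
    have lm: "(a + r) * (l - 1) \<le> n - (r - 1)" by (simp add: l_def)
    have "l - 1 \<le> n div 2"
    proof -
      have "(n - (r - 1)) div (a + r) \<le> n div (a + r)" by (intro div_le_mono) simp
      also have "\<dots> \<le> n div 2" using s2 by (intro div_le_mono2) auto
      finally show ?thesis by (simp add: l_def)
    qed
    then have ln: "l \<le> n" using n1 by linarith
    have l1: "l \<ge> 1" by (simp add: l_def)
    have "n - (r - 1) < (a + r) * l"
      using dividend_less_div_times[of "a + r" "n - (r - 1)"] s2 r by (simp add: l_def algebra_simps)
    then have "n \<le> (a + r) * l + r * l" 
    proof -
      have "r * 1 \<le> r * l" using l1 by (rule mult_le_mono2)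
      then show ?thesis using \<open>n - (r - 1) < (a + r) * l\<close> by linarith
    qed
    then have nsl: "n \<le> s * l" by (simp add: s_def algebra_simps)
    obtain P where P: "degree P \<le> (r - 1) + (a + r) * (l - 1)"
      "integral {0..pi} (\<lambda>\<theta>. \<bar>poly (F - P) (cos \<theta>)\<bar> powr p * sin \<theta>)
        \<le> C * (1 / real l) powr (real r * p) * (real N / real l) powr (2 - 2 * p) * trig_mass p r ((pderiv ^^ r) F)"
      using C(2)[OF l1 _ F] ln n by auto
    have "degree P \<le> n" using P(1) lm n(1) r by linarith
    moreover have "Lp_mass p (poly (F - P)) \<le> C' / real n powr (real r * p) * (real N / real n) powr (2 - 2 * p) * trig_mass p r ((pderiv ^^ r) F)"
    proof -
      have sl: "1 / real l \<le> real s * (1 / real n)"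
        using nsl l1 n1 by (simp add: field_simps) (metis of_nat_le_iff of_nat_mult mult.commute)
      have 1: "(1 / real l) powr (real r * p) \<le> real s powr (real r * p) * (1 / real n) powr (real r * p)"
        unfolding powr_mult[symmetric] using sl p by (intro powr_mono2) auto
      have 2: "(real N / real l) powr (2 - 2 * p) \<le> real s powr (2 - 2 * p) * (real N / real n) powr (2 - 2 * p)"
        unfolding powr_mult[symmetric] using mult_left_mono[OF sl, of "real N"] p by (intro powr_mono2) (auto simp: mult_ac)
      have "Lp_mass p (poly (F - P)) = integral {0..pi} (\<lambda>\<theta>. \<bar>poly (F - P) (cos \<theta>)\<bar> powr p * sin \<theta>)"
        using p by (intro Lp_mass_continuous) (auto intro!: continuous_intros)
      also have "\<dots> \<le> C * (1 / real l) powr (real r * p) * (real N / real l) powr (2 - 2 * p) * trig_mass p r ((pderiv ^^ r) F)"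
        by (rule P(2))
      also have "\<dots> \<le> C * (real s powr (real r * p) * (1 / real n) powr (real r * p)) * (real s powr (2 - 2 * p) * (real N / real n) powr (2 - 2 * p)) * trig_mass p r ((pderiv ^^ r) F)"
        by (intro mult_right_mono mult_mono mult_left_mono 1 2 C(1) mult_nonneg_nonneg trig_mass_nonneg p(1)) auto
      also have "(1 / real n) powr (real r * p) = 1 / real n powr (real r * p)" using n1 by (simp add: powr_divide)
      finally show ?thesis by (simp add: C'_def mult_ac del: poly_diff)
    qed
    ultimately show ?thesis using trig_mass_eq_Lp_mass[OF p(1)] by (intro exI[of _ P]) simp
  qed
  moreover have "C' \<ge> 0" using C(1) by (simp add: C'_def)
  ultimately show ?thesis by blast
qed

text \<open>The prescribed constant term serves to make differences vanish at \<open>0\<close>, and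
  the coefficient formula gives degree bounds that remain meaningful for the zero
  polynomial.\<close>

lemma poly_antiderivative:
  fixes T :: "real poly"
  obtains A where "pderiv A = T" "coeff A 0 = c" "degree A \<le> Suc (degree T)"
    "\<And>i. coeff A (Suc i) = coeff T i / real (Suc i)"
proof -
  define B where "B = Abs_poly (\<lambda>i. coeff T i / real (Suc i))"
  have B: "coeff B i = coeff T i / real (Suc i)" for i
    unfolding B_def by (subst coeff_Abs_poly[of "degree T"]) (auto simp: coeff_eq_0)
  have "degree B \<le> degree T" by (rule degree_le) (simp add: B coeff_eq_0)
  then have "degree (pCons c B) \<le> Suc (degree T)" by (intro order_trans[OF degree_pCons_le]) simp
  moreover have "pderiv (pCons c B) = T" by (intro poly_eqI) (simp add: coeff_pderiv B del: of_nat_Suc)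
  ultimately show ?thesis using B that[of "pCons c B"] by simp
qed

lemma poly_iterated_antiderivative:
  fixes Q :: "real poly"
  shows "\<exists>G. (pderiv ^^ r) G = Q \<and> degree G \<le> degree Q + r"
proof (induction r)
  case (Suc r)
  then obtain G where G: "(pderiv ^^ r) G = Q" "degree G \<le> degree Q + r" by blast
  obtain A where A: "pderiv A = G" "degree A \<le> Suc (degree G)" using poly_antiderivative[of G 0] by blast
  have "(pderiv ^^ Suc r) A = Q" using A(1) G(1) by (simp only: funpow_Suc_right o_apply)
  then show ?case using A(2) G(2) by (intro exI[of _ A]) auto
qed (rule exI[of _ Q], simp)

section \<open>Taylor remainders in weighted spaces\<close>

lemma measurable_integrable_on_indicator:
  fixes v :: "real \<Rightarrow> real"
  assumes "v integrable_on {a..b}"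
  shows "(\<lambda>t. indicator {a..b} t * v t) \<in> borel_measurable lebesgue"
  using integrable_imp_measurable[OF assms] borel_measurable_restrict_space_iff[of "{a..b}" lebesgue v]
  by simp

text \<open>If \<open>v\<close> is integrable in the gauge sense but not absolutely, the right side
  is infinite.\<close>

lemma has_integral_abs_le_nn_integral:
  fixes v :: "real \<Rightarrow> real"
  assumes v: "(v has_integral I) {a..b}"
  shows "ennreal \<bar>I\<bar> \<le> (\<integral>\<^sup>+t. ennreal \<bar>v t\<bar> * indicator {a..b} t \<partial>lebesgue)"
proof -
  let ?w = "\<lambda>t. indicator {a..b} t * v t"
  have m: "?w \<in> borel_measurable lebesgue" using v by (intro measurable_integrable_on_indicator) (auto simp: integrable_on_def)
  have eq: "(\<integral>\<^sup>+t. ennreal \<bar>v t\<bar> * indicator {a..b} t \<partial>lebesgue) = (\<integral>\<^sup>+t. ennreal (norm (?w t)) \<partial>lebesgue)"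
    by (intro nn_integral_cong) (auto simp: indicator_def)
  show ?thesis
  proof (cases "(\<integral>\<^sup>+t. ennreal (norm (?w t)) \<partial>lebesgue) < \<infinity>")
    case True
    then have i: "integrable lebesgue ?w" using m by (intro integrableI_bounded)
    then have s: "set_integrable lebesgue {a..b} v" by (simp add: set_integrable_def)
    have "integral\<^sup>L lebesgue ?w = I"
      using set_lebesgue_integral_eq_integral(2)[OF s] v by (simp add: set_lebesgue_integral_def integral_unique)
    then show ?thesis using integral_norm_bound_ennreal[OF i] eq by simp
  next
    case False
    then have "(\<integral>\<^sup>+t. ennreal (norm (?w t)) \<partial>lebesgue) = \<infinity>" by (simp add: not_less top_unique)
    then show ?thesis unfolding eq by simp
  qed
qed

text \<open>\<open>u x\<close> is the integral of \<open>v\<close> from \<open>0\<close> to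
  \<open>x\<close>. After exchanging the integrals, \<open>t\<close> is met only by the
  \<open>x\<close> between \<open>t\<close> and the end point on its side: an interval of length
  \<open>1 - |t|\<close>, on which \<open>(1 - |x|)^k \<le> (1 - |t|)^k\<close>.\<close>

lemma Hardy_step:
  fixes u v :: "real \<Rightarrow> real"
  assumes H: "\<And>x y. -1 \<le> x \<Longrightarrow> x \<le> y \<Longrightarrow> y \<le> 1 \<Longrightarrow> (v has_integral (u y - u x)) {x..y}" and u0: "u 0 = 0"
  shows "(\<integral>\<^sup>+x. ennreal ((1 - \<bar>x\<bar>) ^ k * \<bar>u x\<bar>) * indicator {-1..1} x \<partial>lebesgue)
    \<le> (\<integral>\<^sup>+t. ennreal ((1 - \<bar>t\<bar>) ^ Suc k * \<bar>v t\<bar>) * indicator {-1..1} t \<partial>lebesgue)"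
proof -
  have "(\<lambda>t. indicator {-1..1} t * v t) \<in> borel_measurable lebesgue"
    using H[of "-1" 1] by (intro measurable_integrable_on_indicator) (auto simp: integrable_on_def)
  \<comment> \<open>Fubini's theorem is applied to \<open>lborel\<close>, hence the Borel function
    that equals \<open>v\<close> almost everywhere on \<open>[-1, 1]\<close>.\<close>
  then obtain w where w[measurable]: "w \<in> borel_measurable lborel" and AE: "AE t in lborel. indicator {-1..1} t * v t = w t"
    using completion_ex_borel_measurable_real by blast
  define B where "B = (\<lambda>x t :: real. indicator {min 0 x..max 0 x} t :: ennreal)"
  define c where "c = (\<lambda>x :: real. ennreal ((1 - \<bar>x\<bar>) ^ k) * indicator {-1..1} x)"
  have cm[measurable]: "c \<in> borel_measurable borel" unfolding c_def by measurable
  have Bm: "(\<lambda>(x, t). B x t) \<in> borel_measurable (borel \<Otimes>\<^sub>M borel)"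
  proof -
    have "(\<lambda>(x, t). B x t) = (\<lambda>z. indicator {z. min 0 (fst z) \<le> snd z \<and> snd z \<le> max 0 (fst z)} z)"
      by (auto simp: fun_eq_iff B_def indicator_def)
    then show ?thesis by simp
  qed
  have Bm1[measurable]: "(\<lambda>t. B x t) \<in> borel_measurable borel" "(\<lambda>x. B x t) \<in> borel_measurable borel" for x t
    using measurable_compose[OF measurable_Pair1'[of x borel borel] Bm] measurable_compose[OF measurable_Pair2'[of t borel borel] Bm] by simp_all
  have ux: "ennreal \<bar>u x\<bar> \<le> (\<integral>\<^sup>+t. ennreal \<bar>w t\<bar> * B x t \<partial>lborel)" if x: "x \<in> {-1..1}" for x
  proof -
    have "(v has_integral (u (max 0 x) - u (min 0 x))) {min 0 x..max 0 x}" using x by (intro H) auto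
    from has_integral_abs_le_nn_integral[OF this]
    have "ennreal \<bar>u (max 0 x) - u (min 0 x)\<bar> \<le> (\<integral>\<^sup>+t. ennreal \<bar>v t\<bar> * B x t \<partial>lborel)"
      unfolding B_def nn_integral_completion .
    also have "\<dots> \<le> (\<integral>\<^sup>+t. ennreal \<bar>w t\<bar> * B x t \<partial>lborel)"
    proof (rule nn_integral_mono_AE)
      show "AE t in lborel. ennreal \<bar>v t\<bar> * B x t \<le> ennreal \<bar>w t\<bar> * B x t"
        using AE by eventually_elim (use x in \<open>auto simp: B_def indicator_def min_def max_def of_bool_def split: if_splits\<close>)
    qed
    also have "\<bar>u (max 0 x) - u (min 0 x)\<bar> = \<bar>u x\<bar>" using u0 by (auto simp: max_def min_def)
    finally show ?thesis .
  qed
  have "(\<integral>\<^sup>+x. ennreal ((1 - \<bar>x\<bar>) ^ k * \<bar>u x\<bar>) * indicator {-1..1} x \<partial>lebesgue)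
     = (\<integral>\<^sup>+x. ennreal ((1 - \<bar>x\<bar>) ^ k * \<bar>u x\<bar>) * indicator {-1..1} x \<partial>lborel)" by (rule nn_integral_completion)
  also have "\<dots> \<le> (\<integral>\<^sup>+x. (\<integral>\<^sup>+t. c x * (ennreal \<bar>w t\<bar> * B x t) \<partial>lborel) \<partial>lborel)"
  proof (rule nn_integral_mono)
    fix x :: real
    have "ennreal ((1 - \<bar>x\<bar>) ^ k * \<bar>u x\<bar>) * indicator {-1..1} x \<le> c x * (\<integral>\<^sup>+t. ennreal \<bar>w t\<bar> * B x t \<partial>lborel)"
    proof (cases "x \<in> {-1..1}")
      case True
      then have "0 \<le> (1 - \<bar>x\<bar>) ^ k" by auto
      then have "ennreal ((1 - \<bar>x\<bar>) ^ k * \<bar>u x\<bar>) = ennreal ((1 - \<bar>x\<bar>) ^ k) * ennreal \<bar>u x\<bar>" by (simp add: ennreal_mult)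
      then show ?thesis using True ux[OF True] by (simp add: c_def mult_left_mono)
    qed simp
    also have "\<dots> = (\<integral>\<^sup>+t. c x * (ennreal \<bar>w t\<bar> * B x t) \<partial>lborel)" by (rule nn_integral_cmult[symmetric]) measurable
    finally show "ennreal ((1 - \<bar>x\<bar>) ^ k * \<bar>u x\<bar>) * indicator {-1..1} x \<le> (\<integral>\<^sup>+t. c x * (ennreal \<bar>w t\<bar> * B x t) \<partial>lborel)" .
  qed
  also have "\<dots> = (\<integral>\<^sup>+t. (\<integral>\<^sup>+x. c x * (ennreal \<bar>w t\<bar> * B x t) \<partial>lborel) \<partial>lborel)"
  proof (rule lborel_pair.Fubini'[symmetric])
    have "(\<lambda>z. c (fst z) * (ennreal \<bar>w (snd z)\<bar> * (\<lambda>(x, t). B x t) z)) \<in> borel_measurable (lborel \<Otimes>\<^sub>M lborel)"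
      using Bm by measurable
    then show "(\<lambda>(x, y). c x * (ennreal \<bar>w y\<bar> * B x y)) \<in> borel_measurable (lborel \<Otimes>\<^sub>M lborel)"
      by (simp add: case_prod_unfold)
  qed
  also have "\<dots> \<le> (\<integral>\<^sup>+t. ennreal ((1 - \<bar>t\<bar>) ^ Suc k * \<bar>v t\<bar>) * indicator {-1..1} t \<partial>lborel)"
  proof (rule nn_integral_mono_AE)
    have "AE t in lborel. t \<noteq> (0::real)" by (rule AE_lborel_singleton)
    with AE show "AE t in lborel. (\<integral>\<^sup>+x. c x * (ennreal \<bar>w t\<bar> * B x t) \<partial>lborel) \<le> ennreal ((1 - \<bar>t\<bar>) ^ Suc k * \<bar>v t\<bar>) * indicator {-1..1} t"
    proof eventually_elim
      case (elim t)
      show ?case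
      proof (cases "t \<in> {-1..1}")
        case False
        then have "w t = 0" using elim(1) by simp
        then show ?thesis by simp
      next
        case True
        then have wt: "w t = v t" using elim(1) by simp
        define J where "J = (if t > 0 then {t..1} else {-1..t})"
        have "(\<integral>\<^sup>+x. c x * (ennreal \<bar>w t\<bar> * B x t) \<partial>lborel) = (\<integral>\<^sup>+x. ennreal \<bar>w t\<bar> * (c x * B x t) \<partial>lborel)"
          by (simp add: mult_ac)
        also have "\<dots> = ennreal \<bar>w t\<bar> * (\<integral>\<^sup>+x. c x * B x t \<partial>lborel)" by (rule nn_integral_cmult) measurable
        also have "(\<integral>\<^sup>+x. c x * B x t \<partial>lborel) \<le> (\<integral>\<^sup>+x. ennreal ((1 - \<bar>t\<bar>) ^ k) * indicator J x \<partial>lborel)"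
        proof (rule nn_integral_mono)
          fix x :: real
          show "c x * B x t \<le> ennreal ((1 - \<bar>t\<bar>) ^ k) * indicator J x"
          proof (cases "x \<in> {-1..1} \<and> t \<in> {min 0 x..max 0 x}")
            case in_range: True
            then have "x \<in> J" "\<bar>t\<bar> \<le> \<bar>x\<bar>" using elim(2) by (auto simp: J_def min_def max_def split: if_splits)
            moreover have "(1 - \<bar>x\<bar>) ^ k \<le> (1 - \<bar>t\<bar>) ^ k" using in_range \<open>\<bar>t\<bar> \<le> \<bar>x\<bar>\<close> by (intro power_mono) auto
            ultimately show ?thesis using in_range by (simp add: c_def B_def ennreal_leI)
          qed (auto simp: c_def B_def indicator_def)
        qed
        also have "\<dots> = ennreal ((1 - \<bar>t\<bar>) ^ k) * ennreal (1 - \<bar>t\<bar>)"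
        proof -
          have "J \<in> sets lborel" by (simp add: J_def)
          moreover have "emeasure lborel J = ennreal (1 - \<bar>t\<bar>)" using True by (auto simp: J_def)
          ultimately show ?thesis by (simp add: nn_integral_cmult_indicator)
        qed
        also have "ennreal \<bar>w t\<bar> * \<dots> = ennreal ((1 - \<bar>t\<bar>) ^ Suc k * \<bar>v t\<bar>) * indicator {-1..1} t"
          using True by (simp add: wt ennreal_mult[symmetric] mult_ac abs_le_iff)
        finally show ?thesis by (simp add: mult_left_mono)
      qed
    qed
  qed
  also have "\<dots> = (\<integral>\<^sup>+t. ennreal ((1 - \<bar>t\<bar>) ^ Suc k * \<bar>v t\<bar>) * indicator {-1..1} t \<partial>lebesgue)"
    by (rule nn_integral_completion[symmetric])
  finally show ?thesis .
qed

text \<open>Each step trades one derivative for one power of \<open>1 - |x|\<close>. The polynomial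
  \<open>T\<close> adjusts the values at \<open>0\<close>, as \<open>Hardy_step\<close> demands.
  Vanishing coefficients express its degree so that \<open>r = 0\<close> forces
  \<open>T = 0\<close>.\<close>

lemma Hardy_iterated:
  fixes D :: "nat \<Rightarrow> real \<Rightarrow> real"
  assumes "\<And>j x y. j < r \<Longrightarrow> -1 \<le> x \<Longrightarrow> x \<le> y \<Longrightarrow> y \<le> 1 \<Longrightarrow> (D (Suc j) has_integral (D j y - D j x)) {x..y}"
  shows "\<exists>T. (\<forall>i\<ge>r. coeff T i = 0) \<and>
    (\<integral>\<^sup>+x. ennreal ((1 - \<bar>x\<bar>) ^ k * \<bar>D 0 x - poly T x\<bar>) * indicator {-1..1} x \<partial>lebesgue)
    \<le> (\<integral>\<^sup>+x. ennreal ((1 - \<bar>x\<bar>) ^ (k + r) * \<bar>D r x\<bar>) * indicator {-1..1} x \<partial>lebesgue)"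
  using assms
proof (induction r arbitrary: D k)
  case 0
  show ?case by (rule exI[of _ 0]) simp
next
  case (Suc r)
  obtain T where T: "\<And>i. i \<ge> r \<Longrightarrow> coeff T i = 0"
    "(\<integral>\<^sup>+x. ennreal ((1 - \<bar>x\<bar>) ^ Suc k * \<bar>D 1 x - poly T x\<bar>) * indicator {-1..1} x \<partial>lebesgue)
    \<le> (\<integral>\<^sup>+x. ennreal ((1 - \<bar>x\<bar>) ^ (Suc k + r) * \<bar>D (Suc r) x\<bar>) * indicator {-1..1} x \<partial>lebesgue)"
    using Suc.IH[of "\<lambda>j. D (Suc j)" "Suc k"] Suc.prems by auto
  obtain A where A: "pderiv A = T" "coeff A 0 = D 0 0" "\<And>i. coeff A (Suc i) = coeff T i / real (Suc i)"
    using poly_antiderivative[of T "D 0 0"] by blast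
  have "(\<integral>\<^sup>+x. ennreal ((1 - \<bar>x\<bar>) ^ k * \<bar>D 0 x - poly A x\<bar>) * indicator {-1..1} x \<partial>lebesgue)
     \<le> (\<integral>\<^sup>+x. ennreal ((1 - \<bar>x\<bar>) ^ Suc k * \<bar>D 1 x - poly T x\<bar>) * indicator {-1..1} x \<partial>lebesgue)"
  proof (rule Hardy_step)
    fix x y :: real assume xy: "-1 \<le> x" "x \<le> y" "y \<le> 1"
    have "(D 1 has_integral (D 0 y - D 0 x)) {x..y}" using Suc.prems[of 0 x y] xy by simp
    moreover have "(poly T has_integral (poly A y - poly A x)) {x..y}"
      using xy poly_DERIV[of A]
      by (intro fundamental_theorem_of_calculus)
         (auto simp: A(1) has_real_derivative_iff_has_vector_derivative[symmetric] intro: has_field_derivative_at_within)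
    ultimately have "((\<lambda>t. D 1 t - poly T t) has_integral ((D 0 y - D 0 x) - (poly A y - poly A x))) {x..y}"
      by (rule has_integral_diff)
    then show "((\<lambda>t. D 1 t - poly T t) has_integral (D 0 y - poly A y - (D 0 x - poly A x))) {x..y}"
      by (simp add: algebra_simps)
  qed (simp add: A(2) poly_0_coeff_0)
  moreover have "coeff A i = 0" if "i \<ge> Suc r" for i using that A(3)[of "i - 1"] T(1)[of "i - 1"] by simp
  ultimately show ?case using T(2) by (intro exI[of _ A]) (auto intro: order_trans)
qed

text \<open>Absolute continuity enters only at \<open>j = r - 1\<close>; below that the derivative
  exists everywhere.\<close>

lemma nth_deriv_AC_has_integral:
  assumes f: "nth_deriv_AC (r - 1) f" and j: "j < r" and xy: "-1 \<le> x" "x \<le> y" "y \<le> 1"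
  shows "(nth_deriv (Suc j) f has_integral (nth_deriv j f y - nth_deriv j f x)) {x..y}"
proof (cases "j = r - 1")
  case True
  then have "abs_cont_on {-1..1} (nth_deriv j f)" using f by (simp add: nth_deriv_AC_def)
  from abs_cont_on_vector_derivative_has_integral[OF this xy] show ?thesis by simp
next
  case False
  then have d: "nth_deriv j f differentiable_on {-1..1}" using f j by (simp add: nth_deriv_AC_def)
  show ?thesis
  proof (rule fundamental_theorem_of_calculus[OF xy(2)])
    fix t assume t: "t \<in> {x..y}"
    then have "t \<in> {-1..1}" using xy by auto
    then have "nth_deriv j f differentiable (at t within {-1..1})" using d by (simp add: differentiable_on_def)
    then have "(nth_deriv j f has_vector_derivative nth_deriv (Suc j) f t) (at t within {-1..1})"
      by (simp add: vector_derivative_works)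
    then show "(nth_deriv j f has_vector_derivative nth_deriv (Suc j) f t) (at t within {x..y})"
      by (rule has_vector_derivative_within_subset) (use xy in auto)
  qed
qed

lemma nth_deriv_AC_continuous:
  assumes f: "nth_deriv_AC (r - 1) f" and r: "r \<ge> 1"
  shows "continuous_on {-1..1} f"
proof -
  have H: "(nth_deriv 1 f has_integral (f y - f x)) {x..y}" if "-1 \<le> x" "x \<le> y" "y \<le> 1" for x y
    using nth_deriv_AC_has_integral[OF f, of 0 x y] r that by simp
  have "nth_deriv 1 f integrable_on {-1..1}" using H[of "-1" 1] by (auto simp: integrable_on_def)
  then have "continuous_on {-1..1} (\<lambda>x. f (-1) + integral {-1..x} (nth_deriv 1 f))"
    by (intro continuous_intros indefinite_integral_continuous_1)
  then show ?thesis
    by (rule continuous_on_eq) (use integral_unique[OF H] in auto)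
qed

text \<open>Hardy's inequality has the weight \<open>(1 - |x|)^r\<close>, and
  \<open>1 - |x| \<le> phi x\<close> because \<open>(1 - |x|)^2 \<le> 1 - x^2\<close>. Weighted
  \<open>L_1\<close> closeness of the r-th derivatives thus gives plain \<open>L_1\<close> closeness
  modulo polynomials of degree below \<open>r\<close>.\<close>

lemma weighted_Taylor_remainder:
  assumes f: "nth_deriv_AC (r - 1) f" and r: "r \<ge> 1"
  shows "\<exists>T. degree T \<le> r - 1 \<and>
    (\<integral>\<^sup>+x. ennreal \<bar>f x - poly G x - poly T x\<bar> * indicator {-1..1} x \<partial>lebesgue)
    \<le> (\<integral>\<^sup>+x. ennreal \<bar>phi x ^ r * (nth_deriv r f x - poly ((pderiv ^^ r) G) x)\<bar> * indicator {-1..1} x \<partial>lebesgue)"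
proof -
  define D where "D = (\<lambda>j x. nth_deriv j f x - poly ((pderiv ^^ j) G) x)"
  have "(D (Suc j) has_integral (D j y - D j x)) {x..y}" if j: "j < r" and xy: "-1 \<le> x" "x \<le> y" "y \<le> 1" for j x y
  proof -
    have "(poly ((pderiv ^^ Suc j) G) has_integral (poly ((pderiv ^^ j) G) y - poly ((pderiv ^^ j) G) x)) {x..y}"
      using xy poly_DERIV[of "(pderiv ^^ j) G"]
      by (intro fundamental_theorem_of_calculus)
         (auto simp: has_real_derivative_iff_has_vector_derivative[symmetric] intro: has_field_derivative_at_within)
    from has_integral_diff[OF nth_deriv_AC_has_integral[OF f j xy] this]
    show ?thesis by (simp add: D_def algebra_simps)
  qed
  from Hardy_iterated[of r D, OF this, of 0]
  obtain T where T: "\<And>i. i \<ge> r \<Longrightarrow> coeff T i = 0"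
    "(\<integral>\<^sup>+x. ennreal ((1 - \<bar>x\<bar>) ^ 0 * \<bar>D 0 x - poly T x\<bar>) * indicator {-1..1} x \<partial>lebesgue)
    \<le> (\<integral>\<^sup>+x. ennreal ((1 - \<bar>x\<bar>) ^ (0 + r) * \<bar>D r x\<bar>) * indicator {-1..1} x \<partial>lebesgue)" by blast
  have "degree T \<le> r - 1" by (rule degree_le) (use T(1) in auto)
  moreover have "(\<integral>\<^sup>+x. ennreal ((1 - \<bar>x\<bar>) ^ (0 + r) * \<bar>D r x\<bar>) * indicator {-1..1} x \<partial>lebesgue)
    \<le> (\<integral>\<^sup>+x. ennreal \<bar>phi x ^ r * D r x\<bar> * indicator {-1..1} x \<partial>lebesgue)"
  proof (rule nn_integral_mono)
    fix x :: real
    show "ennreal ((1 - \<bar>x\<bar>) ^ (0 + r) * \<bar>D r x\<bar>) * indicator {-1..1} x \<le> ennreal \<bar>phi x ^ r * D r x\<bar> * indicator {-1..1} x"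
    proof (cases "x \<in> {-1..1}")
      case True
      then have x: "\<bar>x\<bar> \<le> 1" by auto
      have "(1 - \<bar>x\<bar>)\<^sup>2 \<le> (1 - \<bar>x\<bar>) * (1 + \<bar>x\<bar>)" unfolding power2_eq_square using x by (intro mult_left_mono) auto
      also have "\<dots> = 1 - x\<^sup>2" by (simp add: algebra_simps power2_eq_square)
      finally have "1 - \<bar>x\<bar> \<le> phi x" unfolding phi_def by (rule real_le_rsqrt)
      then have "(1 - \<bar>x\<bar>) ^ r \<le> phi x ^ r" using x by (intro power_mono) auto
      then have "(1 - \<bar>x\<bar>) ^ r * \<bar>D r x\<bar> \<le> \<bar>phi x ^ r\<bar> * \<bar>D r x\<bar>" by (intro mult_right_mono) auto
      then show ?thesis using True by (simp add: abs_mult ennreal_leI)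
    qed simp
  qed
  ultimately show ?thesis using T(2) by (intro exI[of _ T]) (auto simp: D_def intro: order_trans)
qed

section \<open>Best approximation\<close>

lemma Lp_mass_lebesgue_on: "Lp_mass p u = integral\<^sup>L (lebesgue_on {-1..1}) (\<lambda>x. \<bar>u x\<bar> powr p)"
  unfolding Lp_mass_def set_lebesgue_integral_def by (subst integral_restrict_space) auto

lemma finite_measure_unit: "finite_measure (lebesgue_on {-1..1::real})"
  by (rule finite_measure_lebesgue_on) simp

text \<open>\<open>|u|^p \<le> 1 + |u|\<close> on a set of finite measure. This keeps
  \<open>Lp_mass\<close> away from the default value \<open>0\<close> of the Bochner
  integral.\<close>

lemma integrable_abs_powr:
  fixes u :: "real \<Rightarrow> real"
  assumes u: "integrable (lebesgue_on {-1..1}) u" and p: "0 < p" "p \<le> 1"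
  shows "integrable (lebesgue_on {-1..1::real}) (\<lambda>x. \<bar>u x\<bar> powr p)"
proof (rule Bochner_Integration.integrable_bound)
  show "integrable (lebesgue_on {-1..1}) (\<lambda>x. 1 + \<bar>u x\<bar>)"
    using u finite_measure.integrable_const[OF finite_measure_unit] by (intro Bochner_Integration.integrable_add Bochner_Integration.integrable_abs) auto
  show "(\<lambda>x. \<bar>u x\<bar> powr p) \<in> borel_measurable (lebesgue_on {-1..1})" using u by measurable
  have "\<bar>u x\<bar> powr p \<le> 1 + \<bar>u x\<bar>" for x
  proof (cases "\<bar>u x\<bar> \<le> 1")
    case True
    then have "\<bar>u x\<bar> powr p \<le> 1" using p by (intro powr_le1) auto
    then show ?thesis by linarith
  next
    case False
    then have "\<bar>u x\<bar> powr p \<le> \<bar>u x\<bar> powr 1" using p by (intro powr_mono) auto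
    then show ?thesis by simp
  qed
  then show "AE x in lebesgue_on {-1..1}. norm (\<bar>u x\<bar> powr p) \<le> norm (1 + \<bar>u x\<bar>)" by auto
qed

lemma Lp_mass_nonneg: "0 \<le> Lp_mass p u"
  unfolding Lp_mass_lebesgue_on by (intro integral_nonneg_AE) auto

lemma nn_integral_Lp_mass:
  assumes "integrable (lebesgue_on {-1..1}) u" "0 < p" "p \<le> 1"
  shows "(\<integral>\<^sup>+x. ennreal (\<bar>u x\<bar> powr p) \<partial>lebesgue_on {-1..1}) = ennreal (Lp_mass p u)"
  unfolding Lp_mass_lebesgue_on by (intro nn_integral_eq_integral integrable_abs_powr assms) auto

lemma Lp_mass_add:
  assumes "integrable (lebesgue_on {-1..1}) u" "integrable (lebesgue_on {-1..1}) v" and p: "0 < p" "p \<le> 1"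
  shows "Lp_mass p (\<lambda>x. u x + v x) \<le> Lp_mass p u + Lp_mass p v"
proof -
  have "Lp_mass p (\<lambda>x. u x + v x) \<le> integral\<^sup>L (lebesgue_on {-1..1}) (\<lambda>x. \<bar>u x\<bar> powr p + \<bar>v x\<bar> powr p)"
    unfolding Lp_mass_lebesgue_on
  proof (rule integral_mono)
    show "\<bar>u x + v x\<bar> powr p \<le> \<bar>u x\<bar> powr p + \<bar>v x\<bar> powr p" for x
    proof -
      have "\<bar>u x + v x\<bar> powr p \<le> (\<bar>u x\<bar> + \<bar>v x\<bar>) powr p" using p by (intro powr_mono2) auto
      also have "\<dots> \<le> \<bar>u x\<bar> powr p + \<bar>v x\<bar> powr p" using p by (intro powr_add_le) auto
      finally show ?thesis .
    qed
  qed (use assms in \<open>auto intro!: integrable_abs_powr\<close>)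
  then show ?thesis using assms by (simp add: Lp_mass_lebesgue_on integrable_abs_powr)
qed

lemma Lp_mass_sum:
  assumes "\<And>k. k < (K::nat) \<Longrightarrow> integrable (lebesgue_on {-1..1}) (u k)" and p: "0 < p" "p \<le> 1"
  shows "Lp_mass p (\<lambda>x. \<Sum>k<K. u k x) \<le> (\<Sum>k<K. Lp_mass p (u k))"
  using assms(1)
proof (induction K)
  case 0
  show ?case by (simp add: Lp_mass_def set_lebesgue_integral_def)
next
  case (Suc K)
  have "Lp_mass p (\<lambda>x. (\<Sum>k<K. u k x) + u K x) \<le> Lp_mass p (\<lambda>x. \<Sum>k<K. u k x) + Lp_mass p (u K)"
    using Suc.prems by (intro Lp_mass_add p) auto
  then show ?case using Suc by simp
qed

lemma Lp_mass_minus: "Lp_mass p (\<lambda>x. - u x) = Lp_mass p u"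
  by (simp add: Lp_mass_def)

text \<open>Jensen's inequality on an interval of length \<open>2\<close>.\<close>

lemma Lp_mass_le_L1:
  assumes u: "integrable (lebesgue_on {-1..1}) u" and p: "0 < p" "p < 1"
  shows "Lp_mass p u \<le> 2 * Lp_mass 1 u powr p"
proof -
  have S: "{-1..1::real} \<in> sets lebesgue" by simp
  have i1: "integrable (lebesgue_on {-1..1}) (\<lambda>x. \<bar>u x\<bar>)" using u by simp
  have ip: "integrable (lebesgue_on {-1..1}) (\<lambda>x. \<bar>u x\<bar> powr p)" using u p by (intro integrable_abs_powr) auto
  have e1: "Lp_mass 1 u = integral {-1..1} (\<lambda>x. \<bar>u x\<bar> * 1)"
    using lebesgue_integral_eq_integral[OF i1 S] by (simp add: Lp_mass_lebesgue_on)
  have ep: "Lp_mass p u = integral {-1..1} (\<lambda>x. \<bar>u x\<bar> powr p * 1)"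
    using lebesgue_integral_eq_integral[OF ip S] by (simp add: Lp_mass_lebesgue_on)
  have "Lp_mass p u \<le> 2 powr (1 - p) * Lp_mass 1 u powr p"
    unfolding e1 ep
    using integrable_on_lebesgue_on[OF i1 S] integrable_on_lebesgue_on[OF ip S]
    by (intro integral_powr_Jensen p) auto
  also have "\<dots> \<le> 2 powr 1 * Lp_mass 1 u powr p" using p by (intro mult_right_mono powr_mono) auto
  finally show ?thesis by simp
qed

lemma integrable_continuous_unit: "continuous_on {-1..1} u \<Longrightarrow> integrable (lebesgue_on {-1..1::real}) u" for u :: "real \<Rightarrow> real"
  by (intro continuous_imp_integrable_real)

text \<open>\<open>L\<^sub>p\<close>-convergence of \<open>W\<close> to \<open>h\<close> upgrades to \<open>L\<^sub>1\<close> because the increments of \<open>W\<close> are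
  \<open>L\<^sub>1\<close>-summable: almost everywhere \<open>\<bar>h - W\<^sub>K\<bar>\<close> is at most the sum of the later increments.\<close>

lemma L1_limit_of_Lp_limit:
  fixes h :: "real \<Rightarrow> real" and W :: "nat \<Rightarrow> real \<Rightarrow> real"
  assumes p: "0 < p" "p < 1" and h: "integrable (lebesgue_on {-1..1}) h" and W: "\<And>k. integrable (lebesgue_on {-1..1}) (W k)"
    and lim: "(\<lambda>k. Lp_mass p (\<lambda>x. h x - W k x)) \<longlonglongrightarrow> 0"
    and c: "summable c" "\<And>k. Lp_mass 1 (\<lambda>x. W (Suc k) x - W k x) \<le> c k"
  shows "(\<lambda>k. Lp_mass 1 (\<lambda>x. h x - W k x)) \<longlonglongrightarrow> 0"
proof -
  let ?M = "lebesgue_on {-1..1::real}"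
  have c0: "c k \<ge> 0" for k using c(2)[of k] Lp_mass_nonneg[of 1 "\<lambda>x. W (Suc k) x - W k x"] by linarith
  have hW: "integrable ?M (\<lambda>x. h x - W k x)" for k using h W by simp
  have WW: "integrable ?M (\<lambda>x. W (Suc k) x - W k x)" for k using W by simp
  have [measurable]: "h \<in> borel_measurable ?M" "W k \<in> borel_measurable ?M" for k using h W by (auto intro: borel_measurable_integrable)
  have bound: "Lp_mass 1 (\<lambda>x. h x - W K x) \<le> (\<Sum>k. c (k + K))" for K
  proof -
    define Z where "Z = (\<lambda>x. \<Sum>k. ennreal \<bar>W (Suc (k + K)) x - W (k + K) x\<bar>)"
    \<comment> \<open>\<open>L_p\<close> convergence makes the integral of \<open>Y\<close> vanish,
      so for almost every \<open>x\<close> the values \<open>W j x\<close> come arbitrarily close to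
      \<open>h x\<close> for suitable \<open>j\<close>.\<close>
    define Y where "Y = (\<lambda>x. INF j. ennreal (\<bar>h x - W (j + K) x\<bar> powr p))"
    have Ym[measurable]: "Y \<in> borel_measurable ?M" unfolding Y_def by measurable
    have "(\<integral>\<^sup>+x. Y x \<partial>?M) \<le> ennreal (Lp_mass p (\<lambda>x. h x - W (j + K) x))" for j
    proof -
      have "(\<integral>\<^sup>+x. Y x \<partial>?M) \<le> (\<integral>\<^sup>+x. ennreal (\<bar>h x - W (j + K) x\<bar> powr p) \<partial>?M)"
        by (intro nn_integral_mono) (auto simp: Y_def intro: INF_lower)
      also have "\<dots> = ennreal (Lp_mass p (\<lambda>x. h x - W (j + K) x))" using hW p by (intro nn_integral_Lp_mass) auto
      finally show ?thesis .
    qed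
    moreover have "(\<lambda>j. ennreal (Lp_mass p (\<lambda>x. h x - W (j + K) x))) \<longlonglongrightarrow> ennreal 0"
      using LIMSEQ_ignore_initial_segment[OF lim, of K] by (intro tendsto_ennrealI)
    ultimately have "(\<integral>\<^sup>+x. Y x \<partial>?M) \<le> ennreal 0" by (intro LIMSEQ_le_const) auto
    then have "(\<integral>\<^sup>+x. Y x \<partial>?M) = 0" by simp
    then have AE0: "AE x in ?M. Y x = 0" by (simp add: nn_integral_0_iff_AE)
    have pt: "ennreal \<bar>h x - W K x\<bar> \<le> Z x" if "Y x = 0" for x
    proof (rule ennreal_le_epsilon)
      fix e :: real assume e: "e > 0"
      have "Y x < ennreal (e powr p)" using that e by simp
      then obtain j where "ennreal (\<bar>h x - W (j + K) x\<bar> powr p) < ennreal (e powr p)"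
        unfolding Y_def by (auto simp: INF_less_iff)
      then have "\<bar>h x - W (j + K) x\<bar> powr p < e powr p" by (simp add: ennreal_less_iff)
      then have je: "\<bar>h x - W (j + K) x\<bar> < e" using e p by (meson abs_ge_zero not_le powr_mono2 less_imp_le)
      have tel: "\<bar>h x - W K x\<bar> \<le> \<bar>h x - W (j + K) x\<bar> + (\<Sum>k<j. \<bar>W (Suc (k + K)) x - W (k + K) x\<bar>)"
      proof (induction j)
        case (Suc j) then show ?case by simp
      qed simp
      have "ennreal \<bar>h x - W K x\<bar> \<le> ennreal (e + (\<Sum>k<j. \<bar>W (Suc (k + K)) x - W (k + K) x\<bar>))"
        using tel je by (intro ennreal_leI) linarith
      also have "\<dots> = ennreal e + (\<Sum>k<j. ennreal \<bar>W (Suc (k + K)) x - W (k + K) x\<bar>)"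
        using e by (simp add: ennreal_plus sum_nonneg sum_ennreal)
      also have "(\<Sum>k<j. ennreal \<bar>W (Suc (k + K)) x - W (k + K) x\<bar>) \<le> Z x"
        unfolding Z_def by (intro sum_le_suminf) auto
      finally show "ennreal \<bar>h x - W K x\<bar> \<le> Z x + ennreal e" by (simp add: add.commute add_left_mono)
    qed
    have "ennreal (Lp_mass 1 (\<lambda>x. h x - W K x)) = (\<integral>\<^sup>+x. ennreal \<bar>h x - W K x\<bar> \<partial>?M)"
      using nn_integral_Lp_mass[OF hW, of 1 K] by simp
    also have "\<dots> \<le> (\<integral>\<^sup>+x. Z x \<partial>?M)"
      by (rule nn_integral_mono_AE) (use AE0 in eventually_elim, rule pt)
    also have "\<dots> = (\<Sum>k. \<integral>\<^sup>+x. ennreal \<bar>W (Suc (k + K)) x - W (k + K) x\<bar> \<partial>?M)"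
      unfolding Z_def by (rule nn_integral_suminf) measurable
    also have "\<dots> = (\<Sum>k. ennreal (Lp_mass 1 (\<lambda>x. W (Suc (k + K)) x - W (k + K) x)))"
      using nn_integral_Lp_mass[OF WW, of 1] by simp
    also have "\<dots> \<le> (\<Sum>k. ennreal (c (k + K)))"
      by (intro suminf_le ennreal_leI c(2)) auto
    also have "\<dots> = ennreal (\<Sum>k. c (k + K))"
      using c0 c(1) by (intro suminf_ennreal2) (auto simp: summable_iff_shift)
    finally show ?thesis using c0 c(1) by (subst (asm) ennreal_le_iff) (auto intro!: suminf_nonneg simp: summable_iff_shift)
  qed
  have "(\<lambda>K. suminf c - (\<Sum>k<K. c k)) \<longlonglongrightarrow> suminf c - suminf c"
    by (intro tendsto_intros summable_LIMSEQ c(1))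
  then have t0: "(\<lambda>K. \<Sum>k. c (k + K)) \<longlonglongrightarrow> 0"
    by (simp add: suminf_minus_initial_segment[OF c(1)])
  show ?thesis
    by (rule tendsto_sandwich[OF _ _ tendsto_const t0]) (auto intro!: always_eventually bound Lp_mass_nonneg)
qed

section \<open>Best approximations and dyadic summation\<close>

lemma Lp_norm_eq: "Lp_norm p u = Lp_mass p u powr (1 / p)"
  by (simp add: Lp_norm_def Lp_mass_def)

lemma best_approx_bdd: "bdd_below ((\<lambda>P. Lp_norm p (\<lambda>x. w x * (u x - poly P x))) ` A)"
  by (rule bdd_belowI[of _ 0]) (auto simp: Lp_norm_def)

lemma best_approx_nonneg: "0 \<le> best_approx m u p w"
  unfolding best_approx_def by (rule cINF_greatest) (auto simp: Lp_norm_def intro: exI[of _ 0])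

lemma best_approx_powr_le:
  assumes "0 < p" "degree P \<le> m"
  shows "best_approx m u p w powr p \<le> Lp_mass p (\<lambda>x. w x * (u x - poly P x))"
proof -
  have "best_approx m u p w \<le> Lp_norm p (\<lambda>x. w x * (u x - poly P x))"
    unfolding best_approx_def using assms by (intro cINF_lower best_approx_bdd) simp
  then have "best_approx m u p w powr p \<le> Lp_norm p (\<lambda>x. w x * (u x - poly P x)) powr p"
    using assms by (intro powr_mono2 best_approx_nonneg) auto
  then show ?thesis using assms by (simp add: Lp_norm_eq powr_powr Lp_mass_nonneg)
qed

lemma best_approx_antimono: "m \<le> m' \<Longrightarrow> best_approx m' u p w \<le> best_approx m u p w"
  unfolding best_approx_def by (intro cINF_superset_mono best_approx_bdd) (auto intro: exI[of _ 0])

text \<open>A polynomial within \<open>e^(1/p)\<close> of the infimum of the quasi-norms is within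
  \<open>e\<close> for p-th powers, by subadditivity.\<close>

lemma best_approx_near:
  assumes p: "0 < p" "p \<le> 1" and e: "e > 0"
  shows "\<exists>P. degree P \<le> m \<and> Lp_mass p (\<lambda>x. w x * (u x - poly P x)) \<le> best_approx m u p w powr p + e"
proof -
  define d where "d = e powr (1 / p)"
  have d: "d > 0" using e by (simp add: d_def)
  let ?S = "{P :: real poly. degree P \<le> m}"
  have "\<exists>P\<in>?S. Lp_norm p (\<lambda>x. w x * (u x - poly P x)) < best_approx m u p w + d"
  proof (rule ccontr)
    assume "\<not> ?thesis"
    then have "best_approx m u p w + d \<le> best_approx m u p w"
      unfolding best_approx_def by (intro cINF_greatest) (auto simp: not_less intro: exI[of _ 0])
    then show False using d by simp
  qed
  then obtain P where P: "degree P \<le> m" "Lp_norm p (\<lambda>x. w x * (u x - poly P x)) < best_approx m u p w + d" by blast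
  have "Lp_mass p (\<lambda>x. w x * (u x - poly P x)) = Lp_norm p (\<lambda>x. w x * (u x - poly P x)) powr p"
    using p by (simp add: Lp_norm_eq powr_powr Lp_mass_nonneg)
  also have "\<dots> \<le> (best_approx m u p w + d) powr p" using P(2) p by (intro powr_mono2) (auto simp: Lp_norm_def)
  also have "\<dots> \<le> best_approx m u p w powr p + d powr p" using p d by (intro powr_add_le best_approx_nonneg) auto
  also have "d powr p = e" using p e by (simp add: d_def powr_powr)
  finally show ?thesis using P(1) by blast
qed

text \<open>Cauchy condensation: the block from \<open>m + 1\<close> to \<open>2 m\<close> has
  \<open>m\<close> terms, each at least \<open>(2 m)^(1-2p) b (2 m) / 2\<close> by monotonicity, and
  \<open>m (2 m)^(1-2p) / 2 = (2 m)^(2-2p) / 4\<close>.\<close>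

lemma dyadic_sum_le:
  fixes b :: "nat \<Rightarrow> real"
  assumes p: "0 < p" "p < 1" and n: "n \<ge> 1" and b: "\<And>i j. i \<le> j \<Longrightarrow> b j \<le> b i" "\<And>i. 0 \<le> b i"
  shows "(\<Sum>k=1..K. real (2 ^ k * n) powr (2 - 2 * p) * b (2 ^ k * n)) \<le> 4 * (\<Sum>\<nu>\<in>{n+1..2 ^ K * n}. real \<nu> powr (1 - 2 * p) * b \<nu>)"
proof (induction K)
  case (Suc K)
  define m where "m = 2 ^ K * n"
  have m: "m \<ge> n" "m \<ge> 1" using n by (auto simp: m_def)
  have m2: "2 ^ Suc K * n = 2 * m" by (simp add: m_def)
  have "real (2 * m) powr (2 - 2 * p) * b (2 * m) \<le> 4 * (\<Sum>\<nu>\<in>{m+1..2*m}. real \<nu> powr (1 - 2 * p) * b \<nu>)"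
  proof -
    have "(\<Sum>\<nu>\<in>{m+1..2*m}. (1/2) * real (2 * m) powr (1 - 2 * p) * b (2 * m)) \<le> (\<Sum>\<nu>\<in>{m+1..2*m}. real \<nu> powr (1 - 2 * p) * b \<nu>)"
    proof (rule sum_mono)
      fix \<nu> assume \<nu>: "\<nu> \<in> {m+1..2*m}"
      \<comment> \<open>The power does not decrease for \<open>p \<le> 1/2\<close>, where the factor
        \<open>1/2\<close> compensates between \<open>m\<close> and \<open>2 m\<close>; it decreases
        for larger \<open>p\<close>.\<close>
      have "(1/2) * real (2 * m) powr (1 - 2 * p) \<le> real \<nu> powr (1 - 2 * p)"
      proof (cases "1 - 2 * p \<ge> 0")
        case True
        have "1/2 \<le> (1/2::real) powr (1 - 2 * p)" using powr_mono'[of "1 - 2 * p" 1 "1/2"] p by simp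
        then have "(1/2) * real (2 * m) powr (1 - 2 * p) \<le> (1/2) powr (1 - 2 * p) * real (2 * m) powr (1 - 2 * p)"
          by (intro mult_right_mono) auto
        also have "\<dots> = real m powr (1 - 2 * p)" by (simp add: powr_mult[symmetric])
        also have "\<dots> \<le> real \<nu> powr (1 - 2 * p)" using True \<nu> by (intro powr_mono2) auto
        finally show ?thesis .
      next
        case False
        have "(1/2) * real (2 * m) powr (1 - 2 * p) \<le> 1 * real (2 * m) powr (1 - 2 * p)" by (intro mult_right_mono) auto
        also have "\<dots> \<le> 1 * real \<nu> powr (1 - 2 * p)" using False \<nu> m by (intro mult_left_mono powr_mono2') auto
        finally show ?thesis by simp
      qed
      then show "(1/2) * real (2 * m) powr (1 - 2 * p) * b (2 * m) \<le> real \<nu> powr (1 - 2 * p) * b \<nu>"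
        using \<nu> b by (intro mult_mono) auto
    qed
    moreover have "real (2 * m) powr (2 - 2 * p) = real (2 * m) * real (2 * m) powr (1 - 2 * p)"
      using m by (simp add: powr_mult_base)
    ultimately show ?thesis by (simp add: algebra_simps)
  qed
  moreover have "(\<Sum>\<nu>\<in>{n+1..2*m}. real \<nu> powr (1 - 2 * p) * b \<nu>) = (\<Sum>\<nu>\<in>{n+1..m}. real \<nu> powr (1 - 2 * p) * b \<nu>) + (\<Sum>\<nu>\<in>{m+1..2*m}. real \<nu> powr (1 - 2 * p) * b \<nu>)"
  proof -
    have "{n+1..2*m} = {n+1..m} \<union> {m+1..2*m}" using m by auto
    then show ?thesis by (simp add: sum.union_disjoint)
  qed
  moreover have "(\<Sum>k=1..Suc K. real (2 ^ k * n) powr (2 - 2 * p) * b (2 ^ k * n)) =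
      (\<Sum>k=1..K. real (2 ^ k * n) powr (2 - 2 * p) * b (2 ^ k * n)) + real (2 * m) powr (2 - 2 * p) * b (2 * m)"
    unfolding m2[symmetric] by (simp del: power_Suc of_nat_mult of_nat_power)
  ultimately show ?case using Suc.IH unfolding m2 m_def[symmetric] by linarith
qed simp

lemma funpow_pderiv_diff:
  fixes p q :: "real poly"
  shows "(pderiv ^^ r) (p - q) = (pderiv ^^ r) p - (pderiv ^^ r) q"
  by (induction r) (simp_all add: pderiv_diff)

text \<open>\<open>f - PP\<close> is split into \<open>u\<close>, the difference between
  \<open>f\<close> and the antiderivative of \<open>Q K\<close> modulo a polynomial of low degree,
  and the telescoped errors of the increments. The latter are bounded uniformly in \<open>K\<close>;
  the former tends to \<open>0\<close> in \<open>L_1\<close> as \<open>K\<close> grows, hence also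
  in \<open>L_p\<close>.\<close>

lemma simultaneous_approximation_step:
  assumes p: "0 < p" "p < 1" and r: "r \<ge> 1" and n: "r \<le> n" and C0: "C0 \<ge> 0"
    and approx: "\<And>N F. n \<le> N \<Longrightarrow> degree ((pderiv ^^ r) F) + r \<le> N \<Longrightarrow>
      \<exists>P. degree P \<le> n \<and> Lp_mass p (poly (F - P))
        \<le> C0 / real n powr (real r * p) * (real N / real n) powr (2 - 2 * p) * Lp_mass p (\<lambda>x. phi x ^ r * poly ((pderiv ^^ r) F) x)"
    and f: "nth_deriv_AC (r - 1) f" and g: "(\<lambda>x. phi x ^ r * nth_deriv r f x) absolutely_integrable_on {-1..1}"
    and Y: "\<And>K. (\<Sum>k\<le>K. 2 powr (real k * (2 - 2 * p)) * Lp_mass p (\<lambda>x. phi x ^ r * (nth_deriv r f x - poly (Q k) x))) \<le> Y"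
    and Q: "\<And>k. degree (Q k) + r \<le> 2 ^ k * n"
  shows "best_approx n f p (\<lambda>_. 1) powr p \<le> C0 / real n powr (real r * p) * (5 * Y)"
proof -
  let ?M = "lebesgue_on {-1..1::real}"
  define N where "N = (\<lambda>k. 2 ^ k * n)"
  define h where "h = (\<lambda>x. phi x ^ r * nth_deriv r f x)"
  define W where "W = (\<lambda>k x. phi x ^ r * poly (Q k) x)"
  define J where "J = (\<lambda>k. 2 powr (real k * (2 - 2 * p)) * Lp_mass p (\<lambda>x. h x - W k x))"
  define R where "R = (\<lambda>k. Q (Suc k) - Q k)"
  define a where "a = (\<lambda>k. 2 powr (real (Suc k) * (2 - 2 * p)) * Lp_mass p (\<lambda>x. phi x ^ r * poly (R k) x))"
  have n1: "n \<ge> 1" using n r by simp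
  have hi: "integrable ?M h" using g by (simp add: h_def integrable_restrict_space set_integrable_def)
  have Wi: "integrable ?M (W k)" for k
    unfolding W_def by (intro integrable_continuous_unit continuous_intros)
  have hW: "integrable ?M (\<lambda>x. h x - W k x)" for k using hi Wi by simp
  have heq: "phi x ^ r * (nth_deriv r f x - poly (Q k) x) = h x - W k x" for k x
    by (simp add: h_def W_def right_diff_distrib)
  have J0: "J k \<ge> 0" for k by (simp add: J_def Lp_mass_nonneg)
  have JY: "(\<Sum>k\<le>K. J k) \<le> Y" for K using Y[of K] by (simp add: J_def heq)
  have a0: "a k \<ge> 0" for k by (simp add: a_def Lp_mass_nonneg)
  \<comment> \<open>\<open>4\<close> bounds \<open>2^(2-2p)\<close>, the ratio of consecutive
    weights.\<close>
  have ak: "a k \<le> 4 * J k + J (Suc k)" for k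
  proof -
    have "Lp_mass p (\<lambda>x. phi x ^ r * poly (R k) x) = Lp_mass p (\<lambda>x. (h x - W k x) + - (h x - W (Suc k) x))"
      by (simp add: R_def W_def right_diff_distrib)
    also have "\<dots> \<le> Lp_mass p (\<lambda>x. h x - W k x) + Lp_mass p (\<lambda>x. - (h x - W (Suc k) x))"
      using p by (intro Lp_mass_add Bochner_Integration.integrable_minus hW) auto
    also have "\<dots> = Lp_mass p (\<lambda>x. h x - W k x) + Lp_mass p (\<lambda>x. h x - W (Suc k) x)" by (simp only: Lp_mass_minus)
    finally have "a k \<le> 2 powr (real (Suc k) * (2 - 2 * p)) * Lp_mass p (\<lambda>x. h x - W k x) + J (Suc k)"
      unfolding a_def J_def distrib_left[symmetric] by (intro mult_left_mono) auto
    also have "2 powr (real (Suc k) * (2 - 2 * p)) = 2 powr (2 - 2 * p) * 2 powr (real k * (2 - 2 * p))"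
      by (simp add: powr_add[symmetric] algebra_simps)
    also have "2 powr (2 - 2 * p) * 2 powr (real k * (2 - 2 * p)) * Lp_mass p (\<lambda>x. h x - W k x) = 2 powr (2 - 2 * p) * J k"
      by (simp add: J_def)
    also have "\<dots> \<le> 2 powr 2 * J k" using p J0 by (intro mult_right_mono powr_mono) auto
    finally show ?thesis by simp
  qed
  have asum: "(\<Sum>k<K. a k) \<le> 5 * Y" for K
  proof -
    have "(\<Sum>k<K. a k) \<le> 4 * (\<Sum>k<K. J k) + (\<Sum>k<K. J (Suc k))"
      unfolding sum_distrib_left sum.distrib[symmetric] by (intro sum_mono ak)
    also have "(\<Sum>k<K. J k) \<le> (\<Sum>k\<le>K. J k)" using J0 by (intro sum_mono2) auto
    also have "(\<Sum>k<K. J (Suc k)) \<le> (\<Sum>k\<le>K. J k)"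
      using J0[of 0] by (simp add: sum.atMost_shift)
    finally show ?thesis using JY[of K] by simp
  qed
  have "summable J"
  proof (rule summableI_nonneg_bounded)
    show "(\<Sum>k<K. J k) \<le> Y" for K
    proof -
      have "(\<Sum>k<K. J k) \<le> (\<Sum>k\<le>K. J k)" using J0 by (intro sum_mono2) auto
      then show ?thesis using JY[of K] by linarith
    qed
  qed (rule J0)
  then have J_lim: "J \<longlonglongrightarrow> 0" by (rule summable_LIMSEQ_zero)
  have LJ: "Lp_mass p (\<lambda>x. h x - W k x) \<le> J k" for k
  proof -
    have one: "1 \<le> 2 powr (real k * (2 - 2 * p))" using p by (intro ge_one_powr_ge_zero) auto
    show ?thesis using mult_right_mono[OF one Lp_mass_nonneg[of p "\<lambda>x. h x - W k x"]] by (simp add: J_def)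
  qed
  have lim: "(\<lambda>k. Lp_mass p (\<lambda>x. h x - W k x)) \<longlonglongrightarrow> 0"
  proof (rule tendsto_sandwich[OF _ _ tendsto_const J_lim])
    show "\<forall>\<^sub>F k in sequentially. 0 \<le> Lp_mass p (\<lambda>x. h x - W k x)" by (simp add: Lp_mass_nonneg)
    show "\<forall>\<^sub>F k in sequentially. Lp_mass p (\<lambda>x. h x - W k x) \<le> J k" by (simp add: LJ)
  qed
  have sa: "summable a" using a0 asum by (rule summableI_nonneg_bounded)
  define B where "B = 4608 powr (1 - p) * real n powr (2 - 2 * p)"
  \<comment> \<open>Nikolskii's inequality bounds the p-th power of an \<open>L_1\<close> norm by
    \<open>B * a k\<close>. On taking the root, \<open>(a k)^(1/p)\<close> is made linear in
    \<open>a k\<close> by means of \<open>a k \<le> 5 Y\<close>, so that the summability of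
    \<open>a\<close> suffices.\<close>
  define c where "c = (\<lambda>k. B powr (1 / p) * ((5 * Y) powr (1 / p - 1) * a k))"
  have sc: "summable c" unfolding c_def using sa by (intro summable_mult)
  have ac: "Lp_mass 1 (\<lambda>x. W (Suc k) x - W k x) \<le> c k" for k
  proof -
    have Nk: "N (Suc k) \<ge> 1" using n1 by (simp add: N_def)
    have dR: "degree (R k) + r \<le> N (Suc k)"
    proof -
      have "degree (R k) \<le> max (degree (Q (Suc k))) (degree (Q k))" unfolding R_def by (rule degree_diff_le_max)
      moreover have "degree (Q k) + r \<le> N (Suc k)" using Q[of k] by (simp add: N_def)
      moreover have "degree (Q (Suc k)) + r \<le> N (Suc k)" using Q[of "Suc k"] by (simp add: N_def)
      ultimately show ?thesis by linarith
    qed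
    have WR: "(\<lambda>x. W (Suc k) x - W k x) = (\<lambda>x. phi x ^ r * poly (R k) x)"
      by (simp add: W_def R_def right_diff_distrib fun_eq_iff)
    have "Lp_mass 1 (\<lambda>x. phi x ^ r * poly (R k) x) powr p \<le> (4608 * (real (N (Suc k)))\<^sup>2) powr (1 - p) * Lp_mass p (\<lambda>x. phi x ^ r * poly (R k) x)"
      by (rule weighted_Nikolskii[OF p dR Nk])
    also have "(4608 * (real (N (Suc k)))\<^sup>2) powr (1 - p) = B * 2 powr (real (Suc k) * (2 - 2 * p))"
    proof -
      have "real (N (Suc k)) = real n * 2 powr real (Suc k)"
        by (simp add: N_def powr_realpow mult.commute del: power_Suc of_nat_Suc)
      moreover have "0 < real n * 2 powr real (Suc k)" using n1 by simp
      ultimately have "(real (N (Suc k)))\<^sup>2 = (real n * 2 powr real (Suc k)) powr 2" by (simp del: of_nat_Suc)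
      then have "(4608 * (real (N (Suc k)))\<^sup>2) powr (1 - p) = 4608 powr (1 - p) * (real n * 2 powr real (Suc k)) powr (2 * (1 - p))"
        by (simp only: powr_mult powr_powr mult.assoc)
      also have "(real n * 2 powr real (Suc k)) powr (2 * (1 - p)) = real n powr (2 - 2 * p) * 2 powr (real (Suc k) * (2 - 2 * p))"
        by (simp only: powr_mult powr_powr) (simp add: algebra_simps)
      finally show ?thesis by (simp add: B_def)
    qed
    finally have "Lp_mass 1 (\<lambda>x. phi x ^ r * poly (R k) x) powr p \<le> B * a k" by (simp add: a_def mult.assoc)
    then have "(Lp_mass 1 (\<lambda>x. phi x ^ r * poly (R k) x) powr p) powr (1 / p) \<le> (B * a k) powr (1 / p)"
      using p by (intro powr_mono2) auto
    then have "Lp_mass 1 (\<lambda>x. phi x ^ r * poly (R k) x) \<le> B powr (1 / p) * a k powr (1 / p)"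
      using p by (simp add: powr_powr Lp_mass_nonneg powr_mult)
    also have "a k powr (1 / p) \<le> (5 * Y) powr (1 / p - 1) * a k"
    proof (cases "a k = 0")
      case False
      then have apos: "a k > 0" using a0[of k] by simp
      have "a k \<le> (\<Sum>i<Suc k. a i)" using a0 by (simp add: sum_nonneg)
      then have aY: "a k \<le> 5 * Y" using asum[of "Suc k"] by linarith
      have "a k powr (1 / p) = a k powr (1 / p - 1) * a k" using apos by (simp add: powr_diff)
      also have "\<dots> \<le> (5 * Y) powr (1 / p - 1) * a k" using apos aY p by (intro mult_right_mono powr_mono2) auto
      finally show ?thesis .
    qed simp
    finally show ?thesis by (simp add: WR c_def mult_left_mono)
  qed
  have L1: "(\<lambda>K. Lp_mass 1 (\<lambda>x. h x - W K x)) \<longlonglongrightarrow> 0"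
    by (rule L1_limit_of_Lp_limit[OF p hi Wi lim sc ac])
  have "\<forall>k. \<exists>G. (pderiv ^^ r) G = Q k \<and> degree G \<le> degree (Q k) + r"
    by (intro allI poly_iterated_antiderivative)
  from choice[OF this] obtain G where G: "(pderiv ^^ r) (G k) = Q k" "degree (G k) \<le> degree (Q k) + r" for k by blast
  have hp: "(pderiv ^^ r) (G (Suc k) - G k) = R k" for k
    unfolding R_def G(1)[symmetric] by (simp add: funpow_pderiv_diff)
  have "\<exists>P. degree P \<le> n \<and> Lp_mass p (poly (G (Suc k) - G k - P)) \<le> C0 / real n powr (real r * p) * a k" for k
  proof -
    have "degree (R k) \<le> max (degree (Q (Suc k))) (degree (Q k))" unfolding R_def by (rule degree_diff_le_max)
    moreover have "degree (Q k) + r \<le> N (Suc k)" using Q[of k] by (simp add: N_def)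
    moreover have "degree (Q (Suc k)) + r \<le> N (Suc k)" using Q[of "Suc k"] by (simp add: N_def)
    ultimately have "degree ((pderiv ^^ r) (G (Suc k) - G k)) + r \<le> N (Suc k)" unfolding hp by linarith
    moreover have "n \<le> N (Suc k)" by (simp add: N_def)
    ultimately obtain P where P: "degree P \<le> n" "Lp_mass p (poly (G (Suc k) - G k - P))
      \<le> C0 / real n powr (real r * p) * (real (N (Suc k)) / real n) powr (2 - 2 * p) * Lp_mass p (\<lambda>x. phi x ^ r * poly (R k) x)"
      using approx[of "N (Suc k)" "G (Suc k) - G k"] unfolding hp by blast
    have "real (N (Suc k)) / real n = 2 powr real (Suc k)"
      using n1 by (simp add: N_def powr_realpow del: power_Suc of_nat_Suc)
    then have "(real (N (Suc k)) / real n) powr (2 - 2 * p) = 2 powr (real (Suc k) * (2 - 2 * p))"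
      by (simp only: powr_powr)
    then show ?thesis using P by (intro exI[of _ P]) (simp add: a_def mult.assoc del: of_nat_Suc poly_diff)
  qed
  then obtain P where P: "\<And>k. degree (P k) \<le> n" "\<And>k. Lp_mass p (poly (G (Suc k) - G k - P k)) \<le> C0 / real n powr (real r * p) * a k"
    by (metis (no_types))
  have fc: "continuous_on {-1..1} f" by (rule nth_deriv_AC_continuous[OF f r])
  have bound: "best_approx n f p (\<lambda>_. 1) powr p \<le> 2 * Lp_mass 1 (\<lambda>x. h x - W K x) powr p + C0 / real n powr (real r * p) * (5 * Y)" for K
  proof -
    obtain T where T: "degree T \<le> r - 1"
      "(\<integral>\<^sup>+x. ennreal \<bar>f x - poly (G K) x - poly T x\<bar> * indicator {-1..1} x \<partial>lebesgue)
      \<le> (\<integral>\<^sup>+x. ennreal \<bar>phi x ^ r * (nth_deriv r f x - poly ((pderiv ^^ r) (G K)) x)\<bar> * indicator {-1..1} x \<partial>lebesgue)"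
      using weighted_Taylor_remainder[OF f r, of "G K"] by blast
    define u where "u = (\<lambda>x. f x - poly (G K) x - poly T x)"
    have ui: "integrable ?M u" unfolding u_def using fc by (intro integrable_continuous_unit continuous_intros)
    have "(\<integral>\<^sup>+x. ennreal \<bar>u x\<bar> \<partial>?M) \<le> (\<integral>\<^sup>+x. ennreal \<bar>h x - W K x\<bar> \<partial>?M)"
      using T(2) by (simp add: nn_integral_restrict_space u_def G(1) heq)
    then have "ennreal (Lp_mass 1 u) \<le> ennreal (Lp_mass 1 (\<lambda>x. h x - W K x))"
      using nn_integral_Lp_mass[OF ui, of 1] nn_integral_Lp_mass[OF hW, of 1 K] by simp
    then have uL: "Lp_mass 1 u \<le> Lp_mass 1 (\<lambda>x. h x - W K x)" by (simp add: Lp_mass_nonneg)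
    \<comment> \<open>\<open>G 0\<close> already has degree at most \<open>n\<close>; only the
      increments are approximated.\<close>
    define PP where "PP = T + G 0 + (\<Sum>k<K. P k)"
    have "degree (G 0) \<le> n" using G(2)[of 0] Q[of 0] by simp
    then have dP: "degree PP \<le> n" unfolding PP_def using T(1) n P(1) by (intro degree_add_le degree_sum_le) auto
    have eq: "1 * (f x - poly PP x) = u x + (\<Sum>k<K. poly (G (Suc k) - G k - P k) x)" for x
    proof -
      have "(\<Sum>k<K. poly (G (Suc k)) x - poly (G k) x) = poly (G K) x - poly (G 0) x"
        by (rule sum_lessThan_telescope)
      then show ?thesis by (simp add: PP_def u_def poly_sum sum_subtractf)
    qed
    have Hi: "integrable ?M (poly (G (Suc k) - G k - P k))" for k
      by (intro integrable_continuous_unit continuous_on_poly continuous_on_id)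
    have Hs: "integrable ?M (\<lambda>x. \<Sum>k<K. poly (G (Suc k) - G k - P k) x)"
      by (rule Bochner_Integration.integrable_sum) (rule Hi)
    have "best_approx n f p (\<lambda>_. 1) powr p \<le> Lp_mass p (\<lambda>x. 1 * (f x - poly PP x))"
      using p dP by (intro best_approx_powr_le) auto
    also have "\<dots> = Lp_mass p (\<lambda>x. u x + (\<Sum>k<K. poly (G (Suc k) - G k - P k) x))" unfolding eq ..
    also have "\<dots> \<le> Lp_mass p u + Lp_mass p (\<lambda>x. \<Sum>k<K. poly (G (Suc k) - G k - P k) x)"
      using p by (intro Lp_mass_add ui Hs) auto
    also have "Lp_mass p (\<lambda>x. \<Sum>k<K. poly (G (Suc k) - G k - P k) x) \<le> (\<Sum>k<K. Lp_mass p (poly (G (Suc k) - G k - P k)))"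
      using p by (intro Lp_mass_sum Hi) auto
    also have "\<dots> \<le> (\<Sum>k<K. C0 / real n powr (real r * p) * a k)" by (intro sum_mono P(2))
    also have "\<dots> = C0 / real n powr (real r * p) * (\<Sum>k<K. a k)" by (simp add: sum_distrib_left)
    also have "\<dots> \<le> C0 / real n powr (real r * p) * (5 * Y)" using C0 by (intro mult_left_mono asum) auto
    also have "Lp_mass p u \<le> 2 * Lp_mass 1 u powr p" by (rule Lp_mass_le_L1[OF ui p])
    also have "\<dots> \<le> 2 * Lp_mass 1 (\<lambda>x. h x - W K x) powr p"
      using uL p by (intro mult_left_mono powr_mono2) (auto simp: Lp_mass_nonneg)
    finally show ?thesis by simp
  qed
  have "(\<lambda>K. 2 * Lp_mass 1 (\<lambda>x. h x - W K x) powr p + C0 / real n powr (real r * p) * (5 * Y)) \<longlonglongrightarrow> 2 * 0 powr p + C0 / real n powr (real r * p) * (5 * Y)"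
    using p by (intro tendsto_intros tendsto_powr' L1) (auto simp: Lp_mass_nonneg)
  then have "best_approx n f p (\<lambda>_. 1) powr p \<le> 2 * 0 powr p + C0 / real n powr (real r * p) * (5 * Y)"
    by (rule LIMSEQ_le_const) (use bound in auto)
  then show ?thesis by simp
qed

lemma simultaneous_approximation_powr:
  assumes p: "0 < p" "p < 1" and r: "r \<ge> 1"
  shows "\<exists>C\<ge>0. \<forall>f. nth_deriv_AC (r - 1) f \<longrightarrow>
      (\<lambda>x. phi x ^ r * nth_deriv r f x) absolutely_integrable_on {-1..1} \<longrightarrow>
      (\<lambda>\<nu>. real \<nu> powr (1 - 2 * p) *
           best_approx (\<nu> - r) (nth_deriv r f) p (\<lambda>x. phi x ^ r) powr p) summable_on {r + 1..} \<longrightarrow>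
      (\<forall>n\<ge>r. best_approx n f p (\<lambda>_. 1) powr p
          \<le> C / real n powr (real r * p) *
             (best_approx (n - r) (nth_deriv r f) p (\<lambda>x. phi x ^ r) powr p
              + real n powr (2 * p - 2) *
                (\<Sum>\<^sub>\<infinity>\<nu>\<in>{n + 1..}. real \<nu> powr (1 - 2 * p) *
                   best_approx (\<nu> - r) (nth_deriv r f) p (\<lambda>x. phi x ^ r) powr p)))"
proof -
  obtain C0 where C0: "C0 \<ge> 0" "\<And>n N F. r \<le> n \<Longrightarrow> n \<le> N \<Longrightarrow> degree ((pderiv ^^ r) F) + r \<le> N \<Longrightarrow>
    \<exists>P. degree P \<le> n \<and> Lp_mass p (poly (F - P))
        \<le> C0 / real n powr (real r * p) * (real N / real n) powr (2 - 2 * p) * Lp_mass p (\<lambda>x. phi x ^ r * poly ((pderiv ^^ r) F) x)"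
    using poly_approximation[OF p r] by blast
  show ?thesis
  \<comment> \<open>The \<open>5\<close> of the preceding lemma times the \<open>4\<close> of the
    dyadic comparison.\<close>
  proof (intro exI[of _ "20 * C0"] conjI allI impI)
    show "0 \<le> 20 * C0" using C0(1) by simp
    fix f n
    assume f: "nth_deriv_AC (r - 1) f" and g: "(\<lambda>x. phi x ^ r * nth_deriv r f x) absolutely_integrable_on {-1..1}"
      and sm: "(\<lambda>\<nu>. real \<nu> powr (1 - 2 * p) * best_approx (\<nu> - r) (nth_deriv r f) p (\<lambda>x. phi x ^ r) powr p) summable_on {r + 1..}"
      and n: "r \<le> n"
    have n1: "n \<ge> 1" using n r by simp
    define b where "b = (\<lambda>\<nu>. best_approx (\<nu> - r) (nth_deriv r f) p (\<lambda>x. phi x ^ r) powr p)"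
    define S where "S = (\<Sum>\<^sub>\<infinity>\<nu>\<in>{n + 1..}. real \<nu> powr (1 - 2 * p) * b \<nu>)"
    have b0: "b i \<ge> 0" for i by (simp add: b_def)
    have bm: "b j \<le> b i" if "i \<le> j" for i j
      unfolding b_def using p that by (intro powr_mono2 best_approx_nonneg best_approx_antimono) auto
    have sm': "(\<lambda>\<nu>. real \<nu> powr (1 - 2 * p) * b \<nu>) summable_on {n + 1..}"
      using sm unfolding b_def by (rule summable_on_subset_banach) (use n in auto)
    define X where "X = C0 / real n powr (real r * p)"
    have X0: "X \<ge> 0" using C0 by (simp add: X_def)
    have main: "best_approx n f p (\<lambda>_. 1) powr p \<le> X * (5 * (b n + 4 * real n powr (2 * p - 2) * S + 2 * \<eta>))" if \<eta>: "\<eta> > 0" for \<eta>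
    proof -
      \<comment> \<open>The tolerance \<open>\<eta> / 8^k\<close> outweighs the factors
        \<open>2^(k(2-2p)) \<le> 4^k\<close>; the weighted tolerances sum to at most
        \<open>2 \<eta>\<close>.\<close>
      have "\<forall>k. \<exists>q. degree q \<le> 2 ^ k * n - r \<and> Lp_mass p (\<lambda>x. phi x ^ r * (nth_deriv r f x - poly q x)) \<le> b (2 ^ k * n) + \<eta> / 8 ^ k"
        unfolding b_def using p \<eta> by (intro allI best_approx_near) auto
      from choice[OF this] obtain Q where Q: "degree (Q k) \<le> 2 ^ k * n - r"
        "Lp_mass p (\<lambda>x. phi x ^ r * (nth_deriv r f x - poly (Q k) x)) \<le> b (2 ^ k * n) + \<eta> / 8 ^ k" for k :: nat by blast
      have nk: "r \<le> 2 ^ k * n" for k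
      proof -
        have "1 * n \<le> 2 ^ k * n" by (rule mult_le_mono1) simp
        then show ?thesis using n by linarith
      qed
      have "(\<Sum>k\<le>K. 2 powr (real k * (2 - 2 * p)) * Lp_mass p (\<lambda>x. phi x ^ r * (nth_deriv r f x - poly (Q k) x)))
          \<le> b n + 4 * real n powr (2 * p - 2) * S + 2 * \<eta>" for K
      proof -
        have "(\<Sum>k\<le>K. 2 powr (real k * (2 - 2 * p)) * Lp_mass p (\<lambda>x. phi x ^ r * (nth_deriv r f x - poly (Q k) x)))
           \<le> (\<Sum>k\<le>K. 2 powr (real k * (2 - 2 * p)) * b (2 ^ k * n) + \<eta> * (1/2) ^ k)"
        proof (rule sum_mono)
          fix k
          have "2 powr (real k * (2 - 2 * p)) \<le> 2 powr (real k * 2)" using p by (intro powr_mono mult_left_mono) auto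
          also have "\<dots> = (2 powr 2) powr real k" by (simp only: powr_powr mult.commute)
          also have "\<dots> = 4 ^ k" by (simp add: powr_realpow)
          finally have "2 powr (real k * (2 - 2 * p)) * (\<eta> / 8 ^ k) \<le> 4 ^ k * (\<eta> / 8 ^ k)" using \<eta> by (intro mult_right_mono) auto
          also have "4 ^ k * (\<eta> / 8 ^ k) = \<eta> * (4 / 8) ^ k" by (simp only: power_divide) simp
          also have "(4 / 8 :: real) = 1/2" by simp
          finally have e: "2 powr (real k * (2 - 2 * p)) * (\<eta> / 8 ^ k) \<le> \<eta> * (1/2) ^ k" .
          have "2 powr (real k * (2 - 2 * p)) * Lp_mass p (\<lambda>x. phi x ^ r * (nth_deriv r f x - poly (Q k) x))
             \<le> 2 powr (real k * (2 - 2 * p)) * (b (2 ^ k * n) + \<eta> / 8 ^ k)" by (intro mult_left_mono Q(2)) auto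
          also have "\<dots> = 2 powr (real k * (2 - 2 * p)) * b (2 ^ k * n) + 2 powr (real k * (2 - 2 * p)) * (\<eta> / 8 ^ k)" by (rule distrib_left)
          finally show "2 powr (real k * (2 - 2 * p)) * Lp_mass p (\<lambda>x. phi x ^ r * (nth_deriv r f x - poly (Q k) x))
             \<le> 2 powr (real k * (2 - 2 * p)) * b (2 ^ k * n) + \<eta> * (1/2) ^ k" using e by linarith
        qed
        also have "\<dots> = (\<Sum>k\<le>K. 2 powr (real k * (2 - 2 * p)) * b (2 ^ k * n)) + \<eta> * (\<Sum>k\<le>K. (1/2) ^ k)"
          by (simp add: sum.distrib sum_distrib_left)
        also have "(\<Sum>k\<le>K. 2 powr (real k * (2 - 2 * p)) * b (2 ^ k * n)) = b n + (\<Sum>k=1..K. 2 powr (real k * (2 - 2 * p)) * b (2 ^ k * n))"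
          by (simp add: sum.atMost_shift sum.atLeast1_atMost_eq lessThan_Suc_atMost)
        also have "(\<Sum>k=1..K. 2 powr (real k * (2 - 2 * p)) * b (2 ^ k * n)) = real n powr (2 * p - 2) * (\<Sum>k=1..K. real (2 ^ k * n) powr (2 - 2 * p) * b (2 ^ k * n))"
          unfolding sum_distrib_left
        proof (rule sum.cong[OF refl])
          fix k
          have "real (2 ^ k * n) = 2 powr real k * real n" by (simp add: powr_realpow)
          then have "real (2 ^ k * n) powr (2 - 2 * p) = 2 powr (real k * (2 - 2 * p)) * real n powr (2 - 2 * p)"
            by (simp only: powr_mult powr_powr)
          then have e: "real n powr (2 * p - 2) * (real (2 ^ k * n) powr (2 - 2 * p) * b (2 ^ k * n))
              = (real n powr (2 * p - 2) * real n powr (2 - 2 * p)) * (2 powr (real k * (2 - 2 * p)) * b (2 ^ k * n))"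
            by (simp only: mult_ac)
          have uv: "real n powr (2 * p - 2) * real n powr (2 - 2 * p) = 1" using n1 by (simp add: powr_add[symmetric])
          show "2 powr (real k * (2 - 2 * p)) * b (2 ^ k * n) = real n powr (2 * p - 2) * (real (2 ^ k * n) powr (2 - 2 * p) * b (2 ^ k * n))"
            unfolding e uv mult_1 ..
        qed
        finally have main: "(\<Sum>k\<le>K. 2 powr (real k * (2 - 2 * p)) * Lp_mass p (\<lambda>x. phi x ^ r * (nth_deriv r f x - poly (Q k) x)))
           \<le> b n + real n powr (2 * p - 2) * (\<Sum>k=1..K. real (2 ^ k * n) powr (2 - 2 * p) * b (2 ^ k * n)) + \<eta> * (\<Sum>k\<le>K. (1/2) ^ k)" .
        have geo: "(\<Sum>k\<le>K. (1/2::real) ^ k) \<le> 2"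
          using sum_le_suminf[of "\<lambda>k. (1/2::real) ^ k" "{..K}"] suminf_geometric[of "1/2::real"] by (simp add: summable_geometric)
        have ge: "\<eta> * (\<Sum>k\<le>K. (1/2::real) ^ k) \<le> \<eta> * 2" using geo \<eta> by (intro mult_left_mono) auto
        have "(\<Sum>k=1..K. real (2 ^ k * n) powr (2 - 2 * p) * b (2 ^ k * n)) \<le> 4 * (\<Sum>\<nu>\<in>{n+1..2 ^ K * n}. real \<nu> powr (1 - 2 * p) * b \<nu>)"
          by (rule dyadic_sum_le[OF p n1 bm b0])
        also have "(\<Sum>\<nu>\<in>{n+1..2 ^ K * n}. real \<nu> powr (1 - 2 * p) * b \<nu>) \<le> S"
          unfolding S_def using b0 by (intro finite_sum_le_infsum sm') auto
        finally have "real n powr (2 * p - 2) * (\<Sum>k=1..K. real (2 ^ k * n) powr (2 - 2 * p) * b (2 ^ k * n)) \<le> real n powr (2 * p - 2) * (4 * S)"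
          by (intro mult_left_mono) auto
        then have dy: "real n powr (2 * p - 2) * (\<Sum>k=1..K. real (2 ^ k * n) powr (2 - 2 * p) * b (2 ^ k * n)) \<le> 4 * real n powr (2 * p - 2) * S"
          by simp
        show ?thesis using main ge dy by linarith
      qed
      then show ?thesis unfolding X_def
        using Q(1) nk by (intro simultaneous_approximation_step[OF p r n C0(1) C0(2)[OF n] f g]) (auto simp: le_diff_conv2)
    qed
    have "((\<lambda>\<eta>. X * (5 * (b n + 4 * real n powr (2 * p - 2) * S + 2 * \<eta>))) \<longlongrightarrow> X * (5 * (b n + 4 * real n powr (2 * p - 2) * S + 2 * 0))) (at_right 0)"
      by (intro tendsto_intros)
    moreover have "\<forall>\<^sub>F \<eta> in at_right 0. best_approx n f p (\<lambda>_. 1) powr p \<le> X * (5 * (b n + 4 * real n powr (2 * p - 2) * S + 2 * \<eta>))"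
      by (rule eventually_mono[OF eventually_at_right_less[of 0]]) (rule main)
    ultimately have "best_approx n f p (\<lambda>_. 1) powr p \<le> X * (5 * (b n + 4 * real n powr (2 * p - 2) * S + 2 * 0))"
      by (rule tendsto_lowerbound) simp
    also have "\<dots> \<le> X * (20 * (b n + real n powr (2 * p - 2) * S))"
      using X0 b0[of n] by (intro mult_left_mono) auto
    also have "\<dots> = 20 * C0 / real n powr (real r * p) * (b n + real n powr (2 * p - 2) * S)" by (simp add: X_def)
    finally show "best_approx n f p (\<lambda>_. 1) powr p
          \<le> 20 * C0 / real n powr (real r * p) *
             (best_approx (n - r) (nth_deriv r f) p (\<lambda>x. phi x ^ r) powr p
              + real n powr (2 * p - 2) *
                (\<Sum>\<^sub>\<infinity>\<nu>\<in>{n + 1..}. real \<nu> powr (1 - 2 * p) *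
                   best_approx (\<nu> - r) (nth_deriv r f) p (\<lambda>x. phi x ^ r) powr p))"
      by (simp only: b_def S_def)
  qed
qed

theorem theorem4p1:
  fixes r :: nat
  assumes "r \<ge> 1"
  shows "\<exists>n\<^sub>r :: nat. \<forall>p :: real. 0 < p \<and> p < 1 \<longrightarrow>
    (\<exists>C :: real. \<forall>f :: real \<Rightarrow> real.
      nth_deriv_AC (r - 1) f \<and>
      (\<lambda>x. phi x ^ r * nth_deriv r f x) absolutely_integrable_on {-1..1} \<and>
      (\<lambda>\<nu>. real \<nu> powr (1 - 2 * p) *
           best_approx (\<nu> - r) (nth_deriv r f) p (\<lambda>x. phi x ^ r) powr p) summable_on {r + 1..}
      \<longrightarrow>
      (\<forall>n\<ge>n\<^sub>r.
        best_approx n f p (\<lambda>_. 1)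
          \<le> C / real n ^ r *
             (best_approx (n - r) (nth_deriv r f) p (\<lambda>x. phi x ^ r)
              + real n powr (2 - 2 / p) *
                (\<Sum>\<^sub>\<infinity>\<nu>\<in>{n + 1..}. real \<nu> powr (1 - 2 * p) *
                   best_approx (\<nu> - r) (nth_deriv r f) p (\<lambda>x. phi x ^ r) powr p) powr (1 / p))))"
\<comment> \<open>The threshold \<open>r\<close> serves every \<open>p\<close>: it makes
  \<open>n - r\<close> a genuine difference of natural numbers and \<open>n\<close>
  positive.\<close>
proof (rule exI[of _ r], intro allI impI)
  fix p :: real assume "0 < p \<and> p < 1"
  then have p: "0 < p" "p < 1" by auto
  obtain C where C: "C \<ge> 0" "\<And>f n. nth_deriv_AC (r - 1) f \<Longrightarrow>
      (\<lambda>x. phi x ^ r * nth_deriv r f x) absolutely_integrable_on {-1..1} \<Longrightarrow>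
      (\<lambda>\<nu>. real \<nu> powr (1 - 2 * p) *
           best_approx (\<nu> - r) (nth_deriv r f) p (\<lambda>x. phi x ^ r) powr p) summable_on {r + 1..} \<Longrightarrow>
      n \<ge> r \<Longrightarrow> best_approx n f p (\<lambda>_. 1) powr p
          \<le> C / real n powr (real r * p) *
             (best_approx (n - r) (nth_deriv r f) p (\<lambda>x. phi x ^ r) powr p
              + real n powr (2 * p - 2) *
                (\<Sum>\<^sub>\<infinity>\<nu>\<in>{n + 1..}. real \<nu> powr (1 - 2 * p) *
                   best_approx (\<nu> - r) (nth_deriv r f) p (\<lambda>x. phi x ^ r) powr p))"
    using simultaneous_approximation_powr[OF p assms] by blast
  show "\<exists>C :: real. \<forall>f :: real \<Rightarrow> real.
      nth_deriv_AC (r - 1) f \<and>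
      (\<lambda>x. phi x ^ r * nth_deriv r f x) absolutely_integrable_on {-1..1} \<and>
      (\<lambda>\<nu>. real \<nu> powr (1 - 2 * p) *
           best_approx (\<nu> - r) (nth_deriv r f) p (\<lambda>x. phi x ^ r) powr p) summable_on {r + 1..}
      \<longrightarrow>
      (\<forall>n\<ge>r.
        best_approx n f p (\<lambda>_. 1)
          \<le> C / real n ^ r *
             (best_approx (n - r) (nth_deriv r f) p (\<lambda>x. phi x ^ r)
              + real n powr (2 - 2 / p) *
                (\<Sum>\<^sub>\<infinity>\<nu>\<in>{n + 1..}. real \<nu> powr (1 - 2 * p) *
                   best_approx (\<nu> - r) (nth_deriv r f) p (\<lambda>x. phi x ^ r) powr p) powr (1 / p)))"
  \<comment> \<open>Returning from p-th powers to quasi-norms costs \<open>2^(1/p)\<close>, for the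
    root of a sum of two terms.\<close>
  proof (rule exI[of _ "(2 * C) powr (1 / p)"], intro allI impI)
    fix f :: "real \<Rightarrow> real" and n
    let ?E = "best_approx (n - r) (nth_deriv r f) p (\<lambda>x. phi x ^ r)"
    let ?S = "\<Sum>\<^sub>\<infinity>\<nu>\<in>{n + 1..}. real \<nu> powr (1 - 2 * p) * best_approx (\<nu> - r) (nth_deriv r f) p (\<lambda>x. phi x ^ r) powr p"
    assume H: "nth_deriv_AC (r - 1) f \<and>
      (\<lambda>x. phi x ^ r * nth_deriv r f x) absolutely_integrable_on {-1..1} \<and>
      (\<lambda>\<nu>. real \<nu> powr (1 - 2 * p) *
           best_approx (\<nu> - r) (nth_deriv r f) p (\<lambda>x. phi x ^ r) powr p) summable_on {r + 1..}" and n: "r \<le> n"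
    have n0: "real n > 0" using n assms by simp
    have S0: "?S \<ge> 0" by (intro infsum_nonneg) simp
    have E0: "?E \<ge> 0" "best_approx n f p (\<lambda>_. 1) \<ge> 0" by (rule best_approx_nonneg)+
    have "best_approx n f p (\<lambda>_. 1) = (best_approx n f p (\<lambda>_. 1) powr p) powr (1 / p)"
      using p E0 by (simp add: powr_powr)
    also have "\<dots> \<le> (C / real n powr (real r * p) * (?E powr p + real n powr (2 * p - 2) * ?S)) powr (1 / p)"
      using C(2)[of f n] H n p by (intro powr_mono2) auto
    also have "\<dots> = (C / real n powr (real r * p)) powr (1 / p) * (?E powr p + real n powr (2 * p - 2) * ?S) powr (1 / p)"
      by (rule powr_mult)
    also have "\<dots> \<le> (C / real n powr (real r * p)) powr (1 / p) * (2 powr (1 / p) * ((?E powr p) powr (1 / p) + (real n powr (2 * p - 2) * ?S) powr (1 / p)))"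
      using p S0 by (intro mult_left_mono powr_add_le_max) auto
    also have "(?E powr p) powr (1 / p) = ?E" using p E0 by (simp add: powr_powr)
    also have "(real n powr (2 * p - 2) * ?S) powr (1 / p) = real n powr (2 - 2 / p) * ?S powr (1 / p)"
      using p by (simp add: powr_mult powr_powr diff_divide_distrib)
    also have "(C / real n powr (real r * p)) powr (1 / p) = C powr (1 / p) / real n ^ r"
      using C(1) n0 p by (simp add: powr_divide powr_powr powr_realpow)
    also have "C powr (1 / p) / real n ^ r * (2 powr (1 / p) * (?E + real n powr (2 - 2 / p) * ?S powr (1 / p)))
      = (2 * C) powr (1 / p) / real n ^ r * (?E + real n powr (2 - 2 / p) * ?S powr (1 / p))"
      by (simp add: powr_mult)
    finally show "best_approx n f p (\<lambda>_. 1) \<le> (2 * C) powr (1 / p) / real n ^ r * (?E + real n powr (2 - 2 / p) * ?S powr (1 / p))" .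
  qed
qed

end
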